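(* Let $K$ be a field and let $G$ be an arbitrary finite simple graph, with edge ideal $I(G)$ over $K$. Then one has $$\operatorname{indmat}(G)\le \operatorname{reg}R(I(G)).$$
   Context: Let $G$ be a finite simple graph with $V(G)=[n]=\{1,\dots,n\}$ and edge set $E(G)$, and let $S=K[x_1,\dots,x_n]$ be the polynomial ring over a field $K$. The edge ideal $I(G)\subset S$ is the ideal generated by the monomials $x_ix_j$ with $\{i,j\}\in E(G)$. The edge ring $K[G]$ of a graph $G$ is the $K$-algebra generated by the monomials $x_ix_j$ with $\{i,j\}\in E(G)$. The Rees algebra of an ideal $I$ is $R(I)=\bigoplus_{s\ge 0}I^s$. $G^*$ denotes the graph with $V(G^* )=[n+1]$ and $E(G^* )=E(G)\cup\{\{i,n+1\}: i\in V(G)\}$. The Rees algebra $R(I(G))$ is identified with the edge ring $K[G^*]$, the monomial $x_ix_{n+1}$ corresponding to $x_i\in S$ (in Rees degree $0$) and $x_ix_j$, for $\{i,j\}\in E(G)$, corresponding to the generator $x_ix_j\in I(G)$ (in Rees degree $1$). Through this identification $R(I(G))$ is a standard graded $K$-algebra, each of the $n+|E(G)|$ monomial generators having degree $1$. For a standard graded toric $K$-algebra $A$ minimally generated by monomials $u_1,\dots,u_m$, let $P=K[t_1,\dots,t_m]$ be the standard graded polynomial ring, mapping onto $A$ by $t_k\mapsto u_k$; put $\beta_{i,j}(A)=\dim_K\operatorname{Tor}_i^P(A,K)_j$ and $\operatorname{reg}A=\max\{j-i:\beta_{i,j}(A)\ne 0\}$ (Castelnuovo–Mumford regularity). A matching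 of $G$ is a subset $M\subset E(G)$ with $e\cap e'=\emptyset$ for all $e,e'\in M$ with $e\ne e'$. An induced matching of $G$ is a matching $M$ such that for all $e,e'\in M$ with $e\ne e'$ there is no edge $f\in E(G)$ with $e\cap f\ne\emptyset$ and $e'\cap f\ne\emptyset$. The induced matching number $\operatorname{indmat}(G)$ is the maximal cardinality of an induced matching of $G$.
   Formalization: Graphs with exactly one edge are excluded: for every such graph R(I(G)) is a polynomial ring on its monomial generators, so its regularity is 0 while indmat(G) = 1, and the inequality fails; all other finite simple graphs are covered. *)

theory Defs
  imports
    "HOL-Library.Poly_Mapping"
    "HOL-Library.Function_Algebras"
    "HOL-Computational_Algebra.Polynomial"
    "HOL-Algebra.Ideal_Product"
begin

section \<open>Polynomial rings\<close>

text \<open>Polynomials over \<open>'k\<close> in variables from \<open>'x\<close>: exponent vectors are finitely supported maps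
  \<open>'x \<Rightarrow>\<^sub>0 nat\<close>. The polynomial ring in a set \<open>X\<close> of variables is a subset of this type.\<close>

type_synonym ('x, 'k) mpoly = "('x \<Rightarrow>\<^sub>0 nat) \<Rightarrow>\<^sub>0 'k"

definition mconst :: "'k \<Rightarrow> ('x, 'k::zero) mpoly" where
  "mconst c = Poly_Mapping.single 0 c"

definition mvar :: "'x \<Rightarrow> ('x, 'k::zero_neq_one) mpoly" where
  "mvar x = Poly_Mapping.single (Poly_Mapping.single x 1) 1"

definition mpolys :: "'x set \<Rightarrow> ('x, 'k::zero) mpoly set" where
  "mpolys X = {p. \<forall>m\<in>Poly_Mapping.keys p. Poly_Mapping.keys m \<subseteq> X}"

definition mdeg :: "('x \<Rightarrow>\<^sub>0 nat) \<Rightarrow> nat" where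
  "mdeg m = (\<Sum>x\<in>Poly_Mapping.keys m. Poly_Mapping.lookup m x)"

text \<open>The component of degree \<open>d\<close> in the standard grading (zero for negative \<open>d\<close>).\<close>

definition mpolys_hom :: "'x set \<Rightarrow> int \<Rightarrow> ('x, 'k::zero) mpoly set" where
  "mpolys_hom X d = {p \<in> mpolys X. \<forall>m\<in>Poly_Mapping.keys p. int (mdeg m) = d}"

definition mpoly_ring :: "'x set \<Rightarrow> ('x, 'k::field) mpoly ring" where
  "mpoly_ring X = \<lparr>carrier = mpolys X, mult = (*), one = 1, zero = 0, add = (+)\<rparr>"

text \<open>Evaluation \<open>x \<mapsto> u x\<close>, with coefficients mapped by \<open>\<iota>\<close>.\<close>

definition meval :: "('k \<Rightarrow> 'a) \<Rightarrow> ('x \<Rightarrow> 'a) \<Rightarrow> ('x, 'k::zero) mpoly \<Rightarrow> 'a::comm_ring_1" where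
  "meval \<iota> u p = (\<Sum>m\<in>Poly_Mapping.keys p. \<iota> (Poly_Mapping.lookup p m) *
     (\<Prod>x\<in>Poly_Mapping.keys m. u x ^ Poly_Mapping.lookup m x))"

section \<open>Graded modules, graded free resolutions and Tor\<close>

text \<open>A graded module over a graded ring with elements in \<open>'p\<close>, living inside the abelian
  group \<open>'m\<close>: its underlying set, its homogeneous components, and the scalar multiplication.\<close>

record ('p, 'm) gmodule =
  gcarrier :: "'m set"
  gcomp :: "int \<Rightarrow> 'm set"
  gact :: "'p \<Rightarrow> 'm \<Rightarrow> 'm"

text \<open>An augmented complex of finitely generated graded free modules. The basis of the
  module \<open>F\<^sub>i\<close> is indexed by the numbers below \<open>frank i\<close>, the basis element \<open>b\<close> having degree
  \<open>fdeg i b\<close>; the entry \<open>fmat i b c\<close> is the coefficient at the basis element \<open>c\<close> of \<open>F\<^sub>i\<close> of the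
  image of the basis element \<open>b\<close> of \<open>F\<^bsub>i+1\<^esub>\<close>; and \<open>faug b\<close> is the image of the basis element \<open>b\<close>
  of \<open>F\<^sub>0\<close> in the resolved module.\<close>

record ('p, 'm) fcomplex =
  frank :: "nat \<Rightarrow> nat"
  fdeg :: "nat \<Rightarrow> nat \<Rightarrow> int"
  fmat :: "nat \<Rightarrow> nat \<Rightarrow> nat \<Rightarrow> 'p"
  faug :: "nat \<Rightarrow> 'm"

definition fmod :: "'x set \<Rightarrow> (('x, 'k) mpoly, 'm) fcomplex \<Rightarrow> nat
    \<Rightarrow> (nat \<Rightarrow> ('x, 'k::field) mpoly) set" where
  "fmod X F i = {v. \<forall>b. if b < frank F i then v b \<in> mpolys X else v b = 0}"

definition fdiff :: "(('x, 'k) mpoly, 'm) fcomplex \<Rightarrow> nat \<Rightarrow> (nat \<Rightarrow> ('x, 'k::field) mpoly)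
    \<Rightarrow> nat \<Rightarrow> ('x, 'k) mpoly" where
  "fdiff F i v = (\<lambda>c. if c < frank F i then \<Sum>b<frank F (Suc i). v b * fmat F i b c else 0)"

definition faugmap :: "(('x, 'k::field) mpoly, 'm::ab_group_add) gmodule
    \<Rightarrow> (('x, 'k) mpoly, 'm) fcomplex \<Rightarrow> (nat \<Rightarrow> ('x, 'k) mpoly) \<Rightarrow> 'm" where
  "faugmap M F v = (\<Sum>b<frank F 0. gact M (v b) (faug F b))"

definition graded_free_resolution ::
  "'x set \<Rightarrow> (('x, 'k::field) mpoly, 'm::ab_group_add) gmodule
    \<Rightarrow> (('x, 'k) mpoly, 'm) fcomplex \<Rightarrow> bool" where
  "graded_free_resolution X M F \<longleftrightarrow>
     (\<forall>i. \<forall>b<frank F (Suc i). \<forall>c<frank F i.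
        fmat F i b c \<in> mpolys_hom X (fdeg F (Suc i) b - fdeg F i c)) \<and>
     (\<forall>b<frank F 0. faug F b \<in> gcomp M (fdeg F 0 b)) \<and>
     faugmap M F ` fmod X F 0 = gcarrier M \<and>
     {v \<in> fmod X F 0. faugmap M F v = 0} = fdiff F 0 ` fmod X F (Suc 0) \<and>
     (\<forall>i. {v \<in> fmod X F (Suc i). fdiff F i v = (\<lambda>_. 0)} = fdiff F (Suc i) ` fmod X F (Suc (Suc i)))"

text \<open>The complex \<open>F \<otimes> N\<close>: the module \<open>F\<^sub>i \<otimes> N\<close> is a direct sum of copies of \<open>N\<close>, one for each basis
  element of \<open>F\<^sub>i\<close>, shifted by the degree of that basis element.\<close>

definition tensor_comp :: "('p, 'm) fcomplex \<Rightarrow> ('p, 'n::ab_group_add) gmodule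
    \<Rightarrow> nat \<Rightarrow> int \<Rightarrow> (nat \<Rightarrow> 'n) set" where
  "tensor_comp F N i j =
     {w. \<forall>b. if b < frank F i then w b \<in> gcomp N (j - fdeg F i b) else w b = 0}"

definition tensor_diff :: "('p, 'm) fcomplex \<Rightarrow> ('p, 'n::ab_group_add) gmodule
    \<Rightarrow> nat \<Rightarrow> (nat \<Rightarrow> 'n) \<Rightarrow> nat \<Rightarrow> 'n" where
  "tensor_diff F N i w =
     (\<lambda>c. if c < frank F i then \<Sum>b<frank F (Suc i). gact N (fmat F i b c) (w b) else 0)"

fun tensor_cycles :: "('p, 'm) fcomplex \<Rightarrow> ('p, 'n::ab_group_add) gmodule
    \<Rightarrow> nat \<Rightarrow> int \<Rightarrow> (nat \<Rightarrow> 'n) set" where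
  "tensor_cycles F N 0 j = tensor_comp F N 0 j"
| "tensor_cycles F N (Suc i) j = {w \<in> tensor_comp F N (Suc i) j. tensor_diff F N i w = (\<lambda>_. 0)}"

definition tensor_boundaries :: "('p, 'm) fcomplex \<Rightarrow> ('p, 'n::ab_group_add) gmodule
    \<Rightarrow> nat \<Rightarrow> int \<Rightarrow> (nat \<Rightarrow> 'n) set" where
  "tensor_boundaries F N i j = tensor_diff F N i ` tensor_comp F N (Suc i) j"

text \<open>The \<open>'k\<close>-dimension of the degree \<open>j\<close> component of Tor, that is, of cycles modulo
  boundaries, computed from some graded free resolution of the first argument. It is meant for \<open>N\<close>
  with finite-dimensional components, where the dimension of the quotient is the difference.\<close>

definition tor_dim :: "'x set \<Rightarrow> (('x, 'k::field) mpoly, 'm::ab_group_add) gmodule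
    \<Rightarrow> (('x, 'k) mpoly, 'n::ab_group_add) gmodule \<Rightarrow> nat \<Rightarrow> int \<Rightarrow> nat" where
  "tor_dim X M N i j =
     (let F = (SOME F. graded_free_resolution X M F);
          vdim = vector_space.dim (\<lambda>(c::'k) w b. gact N (mconst c) (w b))
      in vdim (tensor_cycles F N i j) - vdim (tensor_boundaries F N i j))"

text \<open>The residue field \<open>K\<close>, concentrated in degree 0; a polynomial acts by its constant term.\<close>

definition residue_field :: "(('x, 'k::field) mpoly, 'k) gmodule" where
  "residue_field = \<lparr>gcarrier = UNIV, gcomp = (\<lambda>j. if j = 0 then UNIV else {0}),
     gact = (\<lambda>p c. Poly_Mapping.lookup p 0 * c)\<rparr>"

text \<open>A standard graded algebra with underlying set \<open>A\<close>, generated in degree 1 by the elements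
  \<open>u x\<close> with \<open>x \<in> X\<close>, as a module over the polynomial ring in \<open>X\<close>.\<close>

definition algebra_gmodule :: "'x set \<Rightarrow> ('k \<Rightarrow> 'a) \<Rightarrow> ('x \<Rightarrow> 'a) \<Rightarrow> 'a set
    \<Rightarrow> (('x, 'k::field) mpoly, 'a::comm_ring_1) gmodule" where
  "algebra_gmodule X \<iota> u A = \<lparr>gcarrier = A, gcomp = (\<lambda>d. meval \<iota> u ` mpolys_hom X d),
     gact = (\<lambda>p a. meval \<iota> u p * a)\<rparr>"

definition algebra_betti :: "'x set \<Rightarrow> ('k::field \<Rightarrow> 'a) \<Rightarrow> ('x \<Rightarrow> 'a) \<Rightarrow> 'a::comm_ring_1 set
    \<Rightarrow> nat \<Rightarrow> int \<Rightarrow> nat" where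
  "algebra_betti X \<iota> u A i j =
     tor_dim X (algebra_gmodule X \<iota> u A) (residue_field :: (('x, 'k) mpoly, 'k) gmodule) i j"

definition algebra_reg :: "'x set \<Rightarrow> ('k::field \<Rightarrow> 'a) \<Rightarrow> ('x \<Rightarrow> 'a) \<Rightarrow> 'a::comm_ring_1 set \<Rightarrow> int" where
  "algebra_reg X \<iota> u A = Max {j - int i | i j. algebra_betti X \<iota> u A i j \<noteq> 0}"

section \<open>Graphs on \<open>{1..n}\<close> and induced matchings\<close>

definition simple_graph :: "nat \<Rightarrow> nat set set \<Rightarrow> bool" where
  "simple_graph n E \<longleftrightarrow> (\<forall>e\<in>E. e \<subseteq> {1..n} \<and> card e = 2)"

definition matching :: "nat set set \<Rightarrow> nat set set \<Rightarrow> bool" where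
  "matching E M \<longleftrightarrow> M \<subseteq> E \<and> (\<forall>e\<in>M. \<forall>e'\<in>M. e \<noteq> e' \<longrightarrow> e \<inter> e' = {})"

definition induced_matching :: "nat set set \<Rightarrow> nat set set \<Rightarrow> bool" where
  "induced_matching E M \<longleftrightarrow> matching E M \<and>
     (\<forall>e\<in>M. \<forall>e'\<in>M. e \<noteq> e' \<longrightarrow> \<not> (\<exists>f\<in>E. e \<inter> f \<noteq> {} \<and> e' \<inter> f \<noteq> {}))"

definition indmat :: "nat set set \<Rightarrow> nat" where
  "indmat E = Max {card M | M. induced_matching E M}"

section \<open>The Rees algebra of the edge ideal\<close>

definition edge_monomial :: "nat set \<Rightarrow> (nat, 'k::field) mpoly" where
  "edge_monomial e = (\<Prod>i\<in>e. mvar i)"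

definition edge_ideal :: "nat \<Rightarrow> nat set set \<Rightarrow> (nat, 'k::field) mpoly set" where
  "edge_ideal n E = genideal (mpoly_ring {1..n}) (edge_monomial ` E)"

text \<open>The Rees algebra of an ideal \<open>I\<close> of a ring \<open>R\<close> whose operations are those of the type
  \<open>'a\<close>, as the subring of all \<open>\<Sum>\<^sub>s f\<^sub>s T\<^sup>s\<close> with \<open>f\<^sub>s \<in> I\<^sup>s\<close> in the polynomial ring \<open>R[T]\<close>;
  \<open>I\<^sup>0\<close> is the whole ring.\<close>

definition rees_algebra :: "'a::comm_ring_1 ring \<Rightarrow> 'a set \<Rightarrow> 'a poly set" where
  "rees_algebra R I = {f. \<forall>s. coeff f s \<in> I [^]\<^bsub>ideals_set R\<^esub> s}"

text \<open>The monomial generators \<open>x\<^sub>i\<close> and \<open>x\<^sub>i x\<^sub>j T\<close>, indexed by the disjoint union of the vertex set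
  and the edge set. In the edge ring of the cone over \<open>G\<close> they correspond to \<open>x\<^sub>i x\<^bsub>n+1\<^esub>\<close> and
  \<open>x\<^sub>i x\<^sub>j\<close>.\<close>

fun rees_gen :: "nat + nat set \<Rightarrow> (nat, 'k::field) mpoly poly" where
  "rees_gen (Inl i) = [:mvar i:]"
| "rees_gen (Inr e) = monom (edge_monomial e) 1"

text \<open>The regularity of \<open>R(I(G))\<close> over the field \<open>'k\<close>, all generators having degree 1. If \<open>G\<close> has
  exactly one edge then \<open>R(I(G))\<close> is a polynomial ring in these generators, so that this number is
  0 although the induced matching number is 1.\<close>

definition rees_edge_reg :: "'k::field itself \<Rightarrow> nat \<Rightarrow> nat set set \<Rightarrow> int" where
  "rees_edge_reg _ n E =
     algebra_reg ({1..n} <+> E) (\<lambda>c::'k. [:mconst c:]) rees_gen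
       (rees_algebra (mpoly_ring {1..n}) (edge_ideal n E))"

end

theory Submission
  imports Defs "HOL-Computational_Algebra.Primes"
begin

text \<open>Let \<open>A\<close> be the Rees algebra, \<open>X\<close> its set of monomial generators, one for every vertex and every edge, and
\<open>P\<close> the polynomial ring in \<open>X\<close>. A lower bound for the regularity of \<open>A\<close> is a non-zero graded Betti number
\<open>\<beta>\<^sub>i\<^sub>,\<^sub>j\<close> with large \<open>j - i\<close>, that is, a non-zero class of degree \<open>j\<close> in \<open>Tor\<^sub>i(A, K)\<close>. This Tor is the homology
of the Koszul complex of \<open>X\<close> with coefficients in \<open>A\<close>, and since \<open>A\<close> is spanned by monomials, the Koszul
complex splits: its strand at a monomial \<open>\<alpha>\<close> is the augmented chain complex of the simplicial complex of
those sets \<open>S\<close> of generators for which \<open>\<alpha> / \<Prod>S\<close> still is a monomial of \<open>A\<close>.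

Let \<open>e\<^sub>1, \<dots>, e\<^sub>q\<close> be an induced matching with \<open>q \<ge> 2\<close>, and let \<open>\<alpha>\<close> be the product of all its vertices
times \<open>T\<close>. As the matching is induced, the only edges of the graph among these vertices are the \<open>e\<^sub>k\<close>. So the
facets of the complex at \<open>\<alpha>\<close> are the sets \<open>F\<^sub>k\<close> made of the generator of \<open>e\<^sub>k\<close> and of the vertices
outside \<open>e\<^sub>k\<close>. Any \<open>q - 1\<close> of them have a common vertex, all \<open>q\<close> have none, hence the complex has the homology of
a sphere of dimension \<open>q - 2\<close>, and \<open>Tor\<close> with index \<open>q - 1\<close> is non-zero in the degree \<open>2 q - 1\<close> of \<open>\<alpha>\<close>;
the difference is \<open>q\<close>. If \<open>q = 1\<close> and there are two edges, then there are two edges \<open>a b\<close> and \<open>a c\<close> with a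
common vertex; the complex at \<open>a b c T\<close> is disconnected, which gives a class in \<open>Tor\<^sub>1\<close> of degree 2. Without
edges the unit of \<open>A\<close> gives a class in \<open>Tor\<^sub>0\<close> of degree 0.

Instead of computing homology, \<open>betti_configuration\<close> pairs an explicit cycle with an explicit cocycle,
and it treats the cases \<open>q \<ge> 2\<close> and \<open>q = 1\<close> uniformly. For \<open>q \<ge> 2\<close> the cycle is the boundary of the
simplex on one chosen vertex from each edge. The cocycle lives on the facet \<open>F\<^sub>1\<close>, partitioned into blocks, one for
each other edge of the matching: it sums over the transversals of the partition. A transversal lies in no other facet, so every
face that contains one stays inside \<open>F\<^sub>1\<close>, where the contributions to a coboundary cancel in pairs
(\<open>sum_transversal_cofaces\<close>).

The Betti numbers are defined by an unspecified graded free resolution \<open>F\<close>, and the regularity is a maximum of a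
set that must be seen to be finite. This leaves three general facts. A graded free resolution by finitely
generated modules exists, which is Hilbert's basis theorem (\<open>graded_submodule_fg\<close>,
\<open>graded_free_resolution_exists\<close>). A Koszul cycle with coefficients in \<open>A\<close> that is no boundary gives a
non-zero Betti number, whatever \<open>F\<close> is (\<open>standard_graded.betti_nonzero\<close>). And \<open>Tor\<^sub>i(A, K) = 0\<close> for
\<open>i > card X\<close>, which is Hilbert's syzygy theorem (\<open>tor_dimension_zero_beyond\<close>). The last two are diagram
chases in the double complex \<open>F \<otimes> Koszul\<close>, whose rows resolve sums of copies of \<open>A\<close> and whose columns resolve
sums of copies of \<open>K\<close>.\<close>

section \<open>Polynomials, restriction to monomials, homogeneous components\<close>

abbreviation coef :: "('a \<Rightarrow>\<^sub>0 'b::zero) \<Rightarrow> 'a \<Rightarrow> 'b" where "coef \<equiv> Poly_Mapping.lookup"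
abbreviation supp :: "('a \<Rightarrow>\<^sub>0 'b::zero) \<Rightarrow> 'a set" where "supp \<equiv> Poly_Mapping.keys"
abbreviation sing :: "'a \<Rightarrow> 'b::zero \<Rightarrow> 'a \<Rightarrow>\<^sub>0 'b" where "sing \<equiv> Poly_Mapping.single"

lemma poly_mapping_sum_single:
  fixes p :: "'a \<Rightarrow>\<^sub>0 'b::comm_monoid_add"
  shows "p = (\<Sum>m\<in>supp p. sing m (coef p m))"
proof (rule poly_mapping_eqI)
  fix k
  have "coef (\<Sum>m\<in>supp p. sing m (coef p m)) k = (\<Sum>m\<in>supp p. if m = k then coef p k else 0)"
    unfolding lookup_sum by (intro sum.cong) (auto simp: lookup_single when_def)
  then show "coef p k = coef (\<Sum>m\<in>supp p. sing m (coef p m)) k"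
    by (simp add: in_keys_iff)
qed

lemma poly_mapping_additive_induct [case_names zero single add]:
  fixes p :: "'a \<Rightarrow>\<^sub>0 'b::comm_monoid_add"
  assumes "P 0" "\<And>m c. m \<in> supp p \<Longrightarrow> P (sing m c)" "\<And>p q. P p \<Longrightarrow> P q \<Longrightarrow> P (p + q)"
  shows "P p"
proof -
  have "P (\<Sum>m\<in>M. sing m (coef p m))" if "finite M" "M \<subseteq> supp p" for M
    using that by (induction M rule: finite_induct) (use assms in auto)
  from this[of "supp p"] show ?thesis
    using poly_mapping_sum_single[of p] by simp
qed

lemma mdeg_superset: "finite S \<Longrightarrow> supp m \<subseteq> S \<Longrightarrow> mdeg m = (\<Sum>x\<in>S. coef m x)"
  unfolding mdeg_def by (rule sum.mono_neutral_left) (auto simp: in_keys_iff)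

lemma supp_add_nat: "supp (m + m' :: 'x \<Rightarrow>\<^sub>0 nat) = supp m \<union> supp m'"
  by (auto simp: in_keys_iff lookup_add)

lemma mdeg_add [simp]: "mdeg (m + m') = mdeg m + mdeg m'"
proof -
  let ?S = "supp m \<union> supp m'"
  have "mdeg (m + m') = (\<Sum>x\<in>?S. coef (m + m') x)"
    by (rule mdeg_superset) (auto simp: supp_add_nat)
  moreover have "mdeg m = (\<Sum>x\<in>?S. coef m x)" "mdeg m' = (\<Sum>x\<in>?S. coef m' x)"
    by (rule mdeg_superset; auto)+
  ultimately show ?thesis by (simp add: lookup_add sum.distrib)
qed

lemma mdeg_zero [simp]: "mdeg 0 = 0"
  by (simp add: mdeg_def)

lemma mdeg_single [simp]: "mdeg (sing x k) = k"
  by (cases "k = 0") (auto simp: mdeg_def)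

lemma mdeg_sum: "mdeg (\<Sum>i\<in>I. f i) = (\<Sum>i\<in>I. mdeg (f i))"
  by (induction I rule: infinite_finite_induct) auto

lemma mdeg_eq_0_iff [simp]: "mdeg m = 0 \<longleftrightarrow> m = 0"
  by (auto simp: mdeg_def in_keys_iff intro!: poly_mapping_eqI)

lift_definition part :: "('a \<Rightarrow> bool) \<Rightarrow> ('a \<Rightarrow>\<^sub>0 'b::zero) \<Rightarrow> 'a \<Rightarrow>\<^sub>0 'b"
  is "\<lambda>P p m. if P m then p m else 0"
  by (erule finite_subset[rotated]) auto

lemma coef_part [simp]: "coef (part P p) m = (if P m then coef p m else 0)"
  by transfer simp

lemma supp_part: "supp (part P p) = {m \<in> supp p. P m}"
  by (auto simp: in_keys_iff split: if_splits)

lemma part_zero [simp]: "part P 0 = 0"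
  by (rule poly_mapping_eqI) simp

lemma part_add: "part P (p + q) = part P p + part P (q :: 'a \<Rightarrow>\<^sub>0 'b::monoid_add)"
  by (rule poly_mapping_eqI) (simp add: lookup_add)

lemma part_sum: "part P (\<Sum>i\<in>I. f i) = (\<Sum>i\<in>I. part P (f i :: 'a \<Rightarrow>\<^sub>0 'b::comm_monoid_add))"
  by (induction I rule: infinite_finite_induct) (auto simp: part_add)

lemma part_single: "part P (sing m c) = (if P m then sing m c else 0)"
  by (rule poly_mapping_eqI) (auto simp: lookup_single when_def)

definition hom_part :: "int \<Rightarrow> ('x, 'k::zero) mpoly \<Rightarrow> ('x, 'k) mpoly" where
  "hom_part d = part (\<lambda>m. int (mdeg m) = d)"

lemma mpolys_zero [simp]: "0 \<in> mpolys X"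
  and mpolys_add: "p \<in> mpolys X \<Longrightarrow> q \<in> mpolys X \<Longrightarrow> p + q \<in> mpolys X"
  by (auto simp: mpolys_def dest!: subsetD[OF keys_add])

lemma mpolys_one [simp]: "(1::('x,'k::zero_neq_one) mpoly) \<in> mpolys X"
  by (auto simp: mpolys_def)

lemma mpolys_mult: "p \<in> mpolys X \<Longrightarrow> q \<in> mpolys X \<Longrightarrow> p * q \<in> mpolys X"
  for p :: "('x,'k::comm_ring_1) mpoly"
  unfolding mpolys_def by (auto simp: supp_add_nat dest!: subsetD[OF keys_mult]) blast+

lemma mpolys_uminus: "p \<in> mpolys X \<Longrightarrow> - p \<in> mpolys X"
  for p :: "('x,'k::comm_ring_1) mpoly"
  by (auto simp: mpolys_def in_keys_iff)

lemma mpolys_diff: "p \<in> mpolys X \<Longrightarrow> q \<in> mpolys X \<Longrightarrow> p - q \<in> mpolys X"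
  for p :: "('x,'k::comm_ring_1) mpoly"
  using mpolys_add[of p X "- q"] mpolys_uminus[of q X] by simp

lemma mpolys_sum: "(\<And>i. i \<in> I \<Longrightarrow> f i \<in> mpolys X) \<Longrightarrow> (\<Sum>i\<in>I. f i) \<in> mpolys X"
  by (induction I rule: infinite_finite_induct) (auto intro: mpolys_add)

lemma mpolys_single: "supp m \<subseteq> X \<Longrightarrow> sing m c \<in> mpolys X"
  by (auto simp: mpolys_def)

lemma mpolys_part: "p \<in> mpolys X \<Longrightarrow> part P p \<in> mpolys X"
  by (auto simp: mpolys_def supp_part)

lemma mpolys_hom_iff: "p \<in> mpolys_hom X d \<longleftrightarrow> p \<in> mpolys X \<and> hom_part d p = p"
  by (auto simp: mpolys_hom_def hom_part_def poly_mapping_eq_iff fun_eq_iff in_keys_iff split: if_splits)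

lemma hom_part_in_hom: "p \<in> mpolys X \<Longrightarrow> hom_part d p \<in> mpolys_hom X d"
  by (auto simp: mpolys_hom_def hom_part_def mpolys_part supp_part)

lemma mpolys_homD: "p \<in> mpolys_hom X d \<Longrightarrow> p \<in> mpolys X"
  by (simp add: mpolys_hom_def)

lemma mpolys_hom_zero [simp]: "0 \<in> mpolys_hom X d"
  by (simp add: mpolys_hom_def)

lemma hom_part_zero [simp]: "hom_part d 0 = 0"
  by (simp add: hom_part_def)

lemma hom_part_add: "hom_part d (p + q) = hom_part d p + hom_part d (q :: ('x,'k::monoid_add) mpoly)"
  by (simp add: hom_part_def part_add)

lemma hom_part_sum: "hom_part d (\<Sum>i\<in>I. f i) = (\<Sum>i\<in>I. hom_part d (f i :: ('x,'k::comm_monoid_add) mpoly))"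
  by (simp add: hom_part_def part_sum)

lemma mpolys_hom_add: "p \<in> mpolys_hom X d \<Longrightarrow> q \<in> mpolys_hom X d \<Longrightarrow> p + q \<in> mpolys_hom X d"
  by (auto simp: mpolys_hom_iff mpolys_add hom_part_add)

lemma mpolys_hom_sum: "(\<And>i. i \<in> I \<Longrightarrow> f i \<in> mpolys_hom X d) \<Longrightarrow> (\<Sum>i\<in>I. f i) \<in> mpolys_hom X d"
  by (induction I rule: infinite_finite_induct) (auto intro: mpolys_hom_add)

lemma mpolys_hom_mult:
  fixes p :: "('x,'k::comm_ring_1) mpoly"
  assumes "p \<in> mpolys_hom X d" "q \<in> mpolys_hom X e"
  shows "p * q \<in> mpolys_hom X (d + e)"
  using assms mpolys_mult[of p X q]
  by (fastforce simp: mpolys_hom_def dest!: subsetD[OF keys_mult])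

lemma mpolys_hom_uminus: "p \<in> mpolys_hom X d \<Longrightarrow> - p \<in> mpolys_hom X d"
  for p :: "('x,'k::comm_ring_1) mpoly"
  by (auto simp: mpolys_hom_def mpolys_uminus in_keys_iff)

lemma mpolys_hom_single: "supp m \<subseteq> X \<Longrightarrow> int (mdeg m) = d \<Longrightarrow> sing m c \<in> mpolys_hom X d"
  by (auto simp: mpolys_hom_def mpolys_single)

lemma mpolys_hom_mvar: "x \<in> X \<Longrightarrow> mvar x \<in> mpolys_hom X 1"
  by (auto simp: mvar_def intro!: mpolys_hom_single)

lemma mpolys_hom_mconst: "mconst c \<in> mpolys_hom X 0"
  by (auto simp: mconst_def intro!: mpolys_hom_single)

text \<open>Multiplication by a homogeneous polynomial shifts homogeneous components. All maps between graded modules below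
are given by matrices of homogeneous polynomials, so this is why they commute with taking components.\<close>

lemma hom_part_mult_hom:
  fixes p q :: "('x,'k::comm_ring_1) mpoly"
  assumes q: "\<forall>m\<in>supp q. int (mdeg m) = e"
  shows "hom_part d (p * q) = hom_part (d - e) p * q"
proof (induction p rule: poly_mapping_additive_induct)
  case (single m c)
  have "hom_part d (sing m c * (\<Sum>m'\<in>supp q. sing m' (coef q m')))
      = hom_part (d - e) (sing m c) * (\<Sum>m'\<in>supp q. sing m' (coef q m'))"
    unfolding sum_distrib_left hom_part_sum mult_single
    by (rule sum.cong) (use q in \<open>auto simp: hom_part_def part_single mult_single\<close>)
  then show ?case by (simp flip: poly_mapping_sum_single)
qed (auto simp: hom_part_add algebra_simps)

lemma sum_hom_part: "finite D \<Longrightarrow> (\<lambda>m. int (mdeg m)) ` supp p \<subseteq> D \<Longrightarrow> (\<Sum>d\<in>D. hom_part d p) = p"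
  by (rule poly_mapping_eqI)
     (auto simp: hom_part_def lookup_sum in_keys_iff image_subset_iff sum.delta intro: ccontr)

lemma coef_single_mult_add: "coef (sing k c * p) (k + t) = c * coef (p :: ('x,'k::comm_ring_1) mpoly) t"
  by (induction p rule: poly_mapping_additive_induct)
     (auto simp: mult_single lookup_single when_def distrib_left lookup_add)

lemma coef_0_mult:
  fixes p q :: "('x,'k::comm_ring_1) mpoly"
  shows "coef (p * q) 0 = coef p 0 * coef q 0"
proof (induction p rule: poly_mapping_additive_induct)
  case (single m c)
  have "coef (sing m c * (\<Sum>m'\<in>supp q. sing m' (coef q m'))) 0
      = coef (sing m c) 0 * coef (\<Sum>m'\<in>supp q. sing m' (coef q m')) 0"
  proof -
    have z: "m + m' = 0 \<longleftrightarrow> m = 0 \<and> m' = 0" for m' :: "'x \<Rightarrow>\<^sub>0 nat"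
      by (metis mdeg_add mdeg_eq_0_iff add_is_0)
    show ?thesis
      unfolding sum_distrib_left lookup_sum mult_single
      by (rule sum.cong) (auto simp: lookup_single when_def z)
  qed
  then show ?case by (simp flip: poly_mapping_sum_single)
qed (auto simp: lookup_add algebra_simps)

section \<open>Graded free modules and finite generation of graded submodules\<close>

text \<open>Elements of the free module of rank \<open>r\<close> are functions on all of \<open>nat\<close> that vanish from \<open>r\<close> on; the
basis element \<open>b\<close> gets degree \<open>dg b\<close>.\<close>

definition free_module :: "'x set \<Rightarrow> nat \<Rightarrow> (nat \<Rightarrow> ('x, 'k::zero) mpoly) set" where
  "free_module X r = {v. \<forall>b. if b < r then v b \<in> mpolys X else v b = 0}"

definition free_comp :: "'x set \<Rightarrow> nat \<Rightarrow> (nat \<Rightarrow> int) \<Rightarrow> int \<Rightarrow> (nat \<Rightarrow> ('x, 'k::zero) mpoly) set" where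
  "free_comp X r dg d = {v. \<forall>b. if b < r then v b \<in> mpolys_hom X (d - dg b) else v b = 0}"

definition free_part :: "(nat \<Rightarrow> int) \<Rightarrow> int \<Rightarrow> (nat \<Rightarrow> ('x, 'k::zero) mpoly) \<Rightarrow> nat \<Rightarrow> ('x, 'k) mpoly" where
  "free_part dg d v = (\<lambda>b. hom_part (d - dg b) (v b))"

definition graded_submodule :: "'x set \<Rightarrow> nat \<Rightarrow> (nat \<Rightarrow> int) \<Rightarrow> (nat \<Rightarrow> ('x, 'k::field) mpoly) set \<Rightarrow> bool" where
  "graded_submodule X r dg N \<longleftrightarrow> N \<subseteq> free_module X r \<and> 0 \<in> N \<and> (\<forall>v\<in>N. \<forall>w\<in>N. v + w \<in> N) \<and>
     (\<forall>p\<in>mpolys X. \<forall>v\<in>N. (\<lambda>b. p * v b) \<in> N) \<and> (\<forall>d. \<forall>v\<in>N. free_part dg d v \<in> N)"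

lemma graded_submoduleD:
  assumes "graded_submodule X r dg N"
  shows "v \<in> N \<Longrightarrow> v \<in> free_module X r" "0 \<in> N" "v \<in> N \<Longrightarrow> w \<in> N \<Longrightarrow> v + w \<in> N"
    "p \<in> mpolys X \<Longrightarrow> v \<in> N \<Longrightarrow> (\<lambda>b. p * v b) \<in> N" "v \<in> N \<Longrightarrow> free_part dg d v \<in> N"
  using assms by (auto simp: graded_submodule_def)

lemma free_comp_free_module: "v \<in> free_comp X r dg d \<Longrightarrow> v \<in> free_module X r"
  unfolding free_comp_def free_module_def using mpolys_homD by (smt (verit) mem_Collect_eq)

lemma free_part_free_comp: "v \<in> free_module X r \<Longrightarrow> free_part dg d v \<in> free_comp X r dg d"
  by (auto simp: free_comp_def free_module_def free_part_def hom_part_in_hom)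

lemma free_part_id: "v \<in> free_comp X r dg d \<Longrightarrow> free_part dg d v = v"
proof
  fix b assume "v \<in> free_comp X r dg d"
  then have "if b < r then v b \<in> mpolys_hom X (d - dg b) else v b = 0" unfolding free_comp_def by blast
  then show "free_part dg d v b = v b" by (auto simp: free_part_def mpolys_hom_iff split: if_splits)
qed

lemma sum_fun_apply: "(\<Sum>i\<in>I. f i) b = (\<Sum>i\<in>I. f i b)"
  for f :: "'i \<Rightarrow> 'a \<Rightarrow> 'b::comm_monoid_add"
  by (induction I rule: infinite_finite_induct) auto

text \<open>Dickson's lemma, by induction on the set of variables. The induction hypothesis, applied to all of \<open>L\<close>, takes
care of the elements whose exponent at the new variable is at least the largest exponent \<open>u\<close> that occurs among
the finitely many functions found; each of the exponents below \<open>u\<close> is treated by the induction hypothesis on its own.\<close>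

lemma dickson:
  fixes L :: "('x \<Rightarrow> nat) set"
  assumes "finite X"
  shows "\<exists>B\<subseteq>L. finite B \<and> (\<forall>f\<in>L. \<exists>g\<in>B. \<forall>x\<in>X. g x \<le> f x)"
  using assms
proof (induction X arbitrary: L rule: finite_induct)
  case empty
  show ?case
  proof (cases "L = {}")
    case False
    then obtain f where "f \<in> L" by auto
    then show ?thesis by (intro exI[of _ "{f}"]) auto
  qed auto
next
  case (insert x X)
  obtain B0 where B0: "B0 \<subseteq> L" "finite B0" "\<forall>f\<in>L. \<exists>g\<in>B0. \<forall>x\<in>X. g x \<le> f x"
    using insert.IH[of L] by auto
  have "\<exists>B. \<forall>k. B k \<subseteq> {f\<in>L. f x = k} \<and> finite (B k) \<and> (\<forall>f\<in>{f\<in>L. f x = k}. \<exists>g\<in>B k. \<forall>x\<in>X. g x \<le> f x)"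
    by (intro choice allI insert.IH)
  then obtain B where "\<forall>k. B k \<subseteq> {f\<in>L. f x = k} \<and> finite (B k) \<and>
      (\<forall>f\<in>{f\<in>L. f x = k}. \<exists>g\<in>B k. \<forall>x\<in>X. g x \<le> f x)" ..
  then have B: "\<And>k. B k \<subseteq> {f\<in>L. f x = k}" "\<And>k. finite (B k)"
      "\<And>k f. f \<in> L \<Longrightarrow> f x = k \<Longrightarrow> \<exists>g\<in>B k. \<forall>x\<in>X. g x \<le> f x"
    by auto
  define u where "u = Max ((\<lambda>g. g x) ` B0)"
  show ?case
  proof (intro exI[of _ "B0 \<union> (\<Union>k<u. B k)"] conjI ballI)
    show "B0 \<union> (\<Union>k<u. B k) \<subseteq> L" using B0(1) B(1) by blast
    show "finite (B0 \<union> (\<Union>k<u. B k))" using B0 B(2) by auto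
    fix f assume f: "f \<in> L"
    show "\<exists>g\<in>B0 \<union> (\<Union>k<u. B k). \<forall>y\<in>insert x X. g y \<le> f y"
    proof (cases "f x < u")
      case True
      obtain g where g: "g \<in> B (f x)" "\<forall>y\<in>X. g y \<le> f y" using B(3)[OF f refl] by auto
      with B(1)[of "f x"] have "g x = f x" by auto
      with g True show ?thesis by (intro bexI[of _ g]) auto
    next
      case False
      obtain g where g: "g \<in> B0" "\<forall>y\<in>X. g y \<le> f y" using B0(3) f by auto
      have "g x \<le> u" unfolding u_def using g B0(2) by auto
      with g False show ?thesis by (intro bexI[of _ g]) auto
    qed
  qed
qed

text \<open>A monomial order on finitely many variables, coded by natural numbers: assign distinct primes to the variables and
evaluate. The weight is multiplicative, and injective by unique factorisation; the order of \<open>nat\<close> makes it a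
well-order.\<close>

lemma monomial_weight_exists:
  assumes X: "finite (X :: 'x set)"
  shows "\<exists>w :: ('x \<Rightarrow>\<^sub>0 nat) \<Rightarrow> nat. (\<forall>m m'. w (m + m') = w m * w m') \<and> (\<forall>m. 0 < w m) \<and>
    inj_on w {m. supp m \<subseteq> X}"
proof -
  obtain f :: "'x \<Rightarrow> nat" where f: "inj_on f X" "f ` X \<subseteq> {p. prime p}"
  proof -
    obtain S :: "nat set" where S: "finite S" "card S = card X" "S \<subseteq> {p. prime p}"
      using infinite_arbitrarily_large[OF primes_infinite] by metis
    then obtain f where "bij_betw f X S" using finite_same_card_bij[OF X S(1)] by metis
    with S(3) that show ?thesis by (auto simp: bij_betw_def)
  qed
  define w where "w m = (\<Prod>x\<in>X. f x ^ coef m x)" for m :: "'x \<Rightarrow>\<^sub>0 nat"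
  have mult: "multiplicity (f x) (w m) = coef m x" if x: "x \<in> X" for x m
  proof -
    have "w m = (\<Prod>p\<in>f ` X. p ^ coef m (inv_into X f p))"
      unfolding w_def using f by (subst prod.reindex) (auto intro!: prod.cong)
    then have "multiplicity (f x) (w m) = (if f x \<in> f ` X then coef m (inv_into X f (f x)) else 0)"
      using f x X by (simp only:) (subst multiplicity_prod_prime_powers, auto)
    then show ?thesis using f x by auto
  qed
  have "inj_on w {m. supp m \<subseteq> X}"
  proof (rule inj_onI, rule poly_mapping_eqI)
    fix m m' x assume a: "m \<in> {m. supp m \<subseteq> X}" "m' \<in> {m. supp m \<subseteq> X}" "w m = w m'"
    show "coef m x = coef m' x"
    proof (cases "x \<in> X")
      case True
      then show ?thesis using mult[of x m] mult[of x m'] a by simp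
    next
      case False
      then show ?thesis using a by (metis mem_Collect_eq in_keys_iff subsetD)
    qed
  qed
  moreover have "w (m + m') = w m * w m'" for m m'
    by (simp add: w_def lookup_add power_add prod.distrib)
  moreover have "0 < w m" for m
    unfolding w_def using f by (auto intro!: prod_pos simp: prime_gt_0_nat image_subset_iff)
  ultimately show ?thesis by blast
qed

text \<open>The weight \<open>w m * r + b\<close> orders the terms \<open>m\<close> at position \<open>b\<close> first by the monomial, then by the position.
This order is compatible with multiplication by monomials.\<close>

lemma lex_weight_mult_mono:
  fixes w u v r b c :: nat
  assumes "u * r + b \<le> v * r + c" "b < r" "c < r" "0 < w"
  shows "w * u * r + b \<le> w * v * r + c"
proof (cases "u = v")
  case False
  have "u < v"
  proof (rule ccontr)
    assume "\<not> u < v"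
    with False have "Suc v \<le> u" by simp
    then have "Suc v * r \<le> u * r" by (rule mult_le_mono1)
    with assms show False by simp
  qed
  then have "Suc (w * u) \<le> w * v" using assms(4) by (metis Suc_leI mult_less_mono2)
  then have "Suc (w * u) * r \<le> w * v * r" by (rule mult_le_mono1)
  with assms(2) show ?thesis by simp
qed (use assms in simp)

definition poly_span :: "'x set \<Rightarrow> (nat \<Rightarrow> ('x, 'k::field) mpoly) set \<Rightarrow> (nat \<Rightarrow> ('x, 'k) mpoly) set" where
  "poly_span X G = {v. \<exists>c. (\<forall>g\<in>G. c g \<in> mpolys X) \<and> v = (\<lambda>b. \<Sum>g\<in>G. c g * g b)}"

lemma poly_span_zero: "0 \<in> poly_span X G"
  unfolding poly_span_def by (auto intro!: exI[of _ "\<lambda>_. 0"] simp: fun_eq_iff)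

lemma poly_span_add: 
  assumes "v \<in> poly_span X G" "w \<in> poly_span X G" shows "v + w \<in> poly_span X G"
proof -
  obtain c d where "\<forall>g\<in>G. c g \<in> mpolys X" "v = (\<lambda>b. \<Sum>g\<in>G. c g * g b)"
    "\<forall>g\<in>G. d g \<in> mpolys X" "w = (\<lambda>b. \<Sum>g\<in>G. d g * g b)"
    using assms by (auto simp: poly_span_def)
  then show ?thesis unfolding poly_span_def
    by (auto intro!: exI[of _ "\<lambda>g. c g + d g"] simp: fun_eq_iff mpolys_add distrib_right sum.distrib)
qed

lemma poly_span_sum: "(\<And>i. i \<in> I \<Longrightarrow> f i \<in> poly_span X G) \<Longrightarrow> (\<Sum>i\<in>I. f i) \<in> poly_span X G"
  by (induction I rule: infinite_finite_induct) (auto intro: poly_span_add poly_span_zero)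

lemma poly_span_mult_gen:
  assumes "finite G" "g \<in> G" "p \<in> mpolys X" shows "(\<lambda>b. p * g b) \<in> poly_span X G"
proof -
  have "(\<lambda>b. p * g b) = (\<lambda>b. \<Sum>h\<in>G. (if h = g then p else 0) * h b)"
    using assms by (simp add: if_distrib[of "\<lambda>x. x * _"] sum.delta cong: if_cong)
  then show ?thesis unfolding poly_span_def using assms(3)
    by (auto intro!: exI[of _ "\<lambda>h. if h = g then p else 0"])
qed

text \<open>A non-zero component of \<open>v\<close> has one of finitely many degrees, so that \<open>v\<close> is a finite sum of elements that are
homogeneous.\<close>

lemma free_module_sum_free_part:
  fixes v :: "nat \<Rightarrow> ('x, 'k::field) mpoly"
  assumes "v \<in> free_module X r"
  shows "\<exists>D. finite D \<and> v = (\<Sum>d\<in>D. free_part dg d v)"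
proof -
  define D where "D = (\<Union>b<r. (\<lambda>m. int (mdeg m) + dg b) ` supp (v b))"
  have fin: "finite D" by (auto simp: D_def)
  have "v b = (\<Sum>d\<in>D. free_part dg d v) b" for b
  proof (cases "b < r")
    case True
    have "(\<Sum>d\<in>D. hom_part (d - dg b) (v b)) = (\<Sum>d\<in>(\<lambda>d. d - dg b) ` D. hom_part d (v b))"
      by (subst sum.reindex) (auto simp: inj_on_def)
    also have "\<dots> = v b"
      by (rule sum_hom_part) (use fin True in \<open>force simp: D_def\<close>)+
    finally show ?thesis by (simp add: free_part_def sum_fun_apply)
  next
    case False
    then show ?thesis using assms by (simp add: free_module_def free_part_def sum_fun_apply)
  qed
  with fin show ?thesis by (auto simp: fun_eq_iff)
qed

text \<open>Hilbert's basis theorem, by leading terms. By Dickson's lemma finitely many homogeneous elements of \<open>N\<close> have leading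
terms that divide those of all homogeneous elements of \<open>N\<close>. Subtracting a monomial multiple of one of them lowers the
leading term, so by induction on the weight of that term they generate.\<close>

lemma graded_submodule_fg:
  fixes N :: "(nat \<Rightarrow> ('x, 'k::field) mpoly) set"
  assumes X: "finite X" and N: "graded_submodule X r dg N"
  shows "\<exists>G\<subseteq>N. finite G \<and> (\<forall>g\<in>G. \<exists>d. g \<in> free_comp X r dg d) \<and> N \<subseteq> poly_span X G"
proof -
  obtain w :: "('x \<Rightarrow>\<^sub>0 nat) \<Rightarrow> nat" where w: "\<And>m m'. w (m + m') = w m * w m'" "\<And>m. 0 < w m"
      "inj_on w {m. supp m \<subseteq> X}"
    using monomial_weight_exists[OF X] by blast
  define Nh where "Nh = {v \<in> N. \<exists>d. v \<in> free_comp X r dg d}"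
  define lead where "lead v m b \<longleftrightarrow> b < r \<and> m \<in> supp (v b) \<and>
      (\<forall>c<r. \<forall>n\<in>supp (v c). w n * r + c \<le> w m * r + b)" for v :: "nat \<Rightarrow> ('x, 'k) mpoly" and m b
  have lead_ex: "\<exists>m b. lead v m b" if v: "v \<in> N" "v \<noteq> 0" for v
  proof -
    define T where "T = (SIGMA c:{..<r}. supp (v c))"
    have "finite T" by (auto simp: T_def)
    obtain c where c: "v c \<noteq> 0" using v(2) by (auto simp: fun_eq_iff)
    with graded_submoduleD(1)[OF N v(1)] have "c < r" by (auto simp: free_module_def split: if_splits)
    moreover obtain n where "n \<in> supp (v c)" using c by fastforce
    ultimately have "T \<noteq> {}" by (auto simp: T_def)
    with \<open>finite T\<close> obtain t where t: "t \<in> T" "\<And>s. s \<in> T \<Longrightarrow> w (snd s) * r + fst s \<le> w (snd t) * r + fst t"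
      using obtains_MAX[of T "\<lambda>t. w (snd t) * r + fst t"] by (metis (no_types, lifting) Max_ge finite_imageI imageI)
    then have "lead v (snd t) (fst t)" by (force simp: lead_def T_def)
    then show ?thesis by blast
  qed
  have "\<exists>B. \<forall>b. B b \<subseteq> Nh \<and> finite (B b) \<and>
      (\<forall>v\<in>Nh. \<forall>m. lead v m b \<longrightarrow> (\<exists>g\<in>B b. \<exists>n. lead g n b \<and> (\<forall>x\<in>X. coef n x \<le> coef m x)))"
  proof (intro choice allI)
    fix b
    define L where "L = {coef m | m v. v \<in> Nh \<and> lead v m b}"
    obtain B where B: "B \<subseteq> L" "finite B" "\<forall>f\<in>L. \<exists>g\<in>B. \<forall>x\<in>X. g x \<le> f x"
      using dickson[OF X, of L] by auto
    have "\<forall>f\<in>B. \<exists>v. v \<in> Nh \<and> (\<exists>m. f = coef m \<and> lead v m b)"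
      using B(1) unfolding L_def by blast
    then obtain h where h: "\<And>f. f \<in> B \<Longrightarrow> h f \<in> Nh \<and> (\<exists>m. f = coef m \<and> lead (h f) m b)"
      by metis
    show "\<exists>B. B \<subseteq> Nh \<and> finite B \<and>
      (\<forall>v\<in>Nh. \<forall>m. lead v m b \<longrightarrow> (\<exists>g\<in>B. \<exists>n. lead g n b \<and> (\<forall>x\<in>X. coef n x \<le> coef m x)))"
    proof (intro exI[of _ "h ` B"] conjI ballI allI impI)
      fix v m assume "v \<in> Nh" "lead v m b"
      then have "coef m \<in> L" by (auto simp: L_def)
      then obtain f where f: "f \<in> B" "\<forall>x\<in>X. f x \<le> coef m x" using B(3) by auto
      with h[OF f(1)] show "\<exists>g\<in>h ` B. \<exists>n. lead g n b \<and> (\<forall>x\<in>X. coef n x \<le> coef m x)" by auto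
    qed (use h B in auto)
  qed
  then obtain B where B': "\<forall>b. B b \<subseteq> Nh \<and> finite (B b) \<and>
      (\<forall>v\<in>Nh. \<forall>m. lead v m b \<longrightarrow> (\<exists>g\<in>B b. \<exists>n. lead g n b \<and> (\<forall>x\<in>X. coef n x \<le> coef m x)))" ..
  have B: "B b \<subseteq> Nh" "finite (B b)"
     "v \<in> Nh \<Longrightarrow> lead v m b \<Longrightarrow> \<exists>g\<in>B b. \<exists>n. lead g n b \<and> (\<forall>x\<in>X. coef n x \<le> coef m x)" for b v m
    using spec[OF B', of b] by simp_all
  define G where "G = (\<Union>b<r. B b)"
  have G: "finite G" "G \<subseteq> Nh" using B by (auto simp: G_def)
  have key: "v \<in> Nh \<Longrightarrow> lead v m b \<Longrightarrow> v \<in> poly_span X G" for v m b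
  proof (induction "w m * r + b" arbitrary: v m b rule: less_induct)
    case less
    obtain g n where g: "g \<in> B b" "lead g n b" and le: "\<forall>x\<in>X. coef n x \<le> coef m x"
      using B(3)[OF less.prems] by blast
    have b: "b < r" and gG: "g \<in> G" and gN: "g \<in> Nh" using g B(1) by (auto simp: lead_def G_def)
    obtain d e where vd: "v \<in> N" "v \<in> free_comp X r dg d" and ge: "g \<in> N" "g \<in> free_comp X r dg e"
      using less.prems(1) gN by (auto simp: Nh_def)
    have "v b \<in> mpolys_hom X (d - dg b)" "g b \<in> mpolys_hom X (e - dg b)"
      using vd(2) ge(2) b by (simp_all add: free_comp_def)
    moreover have "m \<in> supp (v b)" "n \<in> supp (g b)"
      using less.prems(2) g(2) by (simp_all add: lead_def)
    ultimately have mX: "supp m \<subseteq> X" "int (mdeg m) = d - dg b"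
      and nX: "supp n \<subseteq> X" "int (mdeg n) = e - dg b"
      unfolding mpolys_hom_def mpolys_def by blast+
    define k where "k = m - n"
    have mk: "m = k + n"
    proof (rule poly_mapping_eqI)
      fix x
      have "x \<notin> X \<Longrightarrow> coef n x = 0" using nX(1) by (metis in_keys_iff subsetD)
      then show "coef m x = coef (k + n) x"
        using le by (cases "x \<in> X") (auto simp: k_def lookup_add lookup_minus)
    qed
    have kX: "supp k \<subseteq> X" using mk mX(1) supp_add_nat[of k n] by auto
    have kd: "int (mdeg k) = d - e" using mX(2) nX(2) mk by simp
    \<comment> \<open>\<open>u\<close> is \<open>v\<close> with its leading term cancelled by the multiple \<open>c x\<^sup>k\<close> of \<open>g\<close>.\<close>
    define c where "c = coef (v b) m / coef (g b) n"
    have gn: "coef (g b) n \<noteq> 0" using g(2) by (simp add: lead_def in_keys_iff)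
    define q where "q = (\<lambda>i. sing k (- c) * g i)"
    have qh: "q \<in> free_comp X r dg d"
      unfolding free_comp_def q_def
    proof (intro CollectI allI)
      fix i
      show "if i < r then sing k (- c) * g i \<in> mpolys_hom X (d - dg i) else sing k (- c) * g i = 0"
      proof (cases "i < r")
        case True
        then have "g i \<in> mpolys_hom X (e - dg i)" using ge(2) by (simp add: free_comp_def)
        from mpolys_hom_mult[OF mpolys_hom_single[OF kX kd] this] True show ?thesis by simp
      next
        case False
        then have "g i = 0" using ge(2) unfolding free_comp_def by (metis (mono_tags, lifting) mem_Collect_eq)
        then show ?thesis using False by simp
      qed
    qed
    have qN: "q \<in> N" unfolding q_def using graded_submoduleD(4)[OF N mpolys_single[OF kX] ge(1)] by simp
    define u where "u = v + q"
    have uN: "u \<in> N" unfolding u_def using graded_submoduleD(3)[OF N vd(1) qN] .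
    have uh: "u \<in> free_comp X r dg d" using vd(2) qh by (auto simp: u_def free_comp_def mpolys_hom_add)
    have q_coef: "coef (q i) (k + t) = - c * coef (g i) t" for i t
      by (simp add: q_def coef_single_mult_add)
    have "u \<in> poly_span X G"
    proof (cases "u = 0")
      case False
      then obtain m' b' where l: "lead u m' b'" using lead_ex[OF uN] by blast
      have b': "b' < r" "m' \<in> supp (u b')" using l by (auto simp: lead_def)
      have "u b' \<in> mpolys_hom X (d - dg b')" using b' uh by (simp add: free_comp_def)
      then have m'X: "supp m' \<subseteq> X" using b'(2) unfolding mpolys_hom_def mpolys_def by blast
      have "w m' * r + b' \<le> w m * r + b"
      proof (cases "m' \<in> supp (v b')")
        case True
        then show ?thesis using less.prems(2) b' by (auto simp: lead_def)
      next
        case False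
        then have "m' \<in> supp (q b')" using b' keys_add[of "v b'" "q b'"] by (auto simp: u_def)
        then obtain t where t: "m' = k + t" "t \<in> supp (g b')"
          using keys_mult[of "sing k (- c)" "g b'"] by (auto simp: q_def split: if_splits)
        have "w t * r + b' \<le> w n * r + b" using g(2) t b' by (auto simp: lead_def)
        from lex_weight_mult_mono[OF this b'(1) b w(2)[of k]] show ?thesis
          by (simp add: t mk w(1))
      qed
      moreover have "w m' * r + b' \<noteq> w m * r + b"
      proof
        assume eq: "w m' * r + b' = w m * r + b"
        then have "(w m' * r + b') mod r = (w m * r + b) mod r" by simp
        then have bb: "b' = b" using b b'(1) by simp
        with eq b have "w m' = w m" by simp
        then have mm: "m' = m" using w(3) mX m'X by (auto simp: inj_on_def)
        have "coef (u b) m = 0" using q_coef[of b n] gn by (simp add: u_def lookup_add mk[symmetric] c_def)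
        with b'(2) show False by (simp add: bb mm in_keys_iff)
      qed
      ultimately have "w m' * r + b' < w m * r + b" by simp
      moreover have "u \<in> Nh" using uN uh by (auto simp: Nh_def)
      ultimately show ?thesis using less.hyps l by blast
    qed (simp add: poly_span_zero)
    moreover have "(\<lambda>i. sing k c * g i) \<in> poly_span X G"
      by (rule poly_span_mult_gen[OF G(1) gG mpolys_single[OF kX]])
    moreover have "v = u + (\<lambda>i. sing k c * g i)"
      by (auto simp: u_def q_def fun_eq_iff single_uminus)
    ultimately show ?case using poly_span_add by metis
  qed
  have "v \<in> poly_span X G" if v: "v \<in> N" for v
  proof -
    obtain D where D: "finite D" "v = (\<Sum>d\<in>D. free_part dg d v)"
      using free_module_sum_free_part[OF graded_submoduleD(1)[OF N v]] by blast
    have "free_part dg d v \<in> poly_span X G" for d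
    proof (cases "free_part dg d v = 0")
      case False
      have "free_part dg d v \<in> Nh"
        using graded_submoduleD(5)[OF N v] free_part_free_comp[OF graded_submoduleD(1)[OF N v]] by (auto simp: Nh_def)
      with lead_ex[OF graded_submoduleD(5)[OF N v] False] key show ?thesis by blast
    qed (simp add: poly_span_zero)
    then have "(\<Sum>d\<in>D. free_part dg d v) \<in> poly_span X G" by (intro poly_span_sum)
    with D show ?thesis by simp
  qed
  then show ?thesis using G by (intro exI[of _ G]) (auto simp: Nh_def)
qed

section \<open>Existence of graded free resolutions\<close>

text \<open>Row vectors times matrices: the image of the basis element \<open>b\<close> is the row \<open>g b\<close>.\<close>

definition matrix_map :: "nat \<Rightarrow> nat \<Rightarrow> (nat \<Rightarrow> nat \<Rightarrow> ('x, 'k::field) mpoly) \<Rightarrow> (nat \<Rightarrow> ('x, 'k) mpoly) \<Rightarrow> nat \<Rightarrow> ('x, 'k) mpoly" where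
  "matrix_map r s g v = (\<lambda>c. if c < r then \<Sum>b<s. v b * g b c else 0)"

lemma fdiff_matrix_map: "fdiff F i = matrix_map (frank F i) (frank F (Suc i)) (fmat F i)"
  by (rule ext) (simp add: fdiff_def matrix_map_def)

lemma fmod_free_module: "fmod X F i = free_module X (frank F i)"
  by (simp add: fmod_def free_module_def)

lemma matrix_map_free_part:
  assumes "\<And>b c. b < s \<Longrightarrow> c < r \<Longrightarrow> g b c \<in> mpolys_hom X (gd b - dg c)"
  shows "matrix_map r s g (free_part gd d v) = free_part dg d (matrix_map r s g v)"
proof
  fix c
  have "hom_part (d - gd b) (v b) * g b c = hom_part (d - dg c) (v b * g b c)" if "b < s" "c < r" for b
    using assms[OF that] by (subst hom_part_mult_hom[of _ "gd b - dg c"]) (auto simp: mpolys_hom_def)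
  then show "matrix_map r s g (free_part gd d v) c = free_part dg d (matrix_map r s g v) c"
    by (auto simp: matrix_map_def free_part_def hom_part_sum)
qed

lemma graded_submodule_kernel:
  assumes "\<And>b c. b < s \<Longrightarrow> c < r \<Longrightarrow> g b c \<in> mpolys_hom X (gd b - dg c)"
  shows "graded_submodule X s gd {v \<in> free_module X s. matrix_map r s g v = 0}"
  unfolding graded_submodule_def
proof (intro conjI ballI allI)
  fix p :: "('a,'b) mpoly" and v assume p: "p \<in> mpolys X" and v: "v \<in> {v \<in> free_module X s. matrix_map r s g v = 0}"
  have "matrix_map r s g (\<lambda>b. p * v b) = (\<lambda>c. p * matrix_map r s g v c)"
    by (auto simp: matrix_map_def fun_eq_iff sum_distrib_left mult.assoc)
  then show "(\<lambda>b. p * v b) \<in> {v \<in> free_module X s. matrix_map r s g v = 0}"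
    using p v by (auto simp: free_module_def mpolys_mult fun_eq_iff)
next
  fix d v assume v: "v \<in> {v \<in> free_module X s. matrix_map r s g v = 0}"
  then show "free_part gd d v \<in> {v \<in> free_module X s. matrix_map r s g v = 0}"
    using matrix_map_free_part[of s r g X gd dg d v, OF assms] free_part_free_comp[of v X s gd d] free_comp_free_module
    by (auto simp: free_part_def fun_eq_iff)
next
  show "0 \<in> {v \<in> free_module X s. matrix_map r s g v = 0}" by (auto simp: free_module_def matrix_map_def fun_eq_iff)
next
  fix v w assume "v \<in> {v \<in> free_module X s. matrix_map r s g v = 0}" "w \<in> {v \<in> free_module X s. matrix_map r s g v = 0}"
  moreover have "matrix_map r s g (v + w) = matrix_map r s g v + matrix_map r s g w"
    by (auto simp: matrix_map_def fun_eq_iff distrib_right sum.distrib)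
  moreover have "v + w \<in> free_module X s" if "v \<in> free_module X s" "w \<in> free_module X s"
    using that by (simp add: free_module_def mpolys_add)
  ultimately show "v + w \<in> {v \<in> free_module X s. matrix_map r s g v = 0}" by simp
qed blast

text \<open>Finite generation in the form in which a resolution consumes it: every graded submodule is the image of a matrix
with homogeneous entries.\<close>

lemma graded_submodule_cover:
  fixes N :: "(nat \<Rightarrow> ('x, 'k::field) mpoly) set"
  assumes "finite X" and N: "graded_submodule X r dg N"
  shows "\<exists>s gd g. (\<forall>b<s. \<forall>c<r. g b c \<in> mpolys_hom X (gd b - dg c)) \<and> matrix_map r s g ` free_module X s = N"
proof -
  obtain G where G: "G \<subseteq> N" "finite G" "\<And>g. g \<in> G \<Longrightarrow> \<exists>d. g \<in> free_comp X r dg d" "N \<subseteq> poly_span X G"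
    using graded_submodule_fg[OF assms] by blast
  obtain g where bij: "bij_betw g {..<card G} G"
    using ex_bij_betw_nat_finite[OF G(2)] by (auto simp: atLeast0LessThan)
  define gd where "gd b = (SOME d. g b \<in> free_comp X r dg d)" for b
  have gG: "g b \<in> G" if "b < card G" for b using bij that by (auto simp: bij_betw_def)
  have gd: "g b \<in> free_comp X r dg (gd b)" if "b < card G" for b
    unfolding gd_def using G(3)[OF gG[OF that]] by (rule someI_ex)
  have gz: "g b c = 0" if "b < card G" "\<not> c < r" for b c
    using gd[OF that(1)] that(2) by (auto simp: free_comp_def split: if_splits)
  have comb: "matrix_map r (card G) g v = (\<lambda>c. \<Sum>b<card G. v b * g b c)" for v
    by (auto simp: matrix_map_def fun_eq_iff gz)
  have sumN: "(\<Sum>i\<in>I. f i) \<in> N" if "\<And>i. i \<in> I \<Longrightarrow> f i \<in> N" for f :: "nat \<Rightarrow> nat \<Rightarrow> ('x,'k) mpoly" and I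
    using that by (induction I rule: infinite_finite_induct) (use graded_submoduleD[OF N] in auto)
  have "matrix_map r (card G) g v \<in> N" if "v \<in> free_module X (card G)" for v
  proof -
    have "(\<Sum>b<card G. (\<lambda>c. v b * g b c)) \<in> N"
      using gG G(1) that by (intro sumN graded_submoduleD(4)[OF N]) (auto simp: free_module_def)
    moreover have "(\<Sum>b<card G. (\<lambda>c. v b * g b c)) = (\<lambda>c. \<Sum>b<card G. v b * g b c)"
      by (auto simp: fun_eq_iff sum_fun_apply)
    ultimately show ?thesis by (simp add: comb)
  qed
  moreover have "v \<in> matrix_map r (card G) g ` free_module X (card G)" if v: "v \<in> N" for v
  proof -
    obtain c where c: "\<forall>h\<in>G. c h \<in> mpolys X" "v = (\<lambda>b. \<Sum>h\<in>G. c h * h b)"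
      using v G(4) by (auto simp: poly_span_def)
    define u where "u b = (if b < card G then c (g b) else 0)" for b
    have "(\<Sum>h\<in>G. c h * h i) = (\<Sum>b<card G. u b * g b i)" for i
      unfolding sum.reindex_bij_betw[OF bij, symmetric] u_def by (auto intro!: sum.cong)
    then have "v = matrix_map r (card G) g u" by (simp add: comb c)
    moreover have "u \<in> free_module X (card G)" using c gG by (auto simp: u_def free_module_def)
    ultimately show ?thesis by blast
  qed
  ultimately have "matrix_map r (card G) g ` free_module X (card G) = N" by blast
  moreover have "\<forall>b<card G. \<forall>c<r. g b c \<in> mpolys_hom X (gd b - dg c)"
    using gd by (auto simp: free_comp_def)
  ultimately show ?thesis by blast
qed

text \<open>Kernels are graded submodules, so they can be covered by a free module of finite rank again and again, starting with
the kernel of the map from the polynomial ring onto the cyclic module.\<close>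

lemma graded_free_resolution_exists:
  fixes M :: "(('x, 'k::field) mpoly, 'm::ab_group_add) gmodule"
  assumes X: "finite X" and a: "a \<in> gcomp M 0"
    and gen: "(\<lambda>p. gact M p a) ` mpolys X = gcarrier M"
    and ker: "graded_submodule X 1 (\<lambda>_. 0) {v \<in> free_module X 1. gact M (v 0) a = 0}"
  shows "\<exists>F. graded_free_resolution X M F"
proof -
  define N0 where "N0 = {v \<in> free_module X 1. gact M (v 0) a = 0}"
  \<comment> \<open>A state consists of a free module, the map from it to the previous one, and the kernel that
    comes next; at index 0 the map is a dummy.\<close>
  define P where "P n st \<longleftrightarrow> (case st of (r, dg, g, N) \<Rightarrow> graded_submodule X r dg N \<and>
      (n = 0 \<longrightarrow> r = 1 \<and> dg = (\<lambda>_. 0) \<and> N = N0))"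
    for n :: nat and st :: "nat \<times> (nat \<Rightarrow> int) \<times> (nat \<Rightarrow> nat \<Rightarrow> ('x,'k) mpoly) \<times> (nat \<Rightarrow> ('x,'k) mpoly) set"
  define Q where "Q st st' \<longleftrightarrow> (case st of (r, dg, g, N) \<Rightarrow> case st' of (r', dg', g', N') \<Rightarrow>
      (\<forall>b<r'. \<forall>c<r. g' b c \<in> mpolys_hom X (dg' b - dg c)) \<and> matrix_map r r' g' ` free_module X r' = N \<and>
      N' = {v \<in> free_module X r'. matrix_map r r' g' v = 0})"
    for st st' :: "nat \<times> (nat \<Rightarrow> int) \<times> (nat \<Rightarrow> nat \<Rightarrow> ('x,'k) mpoly) \<times> (nat \<Rightarrow> ('x,'k) mpoly) set"
  have "\<exists>f. \<forall>n. P n (f n) \<and> Q (f n) (f (Suc n))"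
  proof (rule dependent_nat_choice)
    show "\<exists>st. P 0 st" using ker by (auto simp: P_def N0_def intro!: exI)
  next
    fix st n assume "P n st"
    moreover obtain r dg g N where st: "st = (r, dg, g, N)" by (cases st)
    ultimately have N: "graded_submodule X r dg N" by (simp add: P_def)
    obtain s gd h where h: "\<forall>b<s. \<forall>c<r. h b c \<in> mpolys_hom X (gd b - dg c)" "matrix_map r s h ` free_module X s = N"
      using graded_submodule_cover[OF X N] by blast
    have "graded_submodule X s gd {v \<in> free_module X s. matrix_map r s h v = 0}"
      by (rule graded_submodule_kernel[of s r h X gd dg]) (use h in auto)
    then have "P (Suc n) (s, gd, h, {v \<in> free_module X s. matrix_map r s h v = 0}) \<and> Q st (s, gd, h, {v \<in> free_module X s. matrix_map r s h v = 0})"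
      using h by (simp add: P_def Q_def st)
    then show "\<exists>st'. P (Suc n) st' \<and> Q st st'" by blast
  qed
  then obtain f where f: "\<And>n. P n (f n)" "\<And>n. Q (f n) (f (Suc n))" by blast
  define F :: "(('x,'k) mpoly, 'm) fcomplex" where
    "F = \<lparr>frank = (\<lambda>n. fst (f n)), fdeg = (\<lambda>n. fst (snd (f n))), fmat = (\<lambda>n. fst (snd (snd (f (Suc n))))), faug = (\<lambda>_. a)\<rparr>"
  define K where "K n = snd (snd (snd (f n)))" for n
  have r0: "frank F 0 = 1" "fdeg F 0 = (\<lambda>_. 0)" "K 0 = N0"
    using f(1)[of 0] by (auto simp: P_def F_def K_def split: prod.splits)
  have hom: "fmat F i b c \<in> mpolys_hom X (fdeg F (Suc i) b - fdeg F i c)"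
    if "b < frank F (Suc i)" "c < frank F i" for i b c
    using f(2)[of i] that by (auto simp: Q_def F_def split: prod.splits)
  have img: "fdiff F i ` fmod X F (Suc i) = K i" for i
    using f(2)[of i] unfolding fdiff_matrix_map fmod_free_module
    by (auto simp: Q_def F_def K_def split: prod.splits)
  have K: "K (Suc i) = {v \<in> fmod X F (Suc i). fdiff F i v = 0}" for i
    using f(2)[of i] unfolding fdiff_matrix_map fmod_free_module
    by (auto simp: Q_def F_def K_def split: prod.splits)
  have aug: "faugmap M F v = gact M (v 0) a" for v
    by (simp add: faugmap_def r0(1)) (simp add: F_def)
  have "faugmap M F ` fmod X F 0 = gcarrier M"
  proof -
    have "faugmap M F ` fmod X F 0 = (\<lambda>p. gact M p a) ` (\<lambda>v. v 0) ` fmod X F 0"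
      by (simp add: aug image_image)
    also have "(\<lambda>v. v 0) ` fmod X F 0 = mpolys X"
    proof (intro equalityI subsetI)
      fix p :: "('x,'k) mpoly" assume "p \<in> mpolys X"
      then have "(\<lambda>b. if b < 1 then p else 0) \<in> fmod X F 0" by (auto simp: fmod_def r0)
      then show "p \<in> (\<lambda>v. v 0) ` fmod X F 0"
        by (intro image_eqI[where x = "\<lambda>b. if b < 1 then p else 0"]) auto
    qed (force simp: fmod_def r0)
    finally show ?thesis using gen by simp
  qed
  moreover have "{v \<in> fmod X F 0. faugmap M F v = 0} = fdiff F 0 ` fmod X F (Suc 0)"
    unfolding img by (simp add: r0 N0_def aug fmod_free_module)
  moreover have "{v \<in> fmod X F (Suc i). fdiff F i v = (\<lambda>_. 0)} = fdiff F (Suc i) ` fmod X F (Suc (Suc i))" for i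
    unfolding img K by (simp add: zero_fun_def)
  ultimately have "graded_free_resolution X M F"
    unfolding graded_free_resolution_def using hom a r0(1,2) by (simp add: F_def)
  then show ?thesis by blast
qed

section \<open>The Koszul complex\<close>

text \<open>The sign of adding \<open>x\<close> to \<open>R\<close>, for the order of the variables given by the injection \<open>ix\<close>.\<close>

definition koszul_sign :: "('x \<Rightarrow> nat) \<Rightarrow> 'x \<Rightarrow> 'x set \<Rightarrow> 'a::comm_ring_1" where
  "koszul_sign ix x R = (- 1) ^ card {y \<in> R. ix y < ix x}"

text \<open>The Koszul differential of the sequence \<open>u\<close>. An element of the Koszul complex is a function \<open>v\<close> on the subsets of \<open>X\<close>;
\<open>v S\<close> is the coefficient at the wedge of the elements of \<open>S\<close>.\<close>

definition koszul :: "'x set \<Rightarrow> ('x \<Rightarrow> nat) \<Rightarrow> ('x \<Rightarrow> 'a) \<Rightarrow> ('x set \<Rightarrow> 'a::comm_ring_1) \<Rightarrow> 'x set \<Rightarrow> 'a" where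
  "koszul X ix u v R = (\<Sum>x\<in>X - R. koszul_sign ix x R * u x * v (insert x R))"

lemma koszul_sign_insert:
  assumes "finite R" "y \<notin> R"
  shows "koszul_sign ix x (insert y R) = (if ix y < ix x then - koszul_sign ix x R else koszul_sign ix x R)"
proof (cases "ix y < ix x")
  case True
  then have "{z \<in> insert y R. ix z < ix x} = insert y {z \<in> R. ix z < ix x}" by auto
  then show ?thesis using assms True by (simp add: koszul_sign_def)
next
  case False
  then have "{z \<in> insert y R. ix z < ix x} = {z \<in> R. ix z < ix x}" by auto
  then show ?thesis using False by (simp add: koszul_sign_def)
qed

lemma koszul_sign_cases: "(koszul_sign ix x R :: 'a::comm_ring_1) = 1 \<or> (koszul_sign ix x R :: 'a) = - 1"
  by (simp add: koszul_sign_def minus_one_power_iff)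

lemma koszul_sign_square [simp]: "koszul_sign ix x R * (koszul_sign ix x R * a) = (a::'a::comm_ring_1)"
  using koszul_sign_cases[of ix x R, where 'a = 'a] by auto

text \<open>Antisymmetry of each pair of terms, and not of the whole sum, is used, so the characteristic may be 2.\<close>

lemma sum_antisymmetric:
  fixes f :: "'x \<Rightarrow> 'x \<Rightarrow> 'a::ab_group_add"
  assumes "finite Y" "\<And>x y. x \<in> Y \<Longrightarrow> y \<in> Y \<Longrightarrow> x \<noteq> y \<Longrightarrow> f x y = - f y x"
  shows "(\<Sum>x\<in>Y. \<Sum>y\<in>Y - {x}. f x y) = 0"
  using assms
proof (induction Y rule: finite_induct)
  case (insert a Y)
  have "(\<Sum>y\<in>insert a Y - {x}. f x y) = f x a + (\<Sum>y\<in>Y - {x}. f x y)" if "x \<in> Y" for x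
  proof -
    have "insert a Y - {x} = insert a (Y - {x})" using that insert.hyps by auto
    then show ?thesis using insert.hyps by simp
  qed
  then have "(\<Sum>x\<in>Y. \<Sum>y\<in>insert a Y - {x}. f x y) = (\<Sum>x\<in>Y. f x a) + (\<Sum>x\<in>Y. \<Sum>y\<in>Y - {x}. f x y)"
    by (simp add: sum.distrib)
  also have "(\<Sum>x\<in>Y. \<Sum>y\<in>Y - {x}. f x y) = 0"
    by (rule insert.IH) (rule insert.prems; blast)
  also have "(\<Sum>x\<in>Y. f x a) = - (\<Sum>x\<in>Y. f a x)"
    unfolding sum_negf[symmetric]
  proof (rule sum.cong)
    fix x assume "x \<in> Y"
    with insert.hyps show "f x a = - f a x" by (intro insert.prems) auto
  qed simp
  finally show ?case using insert.hyps by (simp add: insert_Diff_if)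
qed simp

lemma koszul_koszul:
  assumes X: "finite X" and ix: "inj_on ix X" and R: "R \<subseteq> X"
  shows "koszul X ix u (koszul X ix u v) R = 0"
proof -
  have finR: "finite R" using X R finite_subset by auto
  define f where "f x y = koszul_sign ix x R * u x * (koszul_sign ix y (insert x R) * u y * v (insert y (insert x R)))" for x y
  have "koszul X ix u (koszul X ix u v) R = (\<Sum>x\<in>X - R. \<Sum>y\<in>(X - R) - {x}. f x y)"
    unfolding koszul_def f_def sum_distrib_left by (intro sum.cong) auto
  also have "\<dots> = 0"
  proof (rule sum_antisymmetric)
    fix x y assume xy: "x \<in> X - R" "y \<in> X - R" "x \<noteq> y"
    then have "ix x \<noteq> ix y" using ix by (auto simp: inj_on_def)
    then have "ix x < ix y \<or> ix y < ix x" by auto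
    then show "f x y = - f y x"
      using xy finR by (auto simp: f_def koszul_sign_insert insert_commute algebra_simps)
  qed (use X in simp)
  finally show ?thesis .
qed

lemma koszul_sign_mult_coef: "coef (koszul_sign ix x R * p) m = koszul_sign ix x R * coef (p :: ('x,'k::comm_ring_1) mpoly) m"
  by (cases "even (card {y \<in> R. ix y < ix x})") (auto simp: koszul_sign_def)

lemma koszul_sign_mpolys_hom: "p \<in> mpolys_hom X d \<Longrightarrow> koszul_sign ix x R * p \<in> mpolys_hom X d"
  for p :: "('x,'k::comm_ring_1) mpoly"
  by (cases "even (card {y \<in> R. ix y < ix x})") (auto simp: koszul_sign_def mpolys_hom_uminus)

lemma coef_mvar_mult:
  "coef (mvar x * p) m = (if x \<in> supp m then coef (p :: ('x,'k::comm_ring_1) mpoly) (m - sing x 1) else 0)"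
proof (cases "x \<in> supp m")
  case True
  have "m = sing x 1 + (m - sing x 1)"
    by (rule poly_mapping_eqI) (use True in \<open>auto simp: lookup_add lookup_minus lookup_single when_def in_keys_iff\<close>)
  then show ?thesis using True coef_single_mult_add[of "sing x 1" 1 p "m - sing x 1"] by (simp add: mvar_def)
next
  case False
  then have "m \<notin> supp (mvar x * p)"
    by (auto simp: mvar_def supp_add_nat dest!: subsetD[OF keys_mult])
  then show ?thesis using False by (simp add: in_keys_iff)
qed

lemma coef_koszul_mvar:
  fixes v :: "'x set \<Rightarrow> ('x,'k::comm_ring_1) mpoly"
  assumes "finite X"
  shows "coef (koszul X ix mvar v R) m =
     (\<Sum>x\<in>(X - R) \<inter> supp m. koszul_sign ix x R * coef (v (insert x R)) (m - sing x 1))"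
  unfolding koszul_def lookup_sum mult.assoc koszul_sign_mult_coef coef_mvar_mult
  using assms by (intro sum.mono_neutral_cong_right) auto

definition pick :: "'x set \<Rightarrow> 'x" where "pick A = (SOME t. t \<in> A)"

lemma pick_in: "A \<noteq> {} \<Longrightarrow> pick A \<in> A"
  unfolding pick_def by (rule someI_ex) auto

text \<open>The strand of the Koszul complex of a polynomial ring in a multidegree with support \<open>A\<close> is the chain complex of the full
simplex on \<open>A\<close>. For \<open>A \<noteq> {}\<close> that simplex is a cone with apex \<open>pick A\<close>, and this is the cone construction in
all multidegrees at once. At the monomial \<open>m\<close> and the set \<open>S\<close> the multidegree has support \<open>supp m \<union> S\<close>;
removing \<open>t\<close> from \<open>S\<close> while multiplying \<open>m\<close> by \<open>t\<close> does not change it.\<close>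

definition koszul_contraction :: "('x \<Rightarrow> nat) \<Rightarrow> ('x set \<Rightarrow> ('x,'k::comm_ring_1) mpoly) \<Rightarrow> 'x set \<Rightarrow> ('x,'k) mpoly" where
  "koszul_contraction ix v S = Abs_poly_mapping (\<lambda>m. let t = pick (supp m \<union> S) in
     if t \<in> S then koszul_sign ix t (S - {t}) * coef (v (S - {t})) (m + sing t 1) else 0)"

lemma coef_koszul_contraction:
  assumes "finite S"
  shows "coef (koszul_contraction ix v S) m = (let t = pick (supp m \<union> S) in
     if t \<in> S then koszul_sign ix t (S - {t}) * coef (v (S - {t})) (m + sing t 1) else 0)" (is "_ = ?f m")
proof -
  have "{m. ?f m \<noteq> 0} \<subseteq> (\<Union>t\<in>S. (\<lambda>m. m + sing t 1) -` supp (v (S - {t})))"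
  proof
    fix m assume "m \<in> {m. ?f m \<noteq> 0}"
    then have "pick (supp m \<union> S) \<in> S"
      "coef (v (S - {pick (supp m \<union> S)})) (m + sing (pick (supp m \<union> S)) 1) \<noteq> 0"
      by (auto simp: Let_def split: if_splits)
    then show "m \<in> (\<Union>t\<in>S. (\<lambda>m. m + sing t 1) -` supp (v (S - {t})))"
      by (intro UN_I[of "pick (supp m \<union> S)"]) (simp_all add: in_keys_iff)
  qed
  moreover have "finite (\<Union>t\<in>S. (\<lambda>m. m + sing t 1) -` supp (v (S - {t})))"
    using assms by (auto intro!: finite_vimageI simp: inj_def)
  ultimately have "finite {m. ?f m \<noteq> 0}" by (rule finite_subset)
  then show ?thesis by (simp add: koszul_contraction_def)
qed

text \<open>The apex \<open>t\<close> either lies outside \<open>R\<close>, and then only the term of \<open>t\<close> survives in the differential, or it lies in \<open>R\<close>, and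
then the equation that says that \<open>v\<close> is a cycle at \<open>R - {t}\<close> expresses \<open>v R\<close> by the other terms. The only
multidegree without apex is 0.\<close>

lemma koszul_contraction_homotopy:
  fixes v :: "'x set \<Rightarrow> ('x,'k::comm_ring_1) mpoly"
  assumes X: "finite X" and ix: "inj_on ix X" and R: "R \<subseteq> X" and m: "supp m \<subseteq> X" and ne: "supp m \<union> R \<noteq> {}"
    and cyc: "\<And>R. R \<subseteq> X \<Longrightarrow> koszul X ix mvar v R = 0"
  shows "coef (koszul X ix mvar (koszul_contraction ix v) R) m = coef (v R) m"
proof -
  have finR: "finite R" using X R finite_subset by auto
  define A where "A = supp m \<union> R"
  define t where "t = pick A"
  have t: "t \<in> A" "t \<in> X" using pick_in[of A] ne m R by (auto simp: t_def A_def)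
  have sub: "supp (m - sing x 1) \<union> insert x R = A" if "x \<in> supp m" for x
    using that by (auto simp: A_def in_keys_iff lookup_minus lookup_single when_def split: if_splits)
  have mx: "m - sing x 1 + sing x 1 = m" if "x \<in> supp m" for x
    by (rule poly_mapping_eqI) (use that in \<open>auto simp: lookup_add lookup_minus lookup_single when_def in_keys_iff\<close>)
  have lhs: "coef (koszul X ix mvar (koszul_contraction ix v) R) m = (\<Sum>x\<in>(X - R) \<inter> supp m. koszul_sign ix x R *
     (if t \<in> insert x R then koszul_sign ix t (insert x R - {t}) * coef (v (insert x R - {t})) (m - sing x 1 + sing t 1) else 0))"
    unfolding coef_koszul_mvar[OF X]
  proof (rule sum.cong)
    fix x assume "x \<in> (X - R) \<inter> supp m"
    then have "pick (supp (m - sing x 1) \<union> insert x R) = t" using sub by (auto simp: t_def)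
    then show "koszul_sign ix x R * coef (koszul_contraction ix v (insert x R)) (m - sing x 1) = koszul_sign ix x R *
     (if t \<in> insert x R then koszul_sign ix t (insert x R - {t}) * coef (v (insert x R - {t})) (m - sing x 1 + sing t 1) else 0)"
      using finR by (subst coef_koszul_contraction) (auto simp: Let_def)
  qed simp
  show ?thesis
  proof (cases "t \<in> R")
    case False
    then have tm: "t \<in> supp m" using t by (auto simp: A_def)
    have "coef (koszul X ix mvar (koszul_contraction ix v) R) m = (\<Sum>x\<in>(X - R) \<inter> supp m. if x = t then coef (v R) m else 0)"
      unfolding lhs by (intro sum.cong) (use False mx[OF tm] in auto)
    also have "\<dots> = coef (v R) m" using X tm t False by (subst sum.delta) auto
    finally show ?thesis .
  next
    case True
    define Q where "Q = R - {t}"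
    have Q: "R = insert t Q" "t \<notin> Q" "finite Q" "Q \<subseteq> X" using True finR R by (auto simp: Q_def)
    have eq: "(X - Q) \<inter> supp (m + sing t 1) = insert t ((X - R) \<inter> supp m)"
      using Q t by (auto simp: in_keys_iff lookup_add lookup_single when_def split: if_splits)
    have sw: "m + sing t 1 - sing x 1 = m - sing x 1 + sing t 1" if "x \<in> supp m" for x
      by (rule poly_mapping_eqI) (use that in \<open>auto simp: lookup_add lookup_minus lookup_single when_def in_keys_iff\<close>)
    have "0 = coef (koszul X ix mvar v Q) (m + sing t 1)" using cyc[OF Q(4)] by simp
    also have "\<dots> = koszul_sign ix t Q * coef (v R) m +
       (\<Sum>x\<in>(X - R) \<inter> supp m. koszul_sign ix x Q * coef (v (insert x Q)) (m - sing x 1 + sing t 1))"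
      unfolding coef_koszul_mvar[OF X] eq using X Q(1) sw by simp
    finally have "koszul_sign ix t Q * coef (v R) m =
       - (\<Sum>x\<in>(X - R) \<inter> supp m. koszul_sign ix x Q * coef (v (insert x Q)) (m - sing x 1 + sing t 1))"
      by (simp add: eq_neg_iff_add_eq_0)
    then have "koszul_sign ix t Q * (koszul_sign ix t Q * coef (v R) m) = koszul_sign ix t Q *
       - (\<Sum>x\<in>(X - R) \<inter> supp m. koszul_sign ix x Q * coef (v (insert x Q)) (m - sing x 1 + sing t 1))" by simp
    then have "coef (v R) m =
       (\<Sum>x\<in>(X - R) \<inter> supp m. - koszul_sign ix t Q * koszul_sign ix x Q * coef (v (insert x Q)) (m - sing x 1 + sing t 1))"
      by (simp add: sum_distrib_left sum_negf mult.assoc)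
    also have "\<dots> = coef (koszul X ix mvar (koszul_contraction ix v) R) m"
      unfolding lhs
    proof (rule sum.cong)
      fix x assume x: "x \<in> (X - R) \<inter> supp m"
      have "insert x R - {t} = insert x Q" using Q x by auto
      moreover have "x \<noteq> t" "x \<notin> Q" using x Q by auto
      ultimately show "- koszul_sign ix t Q * koszul_sign ix x Q * coef (v (insert x Q)) (m - sing x 1 + sing t 1) =
        koszul_sign ix x R * (if t \<in> insert x R then koszul_sign ix t (insert x R - {t}) * coef (v (insert x R - {t})) (m - sing x 1 + sing t 1) else 0)"
        using Q(3) Q(2) t(2) x ix by (auto simp: Q(1) koszul_sign_insert inj_on_def)
    qed simp
    finally show ?thesis by simp
  qed
qed

lemma koszul_contraction_hom:
  fixes v :: "'x set \<Rightarrow> ('x,'k::comm_ring_1) mpoly"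
  assumes X: "finite X" and S: "S \<subseteq> X" and v: "\<And>T. T \<subseteq> X \<Longrightarrow> v T \<in> mpolys_hom X (d - int (card T))"
  shows "koszul_contraction ix v S \<in> mpolys_hom X (d - int (card S))"
  unfolding mpolys_hom_def mpolys_def
proof (intro CollectI conjI ballI)
  have finS: "finite S" using X S finite_subset by auto
  fix m assume "m \<in> supp (koszul_contraction ix v S)"
  then have "coef (koszul_contraction ix v S) m \<noteq> 0" by (simp add: in_keys_iff)
  then have "pick (supp m \<union> S) \<in> S"
      "coef (v (S - {pick (supp m \<union> S)})) (m + sing (pick (supp m \<union> S)) 1) \<noteq> 0"
    by (auto simp: coef_koszul_contraction[OF finS] Let_def split: if_splits)
  then obtain t where t: "t \<in> S" "m + sing t 1 \<in> supp (v (S - {t}))"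
    by (auto simp: in_keys_iff)
  have "v (S - {t}) \<in> mpolys_hom X (d - int (card (S - {t})))" using S by (intro v) auto
  then have "supp (m + sing t 1) \<subseteq> X" "int (mdeg (m + sing t 1)) = d - int (card (S - {t}))"
    using t(2) unfolding mpolys_hom_def mpolys_def by blast+
  moreover have "card S = Suc (card (S - {t}))" using card.remove[OF finS t(1)] .
  ultimately show "supp m \<subseteq> X" "int (mdeg m) = d - int (card S)"
    by (auto simp: supp_add_nat)
qed

text \<open>The Koszul complex of the variables is exact apart from the constants in homological degree 0: the contraction of a
cycle is a preimage. For \<open>b = 0\<close> this says that a polynomial without constant term is a combination of the variables.\<close>

lemma koszul_exact:
  fixes v :: "'x set \<Rightarrow> ('x,'k::comm_ring_1) mpoly"
  assumes X: "finite X" and ix: "inj_on ix X"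
    and v: "\<And>S. if S \<subseteq> X \<and> card S = b then v S \<in> mpolys_hom X (d - int b) else v S = 0"
    and cyc: "\<And>R. R \<subseteq> X \<Longrightarrow> koszul X ix mvar v R = 0"
    and const: "coef (v {}) 0 = 0"
  shows "\<exists>u. (\<forall>S. if S \<subseteq> X \<and> card S = Suc b then u S \<in> mpolys_hom X (d - int (Suc b)) else u S = 0) \<and>
     koszul X ix mvar u = v"
proof -
  define u where "u S = (if S \<subseteq> X \<and> card S = Suc b then koszul_contraction ix v S else 0)" for S
  have v': "v T \<in> mpolys_hom X (d - int (card T))" for T
  proof (cases "T \<subseteq> X \<and> card T = b")
    case True
    with v[of T] show ?thesis by simp
  next
    case False
    with v[of T] have "v T = 0" by simp
    then show ?thesis by simp
  qed
  have vz: "v T = 0" if "\<not> (T \<subseteq> X \<and> card T = b)" for T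
    using v[of T] that by simp
  have hz: "koszul_contraction ix v S = 0" if "S \<subseteq> X" "card S \<noteq> Suc b" for S
  proof (rule poly_mapping_eqI)
    fix m
    have finS: "finite S" using X that(1) finite_subset by auto
    have "v (S - {t}) = 0" if t: "t \<in> S" for t
    proof -
      have "card S = Suc (card (S - {t}))" using card.remove[OF finS t] .
      with \<open>card S \<noteq> Suc b\<close> show ?thesis by (intro vz) simp
    qed
    then show "coef (koszul_contraction ix v S) m = coef 0 m" by (simp add: coef_koszul_contraction[OF finS] Let_def)
  qed
  have uh: "u S = koszul_contraction ix v S" if "S \<subseteq> X" for S using hz that by (auto simp: u_def)
  have "if S \<subseteq> X \<and> card S = Suc b then u S \<in> mpolys_hom X (d - int (Suc b)) else u S = 0" for S
  proof (cases "S \<subseteq> X \<and> card S = Suc b")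
    case True
    then show ?thesis using koszul_contraction_hom[OF X conjunct1[OF True] v', of ix] by (simp add: u_def)
  qed (auto simp: u_def)
  moreover have "koszul X ix mvar u R = v R" for R
  proof (cases "R \<subseteq> X")
    case False
    then show ?thesis using vz[of R] by (auto simp: koszul_def u_def intro!: sum.neutral)
  next
    case True
    have "koszul X ix mvar u R = koszul X ix mvar (koszul_contraction ix v) R"
      unfolding koszul_def using True by (intro sum.cong) (auto simp: uh)
    moreover have "coef (koszul X ix mvar (koszul_contraction ix v) R) m = coef (v R) m" for m
    proof (cases "supp m \<union> R = {}")
      case True
      then show ?thesis using const by (simp add: coef_koszul_mvar[OF X])
    next
      case ne: False
      show ?thesis
      proof (cases "supp m \<subseteq> X")
        case True
        show ?thesis by (rule koszul_contraction_homotopy[OF X ix \<open>R \<subseteq> X\<close> True ne cyc])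
      next
        case False
        have "koszul X ix mvar (koszul_contraction ix v) R \<in> mpolys X"
          unfolding koszul_def mult.assoc
        proof (rule mpolys_sum)
          fix x assume x: "x \<in> X - R"
          with \<open>R \<subseteq> X\<close> have "koszul_contraction ix v (insert x R) \<in> mpolys_hom X (d - int (card (insert x R)))"
            by (intro koszul_contraction_hom[OF X _ v']) auto
          from mpolys_hom_mult[OF mpolys_hom_mvar this, of x] x
          show "koszul_sign ix x R * (mvar x * koszul_contraction ix v (insert x R)) \<in> mpolys X"
            by (intro mpolys_homD[OF koszul_sign_mpolys_hom]) auto
        qed
        moreover have "v R \<in> mpolys X" using v' mpolys_homD by blast
        ultimately have "m \<notin> supp (koszul X ix mvar (koszul_contraction ix v) R)" "m \<notin> supp (v R)"
          using False by (auto simp: mpolys_def)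
        then show ?thesis by (simp add: in_keys_iff)
      qed
    qed
    ultimately show ?thesis by (auto intro: poly_mapping_eqI)
  qed
  ultimately show ?thesis by (intro exI[of _ u] conjI allI ext)
qed

section \<open>Double complexes\<close>

text \<open>A first quadrant double complex with commuting differentials, exact rows and columns except at the ends
\<open>a = 0\<close> and \<open>b = 0\<close>. The cokernels there are the two complexes whose homologies are compared.\<close>

locale double_complex =
  fixes C :: "nat \<Rightarrow> nat \<Rightarrow> 'g::ab_group_add set" and d k :: "nat \<Rightarrow> nat \<Rightarrow> 'g \<Rightarrow> 'g"
  assumes C_zero: "0 \<in> C a b" and C_diff: "x \<in> C a b \<Longrightarrow> y \<in> C a b \<Longrightarrow> x - y \<in> C a b"
    and d_in: "x \<in> C (Suc a) b \<Longrightarrow> d a b x \<in> C a b"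
    and k_in: "x \<in> C a (Suc b) \<Longrightarrow> k a b x \<in> C a b"
    and d_diff: "d a b (x - y) = d a b x - d a b y"
    and k_diff: "k a b (x - y) = k a b x - k a b y"
    and d_d: "x \<in> C (Suc (Suc a)) b \<Longrightarrow> d a b (d (Suc a) b x) = 0"
    and k_k: "x \<in> C a (Suc (Suc b)) \<Longrightarrow> k a b (k a (Suc b) x) = 0"
    and d_k: "x \<in> C (Suc a) (Suc b) \<Longrightarrow> d a b (k (Suc a) b x) = k a b (d a (Suc b) x)"
    and d_exact: "x \<in> C (Suc a) b \<Longrightarrow> d a b x = 0 \<Longrightarrow> \<exists>y\<in>C (Suc (Suc a)) b. d (Suc a) b y = x"
    and k_exact: "x \<in> C a (Suc b) \<Longrightarrow> k a b x = 0 \<Longrightarrow> \<exists>y\<in>C a (Suc (Suc b)). k a (Suc b) y = x"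
begin

text \<open>Being a boundary for both differentials together: at \<open>b = 0\<close>, and likewise at \<open>a = 0\<close>, this says that the class of
\<open>c\<close> in the cokernel is a boundary there.\<close>

definition boundary :: "nat \<Rightarrow> nat \<Rightarrow> 'g \<Rightarrow> bool" where
  "boundary a b c \<longleftrightarrow> (\<exists>e\<in>C (Suc a) b. \<exists>f\<in>C a (Suc b). c = d a b e + k a b f)"

lemma k_0: "k a b 0 = 0"
  using k_diff[of a b 0 0] by simp

text \<open>One step of the zigzag between the two ends: when \<open>k c = d c'\<close>, the elements \<open>c\<close> and \<open>c'\<close> represent corresponding
classes. If \<open>c = d e + k f\<close>, then \<open>c' - k e\<close> is killed by \<open>d\<close>, and exactness applies.\<close>

lemma boundary_step_right:
  assumes c: "c \<in> C a (Suc b)" "c' \<in> C (Suc a) b" "k a b c = d a b c'" and bd: "boundary a (Suc b) c"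
  shows "boundary (Suc a) b c'"
proof -
  obtain e f where ef: "e \<in> C (Suc a) (Suc b)" "f \<in> C a (Suc (Suc b))" "c = d a (Suc b) e + k a (Suc b) f"
    using bd by (auto simp: boundary_def)
  have "k a b (c - k a (Suc b) f) = k a b c - 0" using k_k[OF ef(2)] by (simp add: k_diff)
  then have "d a b c' = d a b (k (Suc a) b e)" using ef d_k[OF ef(1)] c(3) by simp
  then have "d a b (c' - k (Suc a) b e) = 0" by (simp add: d_diff)
  then obtain g where "g \<in> C (Suc (Suc a)) b" "d (Suc a) b g = c' - k (Suc a) b e"
    using d_exact[OF C_diff[OF c(2) k_in[OF ef(1)]]] by auto
  then show ?thesis unfolding boundary_def using ef(1)
    by (intro bexI[of _ g] bexI[of _ e]) auto
qed

end

lemma (in double_complex) flip: "double_complex (\<lambda>a b. C b a) (\<lambda>a b. k b a) (\<lambda>a b. d b a)"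
  by unfold_locales
     (auto intro: C_zero C_diff d_in k_in simp: d_diff k_diff d_d k_k d_k d_exact k_exact)

context double_complex
begin

lemma boundary_step_left:
  assumes "c \<in> C a (Suc b)" "c' \<in> C (Suc a) b" "k a b c = d a b c'" "boundary (Suc a) b c'"
  shows "boundary a (Suc b) c"
proof -
  interpret fl: double_complex "\<lambda>a b. C b a" "\<lambda>a b. k b a" "\<lambda>a b. d b a" by (rule flip)
  have "fl.boundary b (Suc a) c'" using assms(4) unfolding boundary_def fl.boundary_def by (metis add.commute)
  from fl.boundary_step_right[OF assms(2,1) assms(3)[symmetric] this]
  show ?thesis unfolding boundary_def fl.boundary_def by (metis add.commute)
qed

text \<open>Walking along the zigzag from the position \<open>(a, b)\<close> to \<open>(a + b, 0)\<close>. A cycle at the end \<open>a = 0\<close> that is no boundary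
there thus produces a cycle at the end \<open>b = 0\<close> that is no boundary.\<close>

lemma transport_non_boundary:
  assumes "c \<in> C a b" "\<not> boundary a b c"
    and "\<And>b'. b = Suc b' \<Longrightarrow> \<exists>e\<in>C (Suc a) b'. k a b' c = d a b' e"
    and "\<And>a'. a = Suc a' \<Longrightarrow> \<exists>f\<in>C a' (Suc b). d a' b c = k a' b f"
  shows "\<exists>c'\<in>C (a + b) 0. \<not> boundary (a + b) 0 c' \<and>
    (\<forall>a'. a + b = Suc a' \<longrightarrow> (\<exists>f\<in>C a' (Suc 0). d a' 0 c' = k a' 0 f))"
  using assms
proof (induction b arbitrary: a c)
  case 0
  then show ?case by (intro bexI[of _ c]) auto
next
  case (Suc b)
  obtain e where e: "e \<in> C (Suc a) b" "k a b c = d a b e" using Suc.prems(3) by blast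
  have "\<exists>c'\<in>C (Suc a + b) 0. \<not> boundary (Suc a + b) 0 c' \<and>
    (\<forall>a'. Suc a + b = Suc a' \<longrightarrow> (\<exists>f\<in>C a' (Suc 0). d a' 0 c' = k a' 0 f))"
  proof (rule Suc.IH[OF e(1)])
    show "\<not> boundary (Suc a) b e" using boundary_step_left[OF Suc.prems(1) e] Suc.prems(2) by blast
    show "\<exists>f\<in>C a' (Suc b). d a' b e = k a' b f" if "Suc a = Suc a'" for a'
      using that e(2) Suc.prems(1) by (intro bexI[of _ c]) auto
    show "\<exists>g\<in>C (Suc (Suc a)) b'. k (Suc a) b' e = d (Suc a) b' g" if b: "b = Suc b'" for b'
    proof -
      have "d a b' (k (Suc a) b' e) = k a b' (d a b e)" using d_k[of e a b'] e(1) b by simp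
      also have "\<dots> = 0" using k_k[of c a b'] Suc.prems(1) e(2)[symmetric] b by simp
      finally show ?thesis using d_exact[of "k (Suc a) b' e" a b'] k_in[of e "Suc a" b'] e(1) b by metis
    qed
  qed
  then show ?case by simp
qed

text \<open>The zigzag in the opposite direction: it reaches the columns \<open>b > m\<close>, where everything is 0, before it
leaves the region \<open>a \<ge> 1\<close> in which the rows are exact.\<close>

lemma vanish_beyond_width:
  assumes width: "\<And>a b. m < b \<Longrightarrow> C a b \<subseteq> {0}"
    and "c \<in> C (Suc a) b" "f \<in> C a (Suc b)" "d a b c = k a b f" "m < Suc a + b"
  shows "boundary (Suc a) b c"
  using assms(2-)
proof (induction "m - b" arbitrary: a b c f)
  case 0
  then have "f = 0" using width[of "Suc b" a] by auto
  then have "d a b c = 0" using 0 by (simp add: k_0)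
  then obtain e where "e \<in> C (Suc (Suc a)) b" "d (Suc a) b e = c" using d_exact 0 by blast
  then show ?case unfolding boundary_def by (intro bexI[of _ e] bexI[of _ 0]) (auto simp: k_0 C_zero)
next
  case (Suc n)
  then obtain a' where a: "a = Suc a'" by (cases a) auto
  have "k a' b (d a' (Suc b) f) = d a' b (d a b c)" using d_k[of f a' b] Suc.prems a by simp
  also have "\<dots> = 0" using d_d[of c a' b] Suc.prems a by simp
  finally have "\<exists>g\<in>C a' (Suc (Suc b)). k a' (Suc b) g = d a' (Suc b) f"
    using k_exact[of "d a' (Suc b) f" a' b] d_in[of f a' "Suc b"] Suc.prems a by blast
  then obtain g where g: "g \<in> C a' (Suc (Suc b))" "d a' (Suc b) f = k a' (Suc b) g" by auto
  have "boundary a (Suc b) f" unfolding a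
    by (rule Suc.hyps(1)[OF _ _ g]) (use Suc a in auto)
  then show ?case using boundary_step_right[of f a b c] Suc.prems by simp
qed

end

section \<open>Tor through the Koszul complex\<close>

lemma coef_0_koszul: "finite X \<Longrightarrow> coef (koszul X ix mvar v R) 0 = (0 :: 'k::comm_ring_1)"
  by (simp add: coef_koszul_mvar)

lemma koszul_sum: "koszul X ix u (\<lambda>S. \<Sum>i\<in>I. f i S) R = (\<Sum>i\<in>I. koszul X ix u (f i) R)"
  unfolding koszul_def sum_distrib_left by (rule sum.swap)

lemma koszul_mult_right: "koszul X ix u (\<lambda>S. v S * a) R = koszul X ix u v R * a"
  unfolding koszul_def sum_distrib_right by (simp add: mult.assoc)

locale resolution =
  fixes X :: "'x set" and ix :: "'x \<Rightarrow> nat"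
    and M :: "(('x, 'k::field) mpoly, 'm::ab_group_add) gmodule"
    and F :: "(('x, 'k) mpoly, 'm) fcomplex"
  assumes X: "finite X" and ix: "inj_on ix X" and F: "graded_free_resolution X M F"
begin

abbreviation FH :: "nat \<Rightarrow> int \<Rightarrow> (nat \<Rightarrow> ('x, 'k) mpoly) set" where
  "FH a e \<equiv> free_comp X (frank F a) (fdeg F a) e"

text \<open>In this order: the matrices are homogeneous, the augmentation is homogeneous, it is surjective, and the
complex is exact at index 0 and at the later indices.\<close>

lemmas resolution_parts = F[unfolded graded_free_resolution_def, THEN conjunct1]
  F[unfolded graded_free_resolution_def, THEN conjunct2, THEN conjunct1]
  F[unfolded graded_free_resolution_def, THEN conjunct2, THEN conjunct2, THEN conjunct1]
  F[unfolded graded_free_resolution_def, THEN conjunct2, THEN conjunct2, THEN conjunct2, THEN conjunct1]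
  F[unfolded graded_free_resolution_def, THEN conjunct2, THEN conjunct2, THEN conjunct2, THEN conjunct2, rule_format]

lemma fmat_hom: "b < frank F (Suc i) \<Longrightarrow> c < frank F i \<Longrightarrow> fmat F i b c \<in> mpolys_hom X (fdeg F (Suc i) b - fdeg F i c)"
  using resolution_parts(1) by blast

lemma fdiff_free_part: "fdiff F i (free_part (fdeg F (Suc i)) e v) = free_part (fdeg F i) e (fdiff F i v)"
  unfolding fdiff_matrix_map by (rule matrix_map_free_part) (rule fmat_hom)

lemma fdiff_FH:
  assumes "v \<in> FH (Suc i) e" shows "fdiff F i v \<in> FH i e"
  unfolding free_comp_def
proof (intro CollectI allI)
  fix c
  have "v b * fmat F i b c \<in> mpolys_hom X (e - fdeg F i c)" if "b < frank F (Suc i)" "c < frank F i" for b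
  proof -
    have "v b \<in> mpolys_hom X (e - fdeg F (Suc i) b)" using assms that by (simp add: free_comp_def)
    from mpolys_hom_mult[OF this fmat_hom[OF that]] show ?thesis by simp
  qed
  then show "if c < frank F i then fdiff F i v c \<in> mpolys_hom X (e - fdeg F i c) else fdiff F i v c = 0"
    by (auto simp: fdiff_def intro!: mpolys_hom_sum)
qed

lemma fdiff_diff: "fdiff F i (v - w) = fdiff F i v - fdiff F i w"
  by (auto simp: fdiff_def fun_eq_iff left_diff_distrib sum_subtractf)

lemma fdiff_0: "fdiff F i 0 = 0"
  by (auto simp: fdiff_def fun_eq_iff)

lemma FH_fmod: "v \<in> FH i e \<Longrightarrow> v \<in> fmod X F i"
  unfolding fmod_free_module by (rule free_comp_free_module)

lemma fdiff_fdiff: "v \<in> fmod X F (Suc (Suc i)) \<Longrightarrow> fdiff F i (fdiff F (Suc i) v) = 0"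
  using resolution_parts(5)[of i] unfolding zero_fun_def by blast

text \<open>Exactness in each degree: take the component of that degree of an arbitrary preimage.\<close>

lemma FH_exact:
  assumes "v \<in> FH (Suc i) e" "fdiff F i v = 0"
  shows "\<exists>u\<in>FH (Suc (Suc i)) e. fdiff F (Suc i) u = v"
proof -
  have "v \<in> {v \<in> fmod X F (Suc i). fdiff F i v = (\<lambda>_. 0)}"
    using assms FH_fmod by (auto simp: zero_fun_def)
  then obtain u where u: "u \<in> fmod X F (Suc (Suc i))" "v = fdiff F (Suc i) u"
    unfolding resolution_parts(5) by blast
  have "fdiff F (Suc i) (free_part (fdeg F (Suc (Suc i))) e u) = v"
    unfolding fdiff_free_part u(2)[symmetric] by (rule free_part_id[OF assms(1)])
  then show ?thesis using free_part_free_comp[of u X "frank F (Suc (Suc i))"] u(1) by (auto simp: fmod_free_module)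
qed

text \<open>The degree \<open>j\<close> part of the double complex that tensors the resolution with the Koszul complex of the variables; \<open>KD\<close>
is the differential of the resolution and \<open>KK\<close> the Koszul differential. A wedge of \<open>b\<close> variables has degree \<open>b\<close>.\<close>

definition KC :: "int \<Rightarrow> nat \<Rightarrow> nat \<Rightarrow> ('x set \<Rightarrow> nat \<Rightarrow> ('x, 'k) mpoly) set" where
  "KC j a b = {v. \<forall>S. if S \<subseteq> X \<and> card S = b then v S \<in> FH a (j - int b) else v S = 0}"

definition KD :: "nat \<Rightarrow> nat \<Rightarrow> ('x set \<Rightarrow> nat \<Rightarrow> ('x, 'k) mpoly) \<Rightarrow> 'x set \<Rightarrow> nat \<Rightarrow> ('x, 'k) mpoly" where
  "KD a b v = (\<lambda>S. fdiff F a (v S))"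

definition KK :: "nat \<Rightarrow> nat \<Rightarrow> ('x set \<Rightarrow> nat \<Rightarrow> ('x, 'k) mpoly) \<Rightarrow> 'x set \<Rightarrow> nat \<Rightarrow> ('x, 'k) mpoly" where
  "KK a b v = (\<lambda>R c. koszul X ix mvar (\<lambda>S. v S c) R)"

lemma KC_I: "(\<And>S. S \<subseteq> X \<Longrightarrow> card S = b \<Longrightarrow> v S \<in> FH a (j - int b)) \<Longrightarrow>
   (\<And>S. \<not> (S \<subseteq> X \<and> card S = b) \<Longrightarrow> v S = 0) \<Longrightarrow> v \<in> KC j a b"
  by (simp add: KC_def)

lemma KC_D: "v \<in> KC j a b \<Longrightarrow> S \<subseteq> X \<Longrightarrow> card S = b \<Longrightarrow> v S \<in> FH a (j - int b)"
  by (simp add: KC_def)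

lemma KC_D0: "v \<in> KC j a b \<Longrightarrow> \<not> (S \<subseteq> X \<and> card S = b) \<Longrightarrow> v S = 0"
  unfolding KC_def mem_Collect_eq by (drule spec[of _ S]) simp

lemma FH_0: "0 \<in> FH a e"
  by (simp add: free_comp_def)

lemma KC_FH: "v \<in> KC j a b \<Longrightarrow> v S \<in> FH a (j - int b)"
proof (cases "S \<subseteq> X \<and> card S = b")
  case False
  assume "v \<in> KC j a b"
  with False have "v S = 0" by (intro KC_D0)
  then show ?thesis using FH_0[of a "j - int b"] by (simp only:)
qed (simp add: KC_D)

lemma FH_diff:
  assumes "v \<in> FH a e" "w \<in> FH a e" shows "v - w \<in> FH a e"
  unfolding free_comp_def
proof (intro CollectI allI)
  fix b
  have "v b \<in> mpolys_hom X (e - fdeg F a b)" "- w b \<in> mpolys_hom X (e - fdeg F a b)" if "b < frank F a"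
    using assms that by (auto simp: free_comp_def intro: mpolys_hom_uminus)
  moreover have "v b = 0" "w b = 0" if "\<not> b < frank F a"
    using assms that unfolding free_comp_def by (metis (mono_tags, lifting) mem_Collect_eq)+
  ultimately show "if b < frank F a then (v - w) b \<in> mpolys_hom X (e - fdeg F a b) else (v - w) b = 0"
    using mpolys_hom_add[of "v b" X "e - fdeg F a b" "- w b"] by simp
qed

lemma KK_in: assumes v: "v \<in> KC j a (Suc b)" shows "KK a b v \<in> KC j a b"
proof (rule KC_I)
  fix R assume R: "R \<subseteq> X" "card R = b"
  have finR: "finite R" using R X finite_subset by auto
  show "KK a b v R \<in> FH a (j - int b)"
    unfolding free_comp_def
  proof (intro CollectI allI)
    fix c
    show "if c < frank F a then KK a b v R c \<in> mpolys_hom X (j - int b - fdeg F a c) else KK a b v R c = 0"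
    proof (cases "c < frank F a")
      case True
      have "koszul_sign ix x R * mvar x * v (insert x R) c \<in> mpolys_hom X (j - int b - fdeg F a c)" if "x \<in> X - R" for x
      proof -
        have "v (insert x R) c \<in> mpolys_hom X (j - int (Suc b) - fdeg F a c)"
          using KC_FH[OF v, of "insert x R"] True by (simp add: free_comp_def)
        from mpolys_hom_mult[OF mpolys_hom_mvar this, of x] that
        show ?thesis unfolding mult.assoc by (intro koszul_sign_mpolys_hom) (simp add: algebra_simps)
      qed
      then show ?thesis using True by (auto simp: KK_def koszul_def intro!: mpolys_hom_sum)
    next
      case False
      have "v S c = 0" for S
        using KC_FH[OF v, of S] False unfolding free_comp_def by (metis (mono_tags, lifting) mem_Collect_eq)
      then show ?thesis using False by (simp add: KK_def koszul_def)
    qed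
  qed
next
  fix R assume R: "\<not> (R \<subseteq> X \<and> card R = b)"
  have "v (insert x R) = 0" if "x \<in> X - R" for x
  proof (rule KC_D0[OF v], rule notI)
    assume a: "insert x R \<subseteq> X \<and> card (insert x R) = Suc b"
    then have "finite R" using X finite_subset by auto
    with a that R show False by auto
  qed
  then show "KK a b v R = 0" by (auto simp: KK_def koszul_def fun_eq_iff intro!: sum.neutral)
qed

text \<open>For each basis element of the resolution separately, this is exactness of the Koszul complex of the
polynomial ring. The case \<open>b = 0\<close> is included: there the condition on constant terms says that the image in the
tensor product with the residue field is 0.\<close>

lemma KK_exact_gen:
  assumes v: "v \<in> KC j a b" and cyc: "\<And>R c. R \<subseteq> X \<Longrightarrow> koszul X ix mvar (\<lambda>S. v S c) R = 0"
    and const: "\<And>c. coef (v {} c) 0 = 0"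
  shows "\<exists>u\<in>KC j a (Suc b). KK a b u = v"
proof -
  have "\<exists>u. (\<forall>S. if S \<subseteq> X \<and> card S = Suc b then u S \<in> mpolys_hom X (j - fdeg F a c - int (Suc b)) else u S = 0) \<and>
     koszul X ix mvar u = (\<lambda>S. v S c)" if c: "c < frank F a" for c
  proof (rule koszul_exact[OF X ix _ cyc const])
    fix S
    show "if S \<subseteq> X \<and> card S = b then v S c \<in> mpolys_hom X (j - fdeg F a c - int b) else v S c = 0"
    proof (cases "S \<subseteq> X \<and> card S = b")
      case True
      have "v S c \<in> mpolys_hom X (j - int b - fdeg F a c)"
        using KC_FH[OF v, of S] c by (simp add: free_comp_def)
      then show ?thesis using True by (simp add: algebra_simps)
    next
      case False
      then have "v S = 0" by (rule KC_D0[OF v])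
      with False show ?thesis by (simp only: if_False zero_fun_def)
    qed
  qed
  then obtain u where u: "\<And>c. c < frank F a \<Longrightarrow> 
     (\<forall>S. if S \<subseteq> X \<and> card S = Suc b then u c S \<in> mpolys_hom X (j - fdeg F a c - int (Suc b)) else u c S = 0) \<and>
     koszul X ix mvar (u c) = (\<lambda>S. v S c)"
    by metis
  define w where "w S c = (if c < frank F a then u c S else 0)" for S c
  have "w \<in> KC j a (Suc b)"
  proof (rule KC_I)
    fix S assume S: "S \<subseteq> X" "card S = Suc b"
    have "u c S \<in> mpolys_hom X (j - int (Suc b) - fdeg F a c)" if "c < frank F a" for c
    proof -
      have "u c S \<in> mpolys_hom X (j - fdeg F a c - int (Suc b))" using conjunct1[OF u[OF that]] S by meson
      then show ?thesis by (simp add: algebra_simps)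
    qed
    then show "w S \<in> FH a (j - int (Suc b))" by (simp add: free_comp_def w_def)
  next
    fix S assume "\<not> (S \<subseteq> X \<and> card S = Suc b)"
    then have "u c S = 0" if "c < frank F a" for c using conjunct1[OF u[OF that]] by meson
    then show "w S = 0" by (auto simp: w_def fun_eq_iff)
  qed
  moreover have "KK a b w = v"
  proof (intro ext)
    fix R c
    show "KK a b w R c = v R c"
    proof (cases "c < frank F a")
      case True
      then have "KK a b w R c = koszul X ix mvar (u c) R" by (simp add: KK_def w_def)
      then show ?thesis using u[OF True] by simp
    next
      case False
      have "v R c = 0"
        using KC_FH[OF v, of R] False unfolding free_comp_def by (metis (mono_tags, lifting) mem_Collect_eq)
      then show ?thesis using False by (simp add: KK_def w_def koszul_def)
    qed
  qed
  ultimately show ?thesis by blast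
qed

lemma KC_double_complex: "double_complex (KC j) KD KK"
proof
  fix a b
  show "0 \<in> KC j a b" by (rule KC_I) (auto simp: FH_0)
  fix x y
  show "x - y \<in> KC j a b" if "x \<in> KC j a b" "y \<in> KC j a b"
    using KC_FH[OF that(1)] KC_FH[OF that(2)] KC_D0[OF that(1)] KC_D0[OF that(2)]
    by (intro KC_I) (simp_all add: FH_diff)
  show "KD a b x \<in> KC j a b" if "x \<in> KC j (Suc a) b"
    using KC_FH[OF that] KC_D0[OF that] by (intro KC_I) (simp_all add: KD_def fdiff_FH fdiff_0)
  show "KK a b x \<in> KC j a b" if "x \<in> KC j a (Suc b)" using that by (rule KK_in)
  show "KD a b (x - y) = KD a b x - KD a b y" by (rule ext) (simp add: KD_def fdiff_diff)
  show "KK a b (x - y) = KK a b x - KK a b y"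
    by (intro ext) (simp add: KK_def koszul_def right_diff_distrib sum_subtractf)
  show "KD a b (KD (Suc a) b x) = 0" if "x \<in> KC j (Suc (Suc a)) b"
    using fdiff_fdiff[OF FH_fmod[OF KC_FH[OF that]]] by (intro ext) (simp add: KD_def fun_eq_iff)
  show "KK a b (KK a (Suc b) x) = 0" if x: "x \<in> KC j a (Suc (Suc b))"
  proof (intro ext)
    fix R c
    show "KK a b (KK a (Suc b) x) R c = 0 R c"
    proof (cases "R \<subseteq> X")
      case True
      then show ?thesis using koszul_koszul[OF X ix, of R mvar "\<lambda>S. x S c"] by (simp add: KK_def)
    next
      case False
      then show ?thesis using KC_D0[OF KK_in[OF KK_in[OF x]], of R] by simp
    qed
  qed
  show "KD a b (KK (Suc a) b x) = KK a b (KD a (Suc b) x)" if "x \<in> KC j (Suc a) (Suc b)"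
    by (intro ext) (auto simp: KD_def KK_def fdiff_def koszul_sum koszul_mult_right, simp add: koszul_def)
  show "\<exists>y\<in>KC j (Suc (Suc a)) b. KD (Suc a) b y = x" if x: "x \<in> KC j (Suc a) b" "KD a b x = 0"
  proof -
    have "\<exists>u. u \<in> FH (Suc (Suc a)) (j - int b) \<and> fdiff F (Suc a) u = x S" for S
      using FH_exact[OF KC_FH[OF x(1)], of S] x(2) by (auto simp: KD_def fun_eq_iff)
    then obtain u where u: "\<And>S. u S \<in> FH (Suc (Suc a)) (j - int b)" "\<And>S. fdiff F (Suc a) (u S) = x S" by metis
    have "(\<lambda>S. if S \<subseteq> X \<and> card S = b then u S else 0) \<in> KC j (Suc (Suc a)) b"
      using u by (intro KC_I) auto
    moreover have "KD (Suc a) b (\<lambda>S. if S \<subseteq> X \<and> card S = b then u S else 0) = x"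
      using u KC_D0[OF x(1)] by (auto simp: KD_def fun_eq_iff fdiff_0)
    ultimately show ?thesis by blast
  qed
  show "\<exists>y\<in>KC j a (Suc (Suc b)). KK a (Suc b) y = x" if x: "x \<in> KC j a (Suc b)" "KK a b x = 0"
  proof (rule KK_exact_gen[OF x(1)])
    fix R c show "koszul X ix mvar (\<lambda>S. x S c) R = 0" using x(2) by (simp add: KK_def fun_eq_iff)
    show "coef (x {} c) 0 = 0" using KC_D0[OF x(1), of "{}"] by simp
  qed
qed

end

section \<open>Dimensions of spaces of finitely supported vectors\<close>

definition cscale :: "'k::field \<Rightarrow> (nat \<Rightarrow> 'k) \<Rightarrow> nat \<Rightarrow> 'k" where
  "cscale c w = (\<lambda>b. c * w b)"

interpretation cvec: vector_space cscale
  by unfold_locales (auto simp: cscale_def fun_eq_iff algebra_simps)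

lemma residue_scale: "(\<lambda>(c::'k::field) w b. gact (residue_field :: (('x, 'k) mpoly, 'k) gmodule) (mconst c) (w b)) = cscale"
  by (simp add: residue_field_def mconst_def cscale_def fun_eq_iff)

lemma bounded_support_span:
  assumes "\<And>b. r \<le> b \<Longrightarrow> w b = 0"
  shows "w \<in> cvec.span ((\<lambda>b i. if i = b then 1 else 0) ` {..<r})"
proof -
  have "w = (\<Sum>b<r. cscale (w b) (\<lambda>i. if i = b then 1 else 0))"
  proof
    fix i show "w i = (\<Sum>b<r. cscale (w b) (\<lambda>i. if i = b then 1 else 0)) i"
      using assms[of i] by (cases "i < r") (auto simp: sum_fun_apply cscale_def if_distrib[of "\<lambda>x. _ * x"] cong: if_cong)
  qed
  also have "\<dots> \<in> cvec.span ((\<lambda>b i. if i = b then 1 else 0) ` {..<r})"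
    by (intro cvec.span_sum cvec.span_scale cvec.span_base) auto
  finally show ?thesis .
qed

lemma cvec_basis:
  assumes "V \<subseteq> {w. \<forall>b\<ge>r. w b = 0}"
  shows "\<exists>B\<subseteq>V. finite B \<and> cvec.independent B \<and> V \<subseteq> cvec.span B \<and> card B = cvec.dim V"
proof -
  obtain B where B: "B \<subseteq> V" "cvec.independent B" "V \<subseteq> cvec.span B" "card B = cvec.dim V"
    using cvec.basis_exists by metis
  have "B \<subseteq> cvec.span ((\<lambda>b i. if i = b then 1 else 0) ` {..<r})"
  proof
    fix w assume "w \<in> B"
    then show "w \<in> cvec.span ((\<lambda>b i. if i = b then 1 else 0) ` {..<r})"
      using B(1) assms by (intro bounded_support_span) blast
  qed
  then have "finite B" using cvec.independent_span_bound[OF _ B(2)] by blast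
  with B show ?thesis by blast
qed

lemma cvec_dim_mono:
  assumes "U \<subseteq> V" "V \<subseteq> {w. \<forall>b\<ge>r. w b = 0}"
  shows "cvec.dim U \<le> cvec.dim V"
proof -
  obtain B where B: "B \<subseteq> V" "finite B" "V \<subseteq> cvec.span B" "card B = cvec.dim V"
    using cvec_basis[of V r, OF assms(2)] by auto
  then show ?thesis using cvec.dim_le_card[of U B] assms(1) by auto
qed

text \<open>A Betti number is a difference of dimensions; it is non-zero once some cycle is no boundary, provided that all spaces are
finite-dimensional, which the bound \<open>r\<close> on the support ensures.\<close>

lemma cvec_dim_strict:
  assumes "U \<subseteq> V" "V \<subseteq> {w. \<forall>b\<ge>r. w b = 0}" "cvec.subspace U" "v \<in> V" "v \<notin> U"
  shows "cvec.dim U < cvec.dim V"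
proof -
  obtain B where B: "B \<subseteq> V" "finite B" "V \<subseteq> cvec.span B" "card B = cvec.dim V"
    using cvec_basis[of V r, OF assms(2)] by auto
  obtain A where A: "A \<subseteq> U" "finite A" "cvec.independent A" "card A = cvec.dim U"
    using cvec_basis[of U r] subset_trans[OF assms(1,2)] by blast
  have "cvec.span A \<subseteq> U" using A(1) assms(3) cvec.span_minimal by blast
  with assms(5) have v: "v \<notin> cvec.span A" by auto
  then have "cvec.independent (insert v A)" using A(3) cvec.independent_insertI by blast
  moreover have "insert v A \<subseteq> cvec.span B" using A(1) B(3) assms(1,4) by auto
  ultimately have "card (insert v A) \<le> card B" using cvec.independent_span_bound[OF B(2)] by blast
  moreover have "v \<notin> A" using v cvec.span_base by auto
  ultimately show ?thesis using A B by simp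
qed

section \<open>Non-vanishing and vanishing of Tor with values in the residue field\<close>

context resolution
begin

abbreviation K where "K \<equiv> residue_field :: (('x, 'k) mpoly, 'k) gmodule"

text \<open>The passage from the end \<open>b = 0\<close> of the double complex to its cokernel, the resolution tensored with the residue field.\<close>

definition const_terms :: "('x set \<Rightarrow> nat \<Rightarrow> ('x, 'k) mpoly) \<Rightarrow> nat \<Rightarrow> 'k" where
  "const_terms v = (\<lambda>b. coef (v {} b) 0)"

definition of_const_terms :: "(nat \<Rightarrow> 'k) \<Rightarrow> 'x set \<Rightarrow> nat \<Rightarrow> ('x, 'k) mpoly" where
  "of_const_terms w = (\<lambda>S b. if S = {} then mconst (w b) else 0)"

lemma const_terms_KD: "const_terms (KD i b v) = tensor_diff F K i (const_terms v)"
  by (auto simp: fun_eq_iff const_terms_def KD_def fdiff_def tensor_diff_def residue_field_def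
      lookup_sum coef_0_mult intro!: sum.cong)

lemma const_terms_KK: "const_terms (KK i b v) = (\<lambda>_. 0)"
  by (auto simp: fun_eq_iff const_terms_def KK_def coef_0_koszul[OF X])

lemma const_terms_add: "const_terms (v + w) = const_terms v + const_terms w"
  by (auto simp: fun_eq_iff const_terms_def lookup_add)

lemma const_terms_of_const_terms [simp]: "const_terms (of_const_terms w) = w"
  by (auto simp: fun_eq_iff const_terms_def of_const_terms_def mconst_def)

lemma const_terms_in:
  assumes "v \<in> KC j i 0" shows "const_terms v \<in> tensor_comp F K i j"
  unfolding tensor_comp_def
proof (intro CollectI allI)
  fix b
  have v: "if b < frank F i then v {} b \<in> mpolys_hom X (j - fdeg F i b) else v {} b = 0"
    using spec[OF CollectD[OF KC_FH[OF assms, of "{}", unfolded free_comp_def]], of b]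
    by (simp split: if_split_asm)
  show "if b < frank F i then const_terms v b \<in> gcomp K (j - fdeg F i b) else const_terms v b = 0"
  proof (cases "b < frank F i")
    case True
    then have h: "v {} b \<in> mpolys_hom X (j - fdeg F i b)" using v by simp
    have "coef (v {} b) 0 = 0" if "j \<noteq> fdeg F i b"
    proof (rule ccontr)
      assume "coef (v {} b) 0 \<noteq> 0"
      then have "0 \<in> supp (v {} b)" by (simp add: in_keys_iff)
      then have "int (mdeg (0 :: 'x \<Rightarrow>\<^sub>0 nat)) = j - fdeg F i b"
        using h unfolding mpolys_hom_def by blast
      with that show False by simp
    qed
    then show ?thesis using True by (auto simp: residue_field_def const_terms_def)
  next
    case False
    then show ?thesis using v by (simp add: const_terms_def)
  qed
qed

lemma of_const_terms_in:
  assumes "w \<in> tensor_comp F K i j" shows "of_const_terms w \<in> KC j i 0"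
proof (rule KC_I)
  fix S :: "'x set" assume "S \<subseteq> X" "card S = 0"
  then have S: "S = {}" using X finite_subset[of S X] by simp
  show "of_const_terms w S \<in> FH i (j - int 0)"
    unfolding free_comp_def
  proof (intro CollectI allI)
    fix b
    have w: "if b < frank F i then w b \<in> gcomp K (j - fdeg F i b) else w b = 0"
      using assms unfolding tensor_comp_def by blast
    show "if b < frank F i then of_const_terms w S b \<in> mpolys_hom X (j - int 0 - fdeg F i b) else of_const_terms w S b = 0"
    proof (cases "b < frank F i")
      case True
      then have "w b = 0 \<or> j - fdeg F i b = 0" using w by (auto simp: residue_field_def split: if_splits)
      then show ?thesis using True S mpolys_hom_mconst[of "w b" X] by (auto simp: of_const_terms_def mconst_def)
    next
      case False
      then show ?thesis using w by (simp add: of_const_terms_def mconst_def)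
    qed
  qed
next
  fix S :: "'x set" assume "\<not> (S \<subseteq> X \<and> card S = 0)"
  then show "of_const_terms w S = 0" by (auto simp: of_const_terms_def fun_eq_iff)
qed

text \<open>The kernel of the passage to constant terms is the image of the Koszul differential.\<close>

lemma zero_const_terms_boundary:
  assumes "v \<in> KC j i 0" "const_terms v = (\<lambda>_. 0)"
  shows "\<exists>u\<in>KC j i (Suc 0). KK i 0 u = v"
proof (rule KK_exact_gen[OF assms(1)])
  show "coef (v {} c) 0 = 0" for c using fun_cong[OF assms(2), of c] by (simp add: const_terms_def)
  fix R c assume R: "R \<subseteq> X"
  have "v (insert x R) = 0" if "x \<in> X - R" for x
  proof (rule KC_D0[OF assms(1)], rule notI)
    assume "insert x R \<subseteq> X \<and> card (insert x R) = 0"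
    moreover have "finite (insert x R)" using R X finite_subset by auto
    ultimately show False by simp
  qed
  then show "koszul X ix mvar (\<lambda>S. v S c) R = 0" by (auto simp: koszul_def intro!: sum.neutral)
qed

lemma tensor_boundary_comp: "tensor_boundaries F K i j \<subseteq> tensor_comp F K i j"
proof
  interpret dc: double_complex "KC j" KD KK by (rule KC_double_complex)
  fix w assume "w \<in> tensor_boundaries F K i j"
  then obtain e where e: "e \<in> tensor_comp F K (Suc i) j" "w = tensor_diff F K i e"
    by (auto simp: tensor_boundaries_def)
  have "const_terms (KD i 0 (of_const_terms e)) \<in> tensor_comp F K i j"
    by (rule const_terms_in[OF dc.d_in[OF of_const_terms_in[OF e(1)]]])
  then show "w \<in> tensor_comp F K i j" by (simp add: const_terms_KD e)
qed

text \<open>The maps after tensoring with the residue field are the constant terms of the maps of the resolution, so they still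
compose to 0.\<close>

lemma tensor_boundaries_cycles: "tensor_boundaries F K i j \<subseteq> tensor_cycles F K i j"
proof
  interpret dc: double_complex "KC j" KD KK by (rule KC_double_complex)
  fix w assume w: "w \<in> tensor_boundaries F K i j"
  show "w \<in> tensor_cycles F K i j"
  proof (cases i)
    case 0
    then show ?thesis using w tensor_boundary_comp by auto
  next
    case (Suc i')
    obtain e where e: "e \<in> tensor_comp F K (Suc i) j" "w = tensor_diff F K i e"
      using w by (auto simp: tensor_boundaries_def)
    have "tensor_diff F K i' w = const_terms (KD i' 0 (KD (Suc i') 0 (of_const_terms e)))"
      by (simp add: const_terms_KD e Suc)
    also have "\<dots> = const_terms 0" using dc.d_d[of "of_const_terms e" i' 0] of_const_terms_in[OF e(1)] Suc by simp
    also have "\<dots> = (\<lambda>_. 0)" by (simp add: const_terms_def fun_eq_iff)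
    finally show ?thesis using w tensor_boundary_comp[of i j] Suc by auto
  qed
qed

text \<open>Boundaries after tensoring with the residue field are the constant terms of boundaries of the double complex.\<close>

lemma const_terms_boundary_iff:
  assumes "c \<in> KC j i 0"
  shows "const_terms c \<in> tensor_boundaries F K i j \<longleftrightarrow> double_complex.boundary (KC j) KD KK i 0 c"
proof -
  interpret dc: double_complex "KC j" KD KK by (rule KC_double_complex)
  show ?thesis
  proof
    assume "const_terms c \<in> tensor_boundaries F K i j"
    then obtain e where e: "e \<in> tensor_comp F K (Suc i) j" "const_terms c = tensor_diff F K i e"
      by (auto simp: tensor_boundaries_def)
    let ?e = "of_const_terms e"
    have e': "?e \<in> KC j (Suc i) 0" by (rule of_const_terms_in[OF e(1)])
    have "const_terms c = const_terms ((c - KD i 0 ?e) + KD i 0 ?e)" by simp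
    then have "const_terms (c - KD i 0 ?e) = (\<lambda>_. 0)"
      unfolding const_terms_add by (simp add: e(2) const_terms_KD fun_eq_iff)
    then obtain f where "f \<in> KC j i (Suc 0)" "KK i 0 f = c - KD i 0 ?e"
      using zero_const_terms_boundary dc.C_diff[OF assms dc.d_in[OF e']] by blast
    then show "dc.boundary i 0 c" unfolding dc.boundary_def using e'
      by (intro bexI[of _ ?e] bexI[of _ f]) auto
  next
    assume "dc.boundary i 0 c"
    then obtain e f where "e \<in> KC j (Suc i) 0" "f \<in> KC j i (Suc 0)" "c = KD i 0 e + KK i 0 f"
      by (auto simp: dc.boundary_def)
    then show "const_terms c \<in> tensor_boundaries F K i j"
      unfolding tensor_boundaries_def
    proof (intro image_eqI[of _ _ "const_terms e"] const_terms_in)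
      have "const_terms c = const_terms (KD i 0 e) + const_terms (KK i 0 f)"
        using \<open>c = _\<close> by (simp only: const_terms_add)
      then show "const_terms c = tensor_diff F K i (const_terms e)"
        by (simp add: const_terms_KD const_terms_KK fun_eq_iff)
    qed
  qed
qed

lemma tensor_cycles_comp: "tensor_cycles F K i j \<subseteq> tensor_comp F K i j"
  by (cases i) auto

lemma tensor_comp_support: "tensor_comp F K i j \<subseteq> {w. \<forall>b\<ge>frank F i. w b = 0}"
proof (intro subsetI CollectI allI impI)
  fix w b assume "w \<in> tensor_comp F K i j" "frank F i \<le> b"
  then show "w b = 0" unfolding tensor_comp_def mem_Collect_eq by (metis linorder_not_le)
qed

lemma subspace_tensor_boundaries: "cvec.subspace (tensor_boundaries F K i j)"
proof -
  have comp: "cvec.subspace (tensor_comp F K (Suc i) j)"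
    unfolding cvec.subspace_def tensor_comp_def residue_field_def cscale_def by auto
  have lin: "cvec.subspace (tensor_diff F K i ` U)" if "cvec.subspace U" for U
  proof -
    have "tensor_diff F K i (v + w) = tensor_diff F K i v + tensor_diff F K i w" for v w
      by (auto simp: tensor_diff_def residue_field_def fun_eq_iff distrib_left sum.distrib)
    moreover have "tensor_diff F K i (cscale c v) = cscale c (tensor_diff F K i v)" for c v
      by (auto simp: tensor_diff_def residue_field_def fun_eq_iff cscale_def sum_distrib_left algebra_simps)
    moreover have "tensor_diff F K i 0 = 0"
      by (auto simp: tensor_diff_def residue_field_def fun_eq_iff)
    ultimately show ?thesis using that unfolding cvec.subspace_def by (smt (verit) image_iff)
  qed
  show ?thesis unfolding tensor_boundaries_def by (rule lin[OF comp])
qed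

abbreviation tor_dimension where
  "tor_dimension i j \<equiv> cvec.dim (tensor_cycles F K i j) - cvec.dim (tensor_boundaries F K i j)"

text \<open>In a fixed homological index only the degrees of the basis elements can occur, because the residue field is concentrated in
degree 0. These are finitely many.\<close>

lemma tor_dimension_nonzero_degree:
  assumes "tor_dimension i j \<noteq> 0" shows "j \<in> fdeg F i ` {..<frank F i}"
proof (rule ccontr)
  assume j: "j \<notin> fdeg F i ` {..<frank F i}"
  have "w = 0" if w: "w \<in> tensor_cycles F K i j" for w
  proof
    fix b
    have "if b < frank F i then w b \<in> gcomp K (j - fdeg F i b) else w b = 0"
      using w tensor_cycles_comp[of i j] unfolding tensor_comp_def by blast
    then show "w b = 0 b" using j by (auto simp: residue_field_def split: if_splits)
  qed
  then have "cvec.dim (tensor_cycles F K i j) \<le> card ({} :: (nat \<Rightarrow> 'k) set)"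
    by (intro cvec.dim_le_card) auto
  with assms show False by simp
qed

text \<open>Hilbert's syzygy theorem for Tor: the Koszul complex has no wedges of more than \<open>card X\<close> variables.\<close>

lemma tor_dimension_zero_beyond:
  assumes i: "card X < i" shows "tor_dimension i j = 0"
proof -
  interpret dc: double_complex "KC j" KD KK by (rule KC_double_complex)
  obtain i' where i': "i = Suc i'" using i by (cases i) auto
  have width: "KC j a b \<subseteq> {0}" if "card X < b" for a b
  proof
    fix v assume v: "v \<in> KC j a b"
    have "v S = 0" for S
    proof (rule KC_D0[OF v], rule notI)
      assume "S \<subseteq> X \<and> card S = b"
      then show False using card_mono[OF X, of S] that by auto
    qed
    then show "v \<in> {0}" by (auto simp: fun_eq_iff)
  qed
  have "w \<in> tensor_boundaries F K i j" if w: "w \<in> tensor_cycles F K i j" for w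
  proof -
    have wc: "w \<in> tensor_comp F K (Suc i') j" and wd: "tensor_diff F K i' w = (\<lambda>_. 0)"
      using w by (auto simp: i')
    let ?c = "of_const_terms w"
    have c: "?c \<in> KC j (Suc i') 0" by (rule of_const_terms_in[OF wc])
    obtain f where f: "f \<in> KC j i' (Suc 0)" "KK i' 0 f = KD i' 0 ?c"
      using zero_const_terms_boundary[OF dc.d_in[OF c]] wd by (auto simp: const_terms_KD)
    have "dc.boundary (Suc i') 0 ?c"
      by (rule dc.vanish_beyond_width[where m = "card X" and f = f]) (use width c f i i' in auto)
    then show ?thesis using const_terms_boundary_iff[OF c] by (simp add: i')
  qed
  then have "cvec.dim (tensor_cycles F K i j) \<le> cvec.dim (tensor_boundaries F K i j)"
    using subset_trans[OF tensor_boundary_comp tensor_comp_support]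
    by (intro cvec_dim_mono[of _ _ "frank F i"]) blast+
  then show ?thesis by simp
qed

lemma tor_dimension_nonzeroI:
  assumes c: "c \<in> KC j 0 i" and nb: "\<not> double_complex.boundary (KC j) KD KK 0 i c"
    and cyc: "\<And>b. i = Suc b \<Longrightarrow> \<exists>e\<in>KC j (Suc 0) b. KK 0 b c = KD 0 b e"
  shows "tor_dimension i j \<noteq> 0"
proof -
  interpret dc: double_complex "KC j" KD KK by (rule KC_double_complex)
  obtain c' where c': "c' \<in> KC j i 0" "\<not> dc.boundary i 0 c'"
    "\<And>a'. i = Suc a' \<Longrightarrow> \<exists>f\<in>KC j a' (Suc 0). KD a' 0 c' = KK a' 0 f"
    using dc.transport_non_boundary[OF c nb cyc] by auto
  have "const_terms c' \<in> tensor_cycles F K i j"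
  proof (cases i)
    case 0
    then show ?thesis using const_terms_in[OF c'(1)] by simp
  next
    case (Suc a')
    obtain f where "KD a' 0 c' = KK a' 0 f" using c'(3)[OF Suc] by auto
    then have "tensor_diff F K a' (const_terms c') = (\<lambda>_. 0)" by (metis const_terms_KD const_terms_KK)
    then show ?thesis using const_terms_in[OF c'(1)] Suc by simp
  qed
  moreover have "const_terms c' \<notin> tensor_boundaries F K i j" using const_terms_boundary_iff c' by blast
  ultimately have "cvec.dim (tensor_boundaries F K i j) < cvec.dim (tensor_cycles F K i j)"
    using tensor_boundaries_cycles subset_trans[OF tensor_cycles_comp tensor_comp_support]
    by (intro cvec_dim_strict[of _ _ "frank F i" "const_terms c'"] subspace_tensor_boundaries)
  then show ?thesis by simp
qed

end

section \<open>Evaluation homomorphisms and standard graded algebras\<close>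

definition monomial_value :: "('x \<Rightarrow> 'a::comm_ring_1) \<Rightarrow> ('x \<Rightarrow>\<^sub>0 nat) \<Rightarrow> 'a" where
  "monomial_value u m = (\<Prod>x\<in>supp m. u x ^ coef m x)"

lemma monomial_value_superset: "finite S \<Longrightarrow> supp m \<subseteq> S \<Longrightarrow> monomial_value u m = (\<Prod>x\<in>S. u x ^ coef m x)"
  unfolding monomial_value_def by (rule prod.mono_neutral_left) (auto simp: in_keys_iff)

lemma monomial_value_add: "monomial_value u (m + n) = monomial_value u m * monomial_value u n"
proof -
  let ?S = "supp m \<union> supp n"
  have "monomial_value u (m + n) = (\<Prod>x\<in>?S. u x ^ coef (m + n) x)"
    by (rule monomial_value_superset) (auto simp: supp_add_nat)
  moreover have "monomial_value u m = (\<Prod>x\<in>?S. u x ^ coef m x)" "monomial_value u n = (\<Prod>x\<in>?S. u x ^ coef n x)"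
    by (rule monomial_value_superset; auto)+
  ultimately show ?thesis by (simp add: lookup_add power_add prod.distrib)
qed

lemma monomial_value_0 [simp]: "monomial_value u 0 = 1"
  by (simp add: monomial_value_def)

lemma monomial_value_single [simp]: "monomial_value u (sing x k) = u x ^ k"
  by (cases "k = 0") (auto simp: monomial_value_def)

locale coefficient_hom =
  fixes \<iota> :: "'k::field \<Rightarrow> 'a::comm_ring_1" and u :: "'x \<Rightarrow> 'a"
  assumes \<iota>: "\<iota> 0 = 0" "\<iota> 1 = 1" "\<iota> (a + b) = \<iota> a + \<iota> b" "\<iota> (a * b) = \<iota> a * \<iota> b"
begin

abbreviation ev where "ev \<equiv> meval \<iota> u"

lemma ev_superset: "finite S \<Longrightarrow> supp p \<subseteq> S \<Longrightarrow> ev p = (\<Sum>m\<in>S. \<iota> (coef p m) * monomial_value u m)"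
  unfolding meval_def monomial_value_def[symmetric] by (rule sum.mono_neutral_left) (auto simp: in_keys_iff \<iota>)

lemma ev_0 [simp]: "ev 0 = 0" by (simp add: meval_def)

lemma ev_single: "ev (sing m c) = \<iota> c * monomial_value u m"
  using ev_superset[of "{m}" "sing m c"] by (auto simp: \<iota>)

lemma ev_1 [simp]: "ev 1 = 1"
  using ev_single[of 0 1] by (simp add: \<iota>)

lemma ev_mvar [simp]: "ev (mvar x) = u x"
  by (simp add: mvar_def ev_single \<iota>)

lemma ev_add: "ev (p + q) = ev p + ev q"
proof -
  let ?S = "supp p \<union> supp q"
  have "ev (p + q) = (\<Sum>m\<in>?S. \<iota> (coef (p + q) m) * monomial_value u m)"
    by (rule ev_superset) (use keys_add[of p q] in auto)
  moreover have "ev p = (\<Sum>m\<in>?S. \<iota> (coef p m) * monomial_value u m)" "ev q = (\<Sum>m\<in>?S. \<iota> (coef q m) * monomial_value u m)"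
    by (rule ev_superset; auto)+
  ultimately show ?thesis by (simp add: lookup_add \<iota> distrib_right sum.distrib)
qed

lemma ev_sum: "ev (\<Sum>i\<in>I. f i) = (\<Sum>i\<in>I. ev (f i))"
  by (induction I rule: infinite_finite_induct) (auto simp: ev_add)

lemma ev_mult: "ev (p * q) = ev p * ev q"
proof (induction p rule: poly_mapping_additive_induct)
  case (single m c)
  show ?case
    by (induction q rule: poly_mapping_additive_induct)
       (auto simp: mult_single ev_single monomial_value_add \<iota> distrib_left ev_add algebra_simps)
qed (auto simp: distrib_right ev_add)

lemma ev_uminus: "ev (- p) = - ev p"
  using ev_add[of "- p" p] by (simp add: eq_neg_iff_add_eq_0)

lemma ev_diff: "ev (p - q) = ev p - ev q"
  using ev_add[of "p - q" q] by simp

lemma ev_koszul_sign: "ev (koszul_sign ix x R) = koszul_sign ix x R"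
  using koszul_sign_cases[of ix x R, where 'a = "('x, 'k) mpoly"] koszul_sign_cases[of ix x R, where 'a = 'a]
  by (cases "even (card {y \<in> R. ix y < ix x})") (auto simp: koszul_sign_def ev_uminus)

lemma ev_koszul: "ev (koszul X ix mvar v R) = koszul X ix u (\<lambda>S. ev (v S)) R"
  by (simp add: koszul_def ev_sum ev_mult ev_koszul_sign)

end

text \<open>The condition \<open>graded_kernel\<close> is what makes the grading of the polynomial ring descend to \<open>A\<close>.\<close>

locale standard_graded = coefficient_hom \<iota> u
  for \<iota> :: "'k::field \<Rightarrow> 'a::comm_ring_1" and u :: "'x \<Rightarrow> 'a" +
  fixes X :: "'x set" and A :: "'a set"
  assumes X: "finite X" and A: "A = meval \<iota> u ` mpolys X"
    and graded_kernel: "p \<in> mpolys X \<Longrightarrow> meval \<iota> u p = 0 \<Longrightarrow> meval \<iota> u (hom_part d p) = 0"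
begin

abbreviation M where "M \<equiv> algebra_gmodule X \<iota> u A"

abbreviation betti where "betti \<equiv> algebra_betti X \<iota> u A"

lemma M_resolution: "\<exists>F. graded_free_resolution X M F"
proof (rule graded_free_resolution_exists[OF X, where a = 1])
  have "(1 :: ('x, 'k) mpoly) \<in> mpolys_hom X 0" using mpolys_hom_mconst[of "1::'k" X] by (simp add: mconst_def)
  then have "ev 1 \<in> ev ` mpolys_hom X 0" by (rule imageI)
  then show "1 \<in> gcomp M 0" by (simp add: algebra_gmodule_def)
  show "(\<lambda>p. gact M p 1) ` mpolys X = gcarrier M" by (simp add: algebra_gmodule_def A)
  have eq: "gact M p 1 = ev p" for p by (simp add: algebra_gmodule_def)
  show "graded_submodule X 1 (\<lambda>_. 0) {v \<in> free_module X 1. gact M (v 0) 1 = 0}"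
    unfolding eq graded_submodule_def
    by (auto simp: free_module_def mpolys_add mpolys_mult ev_add ev_mult free_part_def
       graded_kernel intro: mpolys_homD[OF hom_part_in_hom])
qed

definition "res = (SOME F. graded_free_resolution X M F)"

text \<open>The resolution by which the Betti numbers are computed.\<close>

lemma res: "graded_free_resolution X M res"
  unfolding res_def using M_resolution by (rule someI_ex)

lemma resolution_res: "inj_on ix X \<Longrightarrow> resolution X ix M res"
  by unfold_locales (use X res in auto)

lemma betti_eq: "betti i j = cvec.dim (tensor_cycles res (residue_field :: (('x, 'k) mpoly, 'k) gmodule) i j)
    - cvec.dim (tensor_boundaries res (residue_field :: (('x, 'k) mpoly, 'k) gmodule) i j)" for i j
  unfolding algebra_betti_def tor_dim_def Let_def res_def[symmetric] residue_scale by simp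

text \<open>Bounds on the homological index and, for each index, on the degree make the maximum in the definition of the regularity
one over a finite set.\<close>

lemma finite_betti: "finite {(i, j). betti i j \<noteq> 0}"
proof -
  obtain ix :: "'x \<Rightarrow> nat" where "inj_on ix X" using finite_imp_inj_to_nat_seg[OF X] by metis
  then interpret r: resolution X ix M res by (rule resolution_res)
  have "{(i, j). betti i j \<noteq> 0} \<subseteq> (SIGMA i:{..card X}. fdeg res i ` {..<frank res i})"
    using r.tor_dimension_nonzero_degree r.tor_dimension_zero_beyond by (auto simp: betti_eq not_less[symmetric])
  then show ?thesis by (rule finite_subset) auto
qed

lemma reg_ge: "betti i j \<noteq> 0 \<Longrightarrow> j - int i \<le> algebra_reg X \<iota> u A"
proof -
  assume b: "betti i j \<noteq> 0"
  have "{j - int i | i j. betti i j \<noteq> 0} = (\<lambda>(i, j). j - int i) ` {(i, j). betti i j \<noteq> 0}" by auto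
  then have "finite {j - int i | i j. betti i j \<noteq> 0}" using finite_betti by simp
  then show ?thesis unfolding algebra_reg_def using b by (intro Max_ge) auto
qed

text \<open>Lift the Koszul cycle \<open>z\<close> of \<open>A\<close> through the augmentation to the end \<open>a = 0\<close> of the double complex. It is a cycle
there since the augmentation commutes with the Koszul differential, and it is no boundary because the
augmentation of a boundary is a Koszul boundary. Then the zigzag takes it to a cycle in the resolution tensored with
the residue field.\<close>

lemma betti_nonzero:
  assumes ix: "inj_on ix X"
    and z: "\<And>S. if S \<subseteq> X \<and> card S = i then z S \<in> ev ` mpolys_hom X (j - int i) else z S = 0"
    and cyc: "\<And>R. R \<subseteq> X \<Longrightarrow> koszul X ix u z R = 0"
    and nb: "\<And>y. (\<And>S. y S \<in> A) \<Longrightarrow> (\<And>S. S \<subseteq> X \<and> card S = Suc i \<or> y S = 0) \<Longrightarrow> koszul X ix u y \<noteq> z"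
  shows "betti i j \<noteq> 0"
proof -
  interpret r: resolution X ix M res by (rule resolution_res[OF ix])
  interpret dc: double_complex "r.KC j" r.KD r.KK by (rule r.KC_double_complex)
  have "\<forall>b<frank res 0. \<exists>q. q \<in> mpolys_hom X (fdeg res 0 b) \<and> faug res b = ev q"
    using r.resolution_parts(2) by (auto simp: algebra_gmodule_def)
  then obtain q where q: "\<And>b. b < frank res 0 \<Longrightarrow> q b \<in> mpolys_hom X (fdeg res 0 b)"
     "\<And>b. b < frank res 0 \<Longrightarrow> faug res b = ev (q b)" by metis
  \<comment> \<open>\<open>Q\<close> lifts the augmentation to a map into the polynomial ring.\<close>
  define Q where "Q v = (\<Sum>b<frank res 0. v b * q b)" for v
  have aug: "faugmap M res v = ev (Q v)" for v
    unfolding faugmap_def Q_def ev_sum ev_mult using q(2) by (simp add: algebra_gmodule_def)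
  have Qh: "hom_part e (Q v) = Q (free_part (fdeg res 0) e v)" for e v
    unfolding Q_def hom_part_sum free_part_def using q(1)
    by (intro sum.cong refl hom_part_mult_hom) (auto simp: mpolys_hom_def)
  have QX: "Q v \<in> mpolys X" if "v \<in> fmod X res 0" for v
    unfolding Q_def using that q(1) by (intro mpolys_sum mpolys_mult) (auto simp: fmod_def dest: mpolys_homD)
  have lift: "\<exists>v\<in>r.FH 0 e. ev (Q v) = ev p" if p: "p \<in> mpolys_hom X e" for p e
  proof -
    have "ev p \<in> faugmap M res ` fmod X res 0"
      unfolding r.resolution_parts(3) using mpolys_homD[OF p] by (simp add: algebra_gmodule_def A)
    then obtain v where v: "v \<in> fmod X res 0" "ev p = ev (Q v)" by (auto simp: aug)
    have "ev (hom_part e (Q v - p)) = 0"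
      using v mpolys_homD[OF p] by (intro graded_kernel mpolys_diff QX) (auto simp: ev_diff)
    moreover have "hom_part e (Q v - p) = Q (free_part (fdeg res 0) e v) - p"
      using p hom_part_add[of e "Q v - p" p] by (simp add: mpolys_hom_iff Qh)
    ultimately show ?thesis using free_part_free_comp[of v X "frank res 0" "fdeg res 0" e] v(1)
      by (auto simp: ev_diff fmod_free_module)
  qed
  have "\<exists>v. v \<in> r.FH 0 (j - int i) \<and> ev (Q v) = z S" for S
  proof (cases "S \<subseteq> X \<and> card S = i")
    case True
    then show ?thesis using z[of S] lift by force
  next
    case False
    then show ?thesis using z[of S] lift[of 0 "j - int i"] by auto
  qed
  then obtain c0 where c0: "\<And>S. c0 S \<in> r.FH 0 (j - int i)" "\<And>S. ev (Q (c0 S)) = z S" by metis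
  define c where "c S = (if S \<subseteq> X \<and> card S = i then c0 S else 0)" for S
  have Q0: "Q 0 = 0" by (simp add: Q_def)
  have c: "c \<in> r.KC j 0 i" by (rule r.KC_I) (use c0 in \<open>auto simp: c_def\<close>)
  have zc: "ev (Q (c S)) = z S" for S
    using z[of S] c0(2)[of S] Q0 by (auto simp: c_def split: if_splits)
  have augK: "ev (Q (r.KK 0 b v R)) = koszul X ix u (\<lambda>S. ev (Q (v S))) R" for b v R
    by (simp add: Q_def r.KK_def ev_sum ev_mult ev_koszul koszul_sum koszul_mult_right)
  have augD: "ev (Q (fdiff res 0 v)) = 0" if "v \<in> fmod X res (Suc 0)" for v
  proof -
    have "fdiff res 0 v \<in> {v \<in> fmod X res 0. faugmap M res v = 0}"
      unfolding r.resolution_parts(4) using that by blast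
    then show ?thesis by (simp add: aug)
  qed
  have "\<not> dc.boundary 0 i c"
  proof
    assume "dc.boundary 0 i c"
    then obtain e f where ef: "e \<in> r.KC j (Suc 0) i" "f \<in> r.KC j 0 (Suc i)" "c = r.KD 0 i e + r.KK 0 i f"
      by (auto simp: dc.boundary_def)
    have "z R = koszul X ix u (\<lambda>S. ev (Q (f S))) R" for R
    proof -
      have "ev (Q (c R)) = ev (Q (fdiff res 0 (e R))) + ev (Q (r.KK 0 i f R))"
        unfolding ef(3) by (simp add: Q_def r.KD_def distrib_right sum.distrib ev_add)
      then show ?thesis using augD[OF r.FH_fmod[OF r.KC_FH[OF ef(1)]], of R] zc augK by simp
    qed
    moreover have "ev (Q (f S)) \<in> A" for S
      using QX[OF r.FH_fmod[OF r.KC_FH[OF ef(2)]], of S] by (simp add: A)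
    moreover have "S \<subseteq> X \<and> card S = Suc i \<or> ev (Q (f S)) = 0" for S
    proof (cases "S \<subseteq> X \<and> card S = Suc i")
      case False
      then have "f S = 0" by (rule r.KC_D0[OF ef(2)])
      then show ?thesis using Q0 by (simp only: ev_0 simp_thms)
    qed simp
    ultimately show False using nb[of "\<lambda>S. ev (Q (f S))"] by (auto simp: fun_eq_iff)
  qed
  moreover have "\<exists>e\<in>r.KC j (Suc 0) b. r.KK 0 b c = r.KD 0 b e" if i: "i = Suc b" for b
  proof -
    have k: "r.KK 0 b c \<in> r.KC j 0 b" using r.KK_in c i by simp
    have "\<exists>u. u \<in> r.FH (Suc 0) (j - int b) \<and> fdiff res 0 u = r.KK 0 b c R" for R
    proof -
      have "ev (Q (r.KK 0 b c R)) = 0"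
      proof (cases "R \<subseteq> X")
        case True
        then show ?thesis using cyc[OF True] by (simp add: augK zc)
      next
        case False
        then have "r.KK 0 b c R = 0" using r.KC_D0[OF k, of R] by simp
        then show ?thesis by (simp add: Q0)
      qed
      then have "r.KK 0 b c R \<in> {v \<in> fmod X res 0. faugmap M res v = 0}"
        using r.FH_fmod[OF r.KC_FH[OF k]] by (simp add: aug)
      then obtain w where w: "w \<in> fmod X res (Suc 0)" "r.KK 0 b c R = fdiff res 0 w"
        unfolding r.resolution_parts(4) by blast
      have "fdiff res 0 (free_part (fdeg res (Suc 0)) (j - int b) w) = r.KK 0 b c R"
        unfolding r.fdiff_free_part w(2)[symmetric] by (rule free_part_id[OF r.KC_FH[OF k]])
      then show ?thesis using free_part_free_comp[of w X "frank res (Suc 0)"] w(1) by (auto simp: fmod_free_module)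
    qed
    then obtain e where e: "\<And>R. e R \<in> r.FH (Suc 0) (j - int b)" "\<And>R. fdiff res 0 (e R) = r.KK 0 b c R" by metis
    have "(\<lambda>S. if S \<subseteq> X \<and> card S = b then e S else 0) \<in> r.KC j (Suc 0) b"
      by (rule r.KC_I) (use e in auto)
    moreover have "r.KK 0 b c = r.KD 0 b (\<lambda>S. if S \<subseteq> X \<and> card S = b then e S else 0)"
      using e(2) r.KC_D0[OF k] by (auto simp: r.KD_def fun_eq_iff r.fdiff_0)
    ultimately show ?thesis by blast
  qed
  ultimately show ?thesis using r.tor_dimension_nonzeroI[OF c] unfolding betti_eq by blast
qed

end

section \<open>The Rees algebra as a standard graded toric algebra\<close>

text \<open>The exponent of the squarefree monomial \<open>\<Prod>\<^sub>i\<^sub>\<in>\<^sub>S x\<^sub>i\<close>.\<close>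

definition chi :: "nat set \<Rightarrow> nat \<Rightarrow>\<^sub>0 nat" where
  "chi S = (\<Sum>i\<in>S. sing i 1)"

lemma coef_chi: "finite S \<Longrightarrow> coef (chi S) v = (if v \<in> S then 1 else 0)"
  by (simp add: chi_def lookup_sum lookup_single when_def)

lemma mdeg_chi: "mdeg (chi S) = card S"
  by (simp add: chi_def mdeg_sum)

lemma supp_chi: "finite S \<Longrightarrow> supp (chi S) = S"
  by (auto simp: in_keys_iff coef_chi split: if_splits)

lemma prod_single: "(\<Prod>i\<in>I. sing (f i) (1::'b::comm_semiring_1)) = sing (\<Sum>i\<in>I. f i) 1"
  by (induction I rule: infinite_finite_induct) (auto simp: mult_single)

lemma edge_monomial_chi: "edge_monomial e = sing (chi e) 1"
  by (simp add: edge_monomial_def mvar_def prod_single chi_def)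

lemma rees_gen_Inl: "rees_gen (Inl i) = monom (sing (sing i 1) 1) 0"
  by (simp add: mvar_def monom_0)

lemma rees_gen_Inr: "rees_gen (Inr e) = monom (sing (chi e) 1) 1"
  by (simp add: edge_monomial_chi)

lemma coefficient_hom_rees: "coefficient_hom (\<lambda>c::'k::field. [:mconst c:] :: (nat, 'k) mpoly poly)"
  by unfold_locales (simp_all add: mconst_def single_add mult_single mult.commute)

interpretation rg: coefficient_hom "\<lambda>c::'k::field. [:mconst c:] :: (nat, 'k) mpoly poly" rees_gen
  by (rule coefficient_hom_rees)

text \<open>The monomial \<open>x\<^sup>m T\<^sup>s\<close>.\<close>

abbreviation tmon :: "(nat \<Rightarrow>\<^sub>0 nat) \<Rightarrow> nat \<Rightarrow> (nat, 'k::field) mpoly poly" where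
  "tmon m s \<equiv> monom (sing m 1) s"

lemma tmon_mult: "tmon m s * tmon m' s' = tmon (m + m') (s + s')"
  by (simp add: mult_monom mult_single)

lemma tmon_0 [simp]: "tmon 0 0 = 1"
  by (simp add: monom_0)

lemma ev_tmon: "monomial_value rees_gen a = (tmon m s :: (nat, 'k::field) mpoly poly) \<Longrightarrow> rg.ev (sing a (c::'k)) = monom (sing m c) s"
  unfolding rg.ev_single by (simp add: mconst_def smult_monom mult_single)

text \<open>The exponents of the monomials in the \<open>s\<close>-th power of the edge ideal: those divisible by a product of \<open>s\<close> edges.\<close>

fun power_exponents :: "nat \<Rightarrow> nat set set \<Rightarrow> nat \<Rightarrow> (nat \<Rightarrow>\<^sub>0 nat) set" where
  "power_exponents n E 0 = {m. supp m \<subseteq> {1..n}}"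
| "power_exponents n E (Suc s) = {chi e + m | e m. e \<in> E \<and> m \<in> power_exponents n E s}"

lemma power_exponents_add: "a \<in> power_exponents n E s \<Longrightarrow> b \<in> power_exponents n E t \<Longrightarrow> a + b \<in> power_exponents n E (s + t)"
proof (induction s arbitrary: a)
  case 0
  then show ?case
  proof (induction t arbitrary: b)
    case 0
    then show ?case by (auto simp: supp_add_nat)
  next
    case (Suc t)
    then obtain e m where "b = chi e + m" "e \<in> E" "m \<in> power_exponents n E t" by auto
    moreover from this have "a + m \<in> power_exponents n E (0 + t)" using Suc by blast
    ultimately show ?case by (auto intro!: exI[of _ e] exI[of _ "a + m"] simp: ac_simps)
  qed
next
  case (Suc s)
  then obtain e m where "a = chi e + m" "e \<in> E" "m \<in> power_exponents n E s" by auto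
  moreover from this have "m + b \<in> power_exponents n E (s + t)" using Suc by blast
  ultimately show ?case by (auto intro!: exI[of _ e] exI[of _ "m + b"] simp: ac_simps)
qed

definition power_span :: "nat \<Rightarrow> nat set set \<Rightarrow> nat \<Rightarrow> (nat, 'k::field) mpoly set" where
  "power_span n E s = {p. supp p \<subseteq> power_exponents n E s}"

lemma power_span_add: "p \<in> power_span n E s \<Longrightarrow> q \<in> power_span n E s \<Longrightarrow> p + q \<in> power_span n E s"
  using keys_add[of p q] by (auto simp: power_span_def)

lemma power_span_mult: "p \<in> power_span n E s \<Longrightarrow> q \<in> power_span n E t \<Longrightarrow> p * q \<in> power_span n E (s + t)"
  using keys_mult[of p q] power_exponents_add unfolding power_span_def by fast

lemma power_span_0: "power_span n E 0 = mpolys {1..n}"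
  by (auto simp: power_span_def mpolys_def)

lemma power_span_uminus: "p \<in> power_span n E s \<Longrightarrow> - p \<in> power_span n E s"
  by (auto simp: power_span_def in_keys_iff subset_iff)

lemma power_span_induct [consumes 1, case_names zero single add]:
  assumes "p \<in> power_span n E s" "P 0" "\<And>m c. m \<in> power_exponents n E s \<Longrightarrow> P (sing m c)"
    "\<And>p q. P p \<Longrightarrow> P q \<Longrightarrow> P (p + q)"
  shows "P p"
proof (induction p rule: poly_mapping_additive_induct)
  case (single m c)
  then show ?case using assms(1) by (intro assms(3)) (auto simp: power_span_def)
qed (use assms(2,4) in auto)

lemma cring_mpoly_ring: "cring (mpoly_ring X :: ('x, 'k::field) mpoly ring)"
proof (rule cringI)
  show "abelian_group (mpoly_ring X :: ('x, 'k) mpoly ring)"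
  proof (rule abelian_groupI)
    fix p :: "('x, 'k) mpoly" assume "p \<in> carrier (mpoly_ring X)"
    then show "\<exists>y\<in>carrier (mpoly_ring X). y \<oplus>\<^bsub>mpoly_ring X\<^esub> p = \<zero>\<^bsub>mpoly_ring X\<^esub>"
      by (auto simp: mpoly_ring_def mpolys_uminus intro!: bexI[of _ "- p"])
  qed (auto simp: mpoly_ring_def mpolys_add ac_simps)
  show "Group.comm_monoid (mpoly_ring X :: ('x, 'k) mpoly ring)"
    by (rule comm_monoidI) (auto simp: mpoly_ring_def mpolys_mult ac_simps)
qed (auto simp: mpoly_ring_def distrib_right)

context
  fixes n :: nat and E :: "nat set set"
  assumes G: "simple_graph n E"
begin

lemma edge_sub: "e \<in> E \<Longrightarrow> e \<subseteq> {1..n}" and edge_card: "e \<in> E \<Longrightarrow> card e = 2"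
  using G by (auto simp: simple_graph_def)

lemma edge_finite: "e \<in> E \<Longrightarrow> finite e"
  using edge_sub finite_subset by blast

lemma power_exponents_supp: "m \<in> power_exponents n E s \<Longrightarrow> supp m \<subseteq> {1..n}"
proof (induction s arbitrary: m)
  case (Suc s)
  then obtain e m' where e: "m = chi e + m'" "e \<in> E" "m' \<in> power_exponents n E s" by auto
  show ?case unfolding e(1) supp_add_nat supp_chi[OF edge_finite[OF e(2)]]
    using edge_sub[OF e(2)] Suc.IH[OF e(3)] by (rule Un_least)
qed simp

text \<open>The span of the monomials divisible by an edge is an ideal that contains the edges, and each of its monomials is a
multiple of an edge.\<close>

lemma edge_ideal_eq: "edge_ideal n E = (power_span n E 1 :: (nat, 'k::field) mpoly set)"
proof -
  let ?R = "mpoly_ring {1..n} :: (nat, 'k) mpoly ring"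
  interpret R: cring ?R by (rule cring_mpoly_ring)
  have edge: "edge_monomial e \<in> (power_span n E 1 :: (nat, 'k) mpoly set)" if "e \<in> E" for e
    using that by (auto simp: power_span_def edge_monomial_chi intro!: exI[of _ e] exI[of _ 0])
  have sub: "(power_span n E 1 :: (nat, 'k) mpoly set) \<subseteq> mpolys {1..n}"
    using power_exponents_supp by (auto simp: power_span_def mpolys_def simp del: power_exponents.simps)
  have "ideal (power_span n E 1) ?R"
  proof (rule idealI)
    show "ring ?R" by (rule R.ring_axioms)
    show "subgroup (power_span n E 1) (add_monoid ?R)"
    proof
      fix p :: "(nat, 'k) mpoly" assume p: "p \<in> power_span n E 1"
      have "inv\<^bsub>add_monoid ?R\<^esub> p = - p"
        using R.minus_equality[of "- p" p] p sub mpolys_uminus[of p "{1..n}"]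
        by (auto simp: a_inv_def mpoly_ring_def)
      then show "inv\<^bsub>add_monoid ?R\<^esub> p \<in> power_span n E 1" using power_span_uminus[OF p] by simp
    next
      fix p q :: "(nat, 'k) mpoly" assume "p \<in> power_span n E 1" "q \<in> power_span n E 1"
      then show "p \<otimes>\<^bsub>add_monoid ?R\<^esub> q \<in> power_span n E 1"
        using power_span_add by (simp add: mpoly_ring_def)
    qed (use sub in \<open>auto simp: mpoly_ring_def power_span_def\<close>)
  next
    fix a x :: "(nat, 'k) mpoly" assume "a \<in> power_span n E 1" "x \<in> carrier ?R"
    then have "x * a \<in> power_span n E (0 + 1)"
      by (intro power_span_mult) (auto simp: mpoly_ring_def power_span_0)
    then show "x \<otimes>\<^bsub>?R\<^esub> a \<in> power_span n E 1" "a \<otimes>\<^bsub>?R\<^esub> x \<in> power_span n E 1"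
      by (simp_all add: mpoly_ring_def mult.commute)
  qed
  then have "edge_ideal n E \<subseteq> (power_span n E 1 :: (nat, 'k) mpoly set)"
    unfolding edge_ideal_def genideal_def using edge by auto
  moreover have "p \<in> I" if I: "ideal I ?R" "edge_monomial ` E \<subseteq> I" and p: "p \<in> power_span n E 1" for I and p :: "(nat, 'k) mpoly"
    using p
  proof (induction rule: power_span_induct)
    case zero
    then show ?case using additive_subgroup.zero_closed[OF ideal.axioms(1)[OF I(1)]] by (simp add: mpoly_ring_def)
  next
    case (single m c)
    then obtain e m' where e: "m = chi e + m'" "e \<in> E" "supp m' \<subseteq> {1..n}" by auto
    have "sing m' c \<otimes>\<^bsub>?R\<^esub> edge_monomial e \<in> I"
      using e I by (intro ideal.I_l_closed[OF I(1)]) (auto simp: mpoly_ring_def mpolys_single)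
    then show ?case by (simp add: mpoly_ring_def edge_monomial_chi mult_single e add.commute)
  next
    case (add p q)
    then show ?case using additive_subgroup.a_closed[OF ideal.axioms(1)[OF I(1)]] by (simp add: mpoly_ring_def)
  qed
  then have "(power_span n E 1 :: (nat, 'k) mpoly set) \<subseteq> edge_ideal n E"
    unfolding edge_ideal_def genideal_def by auto
  ultimately show ?thesis by blast
qed

lemma ideal_prod_power_span:
  "ideal_prod (mpoly_ring {1..n}) (power_span n E s) (power_span n E 1) = (power_span n E (Suc s) :: (nat, 'k::field) mpoly set)"
proof (intro equalityI subsetI)
  let ?R = "mpoly_ring {1..n} :: (nat, 'k) mpoly ring"
  fix p assume "p \<in> ideal_prod ?R (power_span n E s) (power_span n E 1)"
  then show "p \<in> power_span n E (Suc s)"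
  proof (induction rule: ideal_prod.induct)
    case (prod p q)
    then have "p * q \<in> power_span n E (s + 1)" by (intro power_span_mult)
    then show ?case by (simp add: mpoly_ring_def)
  next
    case (sum p q)
    then show ?case using power_span_add by (auto simp: mpoly_ring_def)
  qed
next
  let ?R = "mpoly_ring {1..n} :: (nat, 'k) mpoly ring"
  fix p :: "(nat, 'k) mpoly" assume "p \<in> power_span n E (Suc s)"
  then show "p \<in> ideal_prod ?R (power_span n E s) (power_span n E 1)"
  proof (induction rule: power_span_induct)
    case zero
    have "0 \<otimes>\<^bsub>?R\<^esub> 0 \<in> ideal_prod ?R (power_span n E s) (power_span n E 1)"
      by (rule ideal_prod.prod) (auto simp: power_span_def)
    then show ?case by (simp add: mpoly_ring_def)
  next
    case (single m c)
    then obtain e m' where e: "m = chi e + m'" "e \<in> E" "m' \<in> power_exponents n E s" by auto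
    have "sing m' c \<otimes>\<^bsub>?R\<^esub> sing (chi e) 1 \<in> ideal_prod ?R (power_span n E s) (power_span n E 1)"
      using e by (intro ideal_prod.prod) (auto simp: power_span_def intro!: exI[of _ e] exI[of _ 0])
    then show ?case by (simp add: mpoly_ring_def mult_single e add.commute)
  next
    case (add p q)
    then show ?case using ideal_prod.sum[OF add] by (simp add: mpoly_ring_def)
  qed
qed

text \<open>The Rees algebra is spanned by monomials: those \<open>x\<^sup>m T\<^sup>s\<close> for which \<open>x\<^sup>m\<close> is divisible by a product of
\<open>s\<close> edges.\<close>

lemma rees_algebra_eq:
  "rees_algebra (mpoly_ring {1..n}) (edge_ideal n E) = {f :: (nat, 'k::field) mpoly poly. \<forall>s. coeff f s \<in> power_span n E s}"
proof -
  have "edge_ideal n E [^]\<^bsub>ideals_set (mpoly_ring {1..n})\<^esub> s = (power_span n E s :: (nat, 'k) mpoly set)" for s :: nat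
  proof (induction s)
    case 0
    then show ?case unfolding Group.nat_pow_0 by (simp add: ideals_set_def mpoly_ring_def power_span_0)
  next
    case (Suc s)
    have "edge_ideal n E [^]\<^bsub>ideals_set (mpoly_ring {1..n})\<^esub> Suc s =
      ideal_prod (mpoly_ring {1..n}) (power_span n E s) (power_span n E 1 :: (nat, 'k) mpoly set)"
      unfolding Group.nat_pow_Suc Suc unfolding edge_ideal_eq by (simp add: ideals_set_def)
    then show ?case unfolding ideal_prod_power_span .
  qed
  then show ?thesis by (simp add: rees_algebra_def)
qed

abbreviation XG where "XG \<equiv> {1..n} <+> E"

text \<open>A generator \<open>x\<^sub>i\<close> has total degree 1, and \<open>x\<^sub>i x\<^sub>j T\<close> has total degree 2 in the vertices and degree 1 in \<open>T\<close>. Hence the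
number of generators in a product is its vertex degree minus its degree in \<open>T\<close>, whichever factorisation is chosen:
the relations between the generators are homogeneous.\<close>

lemma monomial_value_rees_gen:
  assumes "supp a \<subseteq> XG"
  shows "\<exists>m s. monomial_value rees_gen a = (tmon m s :: (nat, 'k::field) mpoly poly) \<and> m \<in> power_exponents n E s \<and> mdeg m = mdeg a + s"
proof (induction a rule: poly_mapping_additive_induct)
  case zero
  show ?case by (intro exI[of _ 0]) simp
next
  case (single x k)
  then have x: "x \<in> XG" using assms by auto
  have gen: "\<exists>m s. rees_gen x = (tmon m s :: (nat, 'k) mpoly poly) \<and> m \<in> power_exponents n E s \<and> mdeg m = 1 + s"
  proof (cases x)
    case (Inl i)
    then show ?thesis using x
      by (intro exI[of _ "sing i 1"] exI[of _ 0]) (auto simp: rees_gen_Inl simp del: rees_gen.simps)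
  next
    case (Inr e)
    then have "e \<in> E" using x by auto
    moreover from this have "chi e \<in> power_exponents n E 1" by (auto intro!: exI[of _ e] exI[of _ 0])
    ultimately show ?thesis using Inr
      by (intro exI[of _ "chi e"] exI[of _ 1]) (simp add: rees_gen_Inr mdeg_chi edge_card del: rees_gen.simps power_exponents.simps)
  qed
  have "\<exists>m s. rees_gen x ^ k = (tmon m s :: (nat, 'k) mpoly poly) \<and> m \<in> power_exponents n E s \<and> mdeg m = k + s"
  proof (induction k)
    case 0
    show ?case by (intro exI[of _ 0]) simp
  next
    case (Suc k)
    then obtain m s where m: "rees_gen x ^ k = (tmon m s :: (nat, 'k) mpoly poly)" "m \<in> power_exponents n E s" "mdeg m = k + s" by blast
    obtain m' s' where m': "rees_gen x = (tmon m' s' :: (nat, 'k) mpoly poly)" "m' \<in> power_exponents n E s'" "mdeg m' = 1 + s'"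
      using gen by blast
    then show ?case using m
      by (intro exI[of _ "m' + m"] exI[of _ "s' + s"]) (simp add: tmon_mult power_exponents_add)
  qed
  then show ?case by simp
next
  case (add a b)
  then obtain m s m' s' where "monomial_value rees_gen a = (tmon m s :: (nat, 'k) mpoly poly)" "m \<in> power_exponents n E s" "mdeg m = mdeg a + s"
    "monomial_value rees_gen b = (tmon m' s' :: (nat, 'k) mpoly poly)" "m' \<in> power_exponents n E s'" "mdeg m' = mdeg b + s'" by blast
  then show ?case
    by (intro exI[of _ "m + m'"] exI[of _ "s + s'"]) (simp add: tmon_mult power_exponents_add monomial_value_add)
qed

text \<open>Conversely, every monomial of the Rees algebra is a product of generators: split off \<open>s\<close> edges, and write the rest
as a product of vertices.\<close>

lemma power_exponents_monomial_value:
  assumes "m \<in> power_exponents n E s"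
  shows "\<exists>a. supp a \<subseteq> XG \<and> monomial_value rees_gen a = (tmon m s :: (nat, 'k::field) mpoly poly)"
  using assms
proof (induction s arbitrary: m)
  case 0
  then have m: "supp m \<subseteq> {1..n}" by simp
  show ?case
  proof (induction m rule: poly_mapping_additive_induct)
    case zero
    show ?case by (intro exI[of _ 0]) simp
  next
    case (single i k)
    then have "Inl i \<in> XG" using m by auto
    moreover have "tmon (sing i 1) 0 ^ k = (tmon (sing i k) 0 :: (nat, 'k) mpoly poly)"
      by (induction k) (simp_all add: tmon_mult flip: single_add)
    ultimately show ?case
      by (intro exI[of _ "sing (Inl i) k"] conjI)
        (auto simp: rees_gen_Inl simp del: rees_gen.simps split: if_splits)
  next
    case (add m m')
    then obtain a b where "supp a \<subseteq> XG" "monomial_value rees_gen a = (tmon m 0 :: (nat, 'k) mpoly poly)"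
      "supp b \<subseteq> XG" "monomial_value rees_gen b = (tmon m' 0 :: (nat, 'k) mpoly poly)" by blast
    then show ?case
      by (intro exI[of _ "a + b"]) (simp add: supp_add_nat monomial_value_add tmon_mult)
  qed
next
  case (Suc s)
  then obtain e m' where e: "m = chi e + m'" "e \<in> E" "m' \<in> power_exponents n E s" by auto
  from Suc.IH[OF e(3)] obtain a where
    a: "supp a \<subseteq> XG" "monomial_value rees_gen a = (tmon m' s :: (nat, 'k) mpoly poly)" by blast
  show ?case
  proof (intro exI[of _ "sing (Inr e) 1 + a"] conjI)
    show "supp (sing (Inr e) 1 + a) \<subseteq> XG" unfolding supp_add_nat using a(1) e(2) by auto
  qed (simp add: a(2) monomial_value_add rees_gen_Inr tmon_mult e(1) del: rees_gen.simps)
qed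

text \<open>The grading of the algebra read off from its monomials: \<open>x\<^sup>m T\<^sup>s\<close> has degree \<open>mdeg m - s\<close>.\<close>

lemma coef_ev_hom_part:
  fixes p :: "(nat + nat set, 'k::field) mpoly"
  assumes p: "p \<in> mpolys XG"
  shows "coef (coeff (rg.ev (hom_part d p)) s) m = (if int (mdeg m) - int s = d then coef (coeff (rg.ev p) s) m else 0)"
proof (induction p rule: poly_mapping_additive_induct)
  case (single a c)
  then have "supp a \<subseteq> XG" using p by (auto simp: mpolys_def)
  then obtain m' s' where a: "monomial_value rees_gen a = (tmon m' s' :: (nat, 'k) mpoly poly)" "mdeg m' = mdeg a + s'"
    using monomial_value_rees_gen by blast
  have "rg.ev (sing a c) = monom (sing m' c) s'"
    by (rule ev_tmon[OF a(1)])
  then show ?case using a(2)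
    by (auto simp: hom_part_def part_single lookup_single when_def)
qed (auto simp: hom_part_add rg.ev_add lookup_add)

lemma tmon_in_image:
  assumes "m \<in> power_exponents n E s"
  shows "monom (sing m (c::'k::field)) s \<in> rg.ev ` mpolys_hom XG (int (mdeg m) - int s)"
proof -
  obtain a where a: "supp a \<subseteq> XG" "monomial_value rees_gen a = (tmon m s :: (nat, 'k) mpoly poly)"
    using power_exponents_monomial_value[OF assms] by blast
  obtain m' s' where a': "monomial_value rees_gen a = (tmon m' s' :: (nat, 'k) mpoly poly)" "mdeg m' = mdeg a + s'"
    using monomial_value_rees_gen[OF a(1)] by blast
  have "m' = m \<and> s' = s"
  proof -
    have "coef (coeff (tmon m s :: (nat, 'k) mpoly poly) s) m = coef (coeff (tmon m' s' :: (nat, 'k) mpoly poly) s) m"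
      using a(2) a'(1) by simp
    then show ?thesis by (auto simp: lookup_single when_def split: if_splits)
  qed
  then have "sing a c \<in> mpolys_hom XG (int (mdeg m) - int s)"
    using a(1) a'(2) by (intro mpolys_hom_single) auto
  moreover have "rg.ev (sing a c) = monom (sing m c) s"
    by (rule ev_tmon[OF a(2)])
  ultimately show ?thesis by (metis imageI)
qed

lemma rees_image: "rees_algebra (mpoly_ring {1..n}) (edge_ideal n E) = (rg.ev ` mpolys XG :: (nat, 'k::field) mpoly poly set)"
  unfolding rees_algebra_eq
proof (intro equalityI subsetI)
  fix f :: "(nat, 'k) mpoly poly" assume "f \<in> {f. \<forall>s. coeff f s \<in> power_span n E s}"
  then have f: "coeff f s \<in> power_span n E s" for s by blast
  have closed: "a + b \<in> rg.ev ` mpolys XG" if ab: "a \<in> rg.ev ` mpolys XG" "b \<in> rg.ev ` mpolys XG"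
    for a b :: "(nat, 'k) mpoly poly"
  proof -
    obtain p q where "p \<in> mpolys XG" "a = rg.ev p" "q \<in> mpolys XG" "b = rg.ev q" using ab by blast
    then show ?thesis by (intro image_eqI[of _ _ "p + q"]) (auto simp: rg.ev_add mpolys_add)
  qed
  have zero: "0 \<in> (rg.ev ` mpolys XG :: (nat, 'k) mpoly poly set)"
    by (rule image_eqI[of _ _ 0]) auto
  have "monom (coeff f s) s \<in> rg.ev ` mpolys XG" for s
    using f[of s]
  proof (induction rule: power_span_induct)
    case (single m c)
    then show ?case using tmon_in_image[of m s c] mpolys_homD by fast
  next
    case (add p q)
    then show ?case using closed[of "monom p s" "monom q s"] by (simp add: add_monom)
  qed (simp only: monom_eq_0 zero)
  then have "(\<Sum>s\<in>S. monom (coeff f s) s) \<in> rg.ev ` mpolys XG" for S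
    using zero closed by (induction S rule: infinite_finite_induct) (simp_all del: One_nat_def)
  from this[of "{..degree f}"] show "f \<in> rg.ev ` mpolys XG"
    unfolding poly_as_sum_of_monoms .
next
  fix f :: "(nat, 'k) mpoly poly" assume "f \<in> rg.ev ` mpolys XG"
  then obtain p where p: "p \<in> mpolys XG" "f = rg.ev p" by blast
  have "\<forall>s. coeff (rg.ev p) s \<in> power_span n E s"
  proof (induction p rule: poly_mapping_additive_induct)
    case (single a c)
    then have "supp a \<subseteq> XG" using p by (auto simp: mpolys_def)
    then obtain m s where a: "monomial_value rees_gen a = (tmon m s :: (nat, 'k) mpoly poly)" "m \<in> power_exponents n E s"
      using monomial_value_rees_gen by blast
    have "rg.ev (sing a c) = monom (sing m c) s"
      by (rule ev_tmon[OF a(1)])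
    then show ?case using a(2) by (auto simp: power_span_def)
  qed (auto simp: rg.ev_add power_span_add, simp add: power_span_def)
  then show "f \<in> {f. \<forall>s. coeff f s \<in> power_span n E s}" by (simp add: p(2))
qed

lemma finite_XG: "finite XG"
  using finite_subset[of E "Pow {1..n}"] edge_sub by auto

lemma rees_standard_graded:
  "standard_graded (\<lambda>c::'k::field. [:mconst c:]) rees_gen XG (rees_algebra (mpoly_ring {1..n}) (edge_ideal n E))"
proof
  fix p :: "(nat + nat set, 'k) mpoly" and d
  assume p: "p \<in> mpolys XG" "rg.ev p = 0"
  show "rg.ev (hom_part d p) = 0"
    using coef_ev_hom_part[OF p(1)] p(2) by (auto simp: poly_eq_iff intro!: poly_mapping_eqI)
qed (rule finite_XG rees_image)+

end

section \<open>A functional that annihilates Koszul boundaries\<close>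

text \<open>\<open>\<beta>\<close> assigns elements of \<open>B\<close> to blocks numbered by \<open>1, \<dots>, i\<close>; a transversal takes one element from each block.\<close>

definition transversals :: "('x \<Rightarrow> nat) \<Rightarrow> 'x set \<Rightarrow> nat \<Rightarrow> 'x set set" where
  "transversals \<beta> B i = {R. R \<subseteq> B \<and> bij_betw \<beta> R {1..i}}"

lemma finite_transversals: "finite B \<Longrightarrow> finite (transversals \<beta> B i)"
  by (rule finite_subset[of _ "Pow B"]) (auto simp: transversals_def)

text \<open>Ordering the generators block by block is what makes all transversals count with the same sign in the cocycle.\<close>

lemma block_order_exists:
  fixes \<beta> :: "'x \<Rightarrow> nat"
  assumes "finite X"
  shows "\<exists>ix :: 'x \<Rightarrow> nat. inj_on ix X \<and> (\<forall>x\<in>X. \<forall>y\<in>X. \<beta> x < \<beta> y \<longrightarrow> ix x < ix y)"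
proof -
  obtain g :: "'x \<Rightarrow> nat" and N where g: "g ` X = {i. i < N}" "inj_on g X"
    using finite_imp_inj_to_nat_seg[OF assms] by metis
  have lt: "g x < N" if "x \<in> X" for x using g(1) that by auto
  define ix where "ix x = \<beta> x * N + g x" for x
  have mono: "ix x < ix y" if "x \<in> X" "y \<in> X" "\<beta> x < \<beta> y" for x y
  proof -
    have "Suc (\<beta> x) * N \<le> \<beta> y * N" using that(3) by (intro mult_le_mono1) simp
    then show ?thesis using lt[OF that(1)] by (simp add: ix_def)
  qed
  have "inj_on ix X"
  proof (rule inj_onI)
    fix x y assume xy: "x \<in> X" "y \<in> X" "ix x = ix y"
    then have "\<beta> x = \<beta> y" using mono[of x y] mono[of y x] by (metis less_irrefl linorder_neqE_nat)
    with xy have "g x = g y" by (simp add: ix_def)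
    with g(2) xy show "x = y" by (auto simp: inj_on_def)
  qed
  with mono show ?thesis by blast
qed

text \<open>Adding an element to a transversal doubles exactly one block, and a transversal is left only if one of the two elements of
that block is removed.\<close>

lemma transversal_swap:
  assumes R: "R \<in> transversals \<beta> B i" and x: "x \<in> B - R" and \<beta>: "\<beta> ` B \<subseteq> {1..i}"
  shows "\<exists>r\<in>R. \<beta> r = \<beta> x \<and> {y. y \<in> insert x R \<and> insert x R - {y} \<in> transversals \<beta> B i} = {x, r}"
proof -
  have R': "R \<subseteq> B" "inj_on \<beta> R" "\<beta> ` R = {1..i}" using R by (auto simp: transversals_def bij_betw_def)
  have "\<beta> x \<in> \<beta> ` R" using x \<beta> R'(3) by auto
  then obtain r where r: "r \<in> R" "\<beta> r = \<beta> x" by auto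
  have xr: "x \<noteq> r" using r x by auto
  have "y = x \<or> y = r" if y: "y \<in> insert x R" "insert x R - {y} \<in> transversals \<beta> B i" for y
  proof (rule ccontr)
    assume "\<not> (y = x \<or> y = r)"
    then have "x \<in> insert x R - {y}" "r \<in> insert x R - {y}" using r by auto
    moreover have "inj_on \<beta> (insert x R - {y})" using y(2) by (auto simp: transversals_def bij_betw_def)
    ultimately show False using r xr by (auto dest: inj_onD)
  qed
  moreover have "insert x R - {x} \<in> transversals \<beta> B i" using R x by simp
  moreover have "insert x R - {r} \<in> transversals \<beta> B i"
  proof -
    have "inj_on \<beta> (insert x R - {r})"
      using R'(2) r xr x by (auto simp: inj_on_def)
    moreover have "\<beta> ` (insert x R - {r}) = \<beta> ` R"
    proof -
      have "insert x R - {r} = insert x (R - {r})" using xr by auto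
      moreover have "R = insert r (R - {r})" using r by auto
      ultimately show ?thesis using r(2) by (metis image_insert)
    qed
    ultimately show ?thesis using R' x by (auto simp: transversals_def bij_betw_def)
  qed
  ultimately show ?thesis using r by (intro bexI[of _ r]) auto
qed

text \<open>Two elements of the same block have the same elements of \<open>C\<close> below them, so only their mutual order counts.\<close>

lemma koszul_sign_same_block:
  fixes \<beta> :: "'x \<Rightarrow> nat"
  assumes X: "finite X" and ix: "inj_on ix X" "\<And>x y. x \<in> X \<Longrightarrow> y \<in> X \<Longrightarrow> \<beta> x < \<beta> y \<Longrightarrow> ix x < ix y"
    and C: "C \<subseteq> X" "x \<in> X - C" "r \<in> X - C" "x \<noteq> r" "\<beta> r = \<beta> x" "\<And>y. y \<in> C \<Longrightarrow> \<beta> y \<noteq> \<beta> x"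
  shows "koszul_sign ix x (insert r C) + koszul_sign ix r (insert x C) = (0 :: 'a::comm_ring_1)"
proof -
  have finC: "finite C" using X C(1) finite_subset by auto
  have "ix y < ix x \<longleftrightarrow> ix y < ix r" if y: "y \<in> C" for y
  proof (cases "\<beta> y < \<beta> x")
    case True
    then show ?thesis using ix(2)[of y x] ix(2)[of y r] y C by auto
  next
    case False
    then have "\<beta> x < \<beta> y" using C(6)[OF y] by simp
    then show ?thesis using ix(2)[of x y] ix(2)[of r y] y C by force
  qed
  then have "{y \<in> C. ix y < ix x} = {y \<in> C. ix y < ix r}" by auto
  then have same: "koszul_sign ix x C = (koszul_sign ix r C :: 'a)" by (simp add: koszul_sign_def)
  have "ix x \<noteq> ix r" using ix(1) C by (auto simp: inj_on_def)
  then show ?thesis using finC C same by (auto simp: koszul_sign_insert)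
qed

text \<open>The coboundary of the sum over all transversals vanishes on the faces in question. By the condition on \<open>g\<close> a face that
contributes is a transversal with one more element of \<open>B\<close>; it contains two transversals, and they enter with opposite
signs. Grouping the terms by faces makes the argument work in characteristic 2.\<close>

lemma sum_transversal_cofaces:
  fixes g :: "'x set \<Rightarrow> 'a::comm_ring_1"
  assumes X: "finite X" and ix: "inj_on ix X" "\<And>x y. x \<in> X \<Longrightarrow> y \<in> X \<Longrightarrow> \<beta> x < \<beta> y \<Longrightarrow> ix x < ix y"
    and B: "B \<subseteq> X" "\<beta> ` B \<subseteq> {1..i}"
    and g: "\<And>R x. R \<in> transversals \<beta> B i \<Longrightarrow> x \<in> X - R \<Longrightarrow> g (insert x R) \<noteq> 0 \<Longrightarrow> x \<in> B"
  shows "(\<Sum>R\<in>transversals \<beta> B i. \<Sum>x\<in>X - R. koszul_sign ix x R * g (insert x R)) = 0"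
proof -
  let ?T = "transversals \<beta> B i"
  have finB: "finite B" using X B finite_subset by auto
  have finT: "finite ?T" by (rule finite_transversals[OF finB])
  define P where "P = (SIGMA R:?T. B - R)"
  have finP: "finite P" using finT finB by (auto simp: P_def)
  have RX: "R \<subseteq> X" if "R \<in> ?T" for R using that B by (auto simp: transversals_def)
  have "(\<Sum>R\<in>?T. \<Sum>x\<in>X - R. koszul_sign ix x R * g (insert x R)) = (\<Sum>R\<in>?T. \<Sum>x\<in>B - R. koszul_sign ix x R * g (insert x R))"
  proof (rule sum.cong[OF refl], rule sum.mono_neutral_right)
    fix R assume R: "R \<in> ?T"
    show "\<forall>x\<in>X - R - (B - R). koszul_sign ix x R * g (insert x R) = 0" using g[OF R] by fastforce
  qed (use X B in auto)
  also have "\<dots> = (\<Sum>p\<in>P. koszul_sign ix (snd p) (fst p) * g (insert (snd p) (fst p)))"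
    unfolding P_def using finT finB by (subst sum.Sigma) (auto simp: case_prod_unfold)
  also have "\<dots> = (\<Sum>S\<in>(\<lambda>p. insert (snd p) (fst p)) ` P. \<Sum>p\<in>{p \<in> P. insert (snd p) (fst p) = S}.
      koszul_sign ix (snd p) (fst p) * g (insert (snd p) (fst p)))"
    by (rule sum.image_gen[OF finP])
  also have "\<dots> = 0"
  proof (rule sum.neutral, intro ballI)
    fix S assume "S \<in> (\<lambda>p. insert (snd p) (fst p)) ` P"
    then obtain R x where Rx: "R \<in> ?T" "x \<in> B - R" "S = insert x R" by (auto simp: P_def)
    obtain r where r: "r \<in> R" "\<beta> r = \<beta> x" "{y. y \<in> S \<and> S - {y} \<in> ?T} = {x, r}"
      using transversal_swap[OF Rx(1,2) B(2)] Rx(3) by blast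
    have xr: "x \<noteq> r" using Rx r by auto
    define C where "C = R - {r}"
    have C: "S - {x} = insert r C" "S - {r} = insert x C" using Rx r xr by (auto simp: C_def)
    have SB: "S \<subseteq> B" using Rx by (auto simp: transversals_def)
    have eq: "{p \<in> P. insert (snd p) (fst p) = S} = (\<lambda>y. (S - {y}, y)) ` {y. y \<in> S \<and> S - {y} \<in> ?T}"
      using SB by (auto simp: P_def image_iff)
    have "(\<Sum>p\<in>{p \<in> P. insert (snd p) (fst p) = S}. koszul_sign ix (snd p) (fst p) * g (insert (snd p) (fst p)))
        = (\<Sum>y\<in>{x, r}. koszul_sign ix y (S - {y}) * g (insert y (S - {y})))"
      unfolding eq r(3) by (subst sum.reindex) (auto simp: inj_on_def)
    also have "\<dots> = (koszul_sign ix x (insert r C) + koszul_sign ix r (insert x C)) * g S"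
      using xr Rx r C by (simp add: insert_absorb distrib_right)
    also have "koszul_sign ix x (insert r C) + koszul_sign ix r (insert x C) = (0 :: 'a)"
    proof (rule koszul_sign_same_block[OF X ix])
      have inj: "inj_on \<beta> R" using Rx(1) by (auto simp: transversals_def bij_betw_def)
      show "\<beta> y \<noteq> \<beta> x" if "y \<in> C" for y
        using inj_onD[OF inj, of y r] r that by (auto simp: C_def)
    qed (use RX[OF Rx(1)] Rx B r xr in \<open>auto simp: C_def\<close>)
    finally show "(\<Sum>p\<in>{p \<in> P. insert (snd p) (fst p) = S}. koszul_sign ix (snd p) (fst p) * g (insert (snd p) (fst p))) = 0"
      by simp
  qed
  finally show ?thesis .
qed

section \<open>Non-vanishing Betti numbers from a configuration of edges\<close>

lemma prod_rees_gen:
  assumes "finite S"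
  shows "(\<Prod>x\<in>S. rees_gen x) = tmon (chi (Inl -` S) + (\<Sum>e\<in>Inr -` S. chi e)) (card (Inr -` S))"
  using assms
proof (induction S rule: finite_induct)
  case empty
  show ?case by (simp add: chi_def)
next
  case (insert x S)
  have fin: "finite (Inl -` S)" "finite (Inr -` S)"
    using insert.hyps(1) by (auto intro!: finite_vimageI simp: inj_def)
  show ?case
  proof (cases x)
    case (Inl i)
    have "Inl -` insert x S = insert i (Inl -` S)" "Inr -` insert x S = Inr -` S" using Inl by auto
    moreover have "i \<notin> Inl -` S" using Inl insert.hyps by auto
    ultimately show ?thesis using insert fin
      by (simp add: Inl rees_gen_Inl tmon_mult chi_def add.assoc del: rees_gen.simps)
  next
    case (Inr e)
    have "Inr -` insert x S = insert e (Inr -` S)" "Inl -` insert x S = Inl -` S" using Inr by auto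
    moreover have "e \<notin> Inr -` S" using Inr insert.hyps by auto
    ultimately show ?thesis using insert fin
      by (simp add: Inr rees_gen_Inr tmon_mult ac_simps del: rees_gen.simps)
  qed
qed

lemma coef_mult_tmon:
  fixes y :: "(nat, 'k::field) mpoly poly"
  assumes "coef (coeff (y * tmon b t) s) a \<noteq> 0"
  shows "\<exists>m. t \<le> s \<and> a = m + b \<and> m \<in> supp (coeff y (s - t))"
proof -
  have ts: "t \<le> s" "coef (coeff y (s - t) * sing b 1) a \<noteq> 0"
    using assms by (auto simp: mult.commute[of y] mult.commute[of "coeff y _"] coeff_monom_mult split: if_splits)
  then have "a \<in> supp (coeff y (s - t) * sing b 1)" by (simp add: in_keys_iff)
  then show ?thesis using ts(1) keys_mult[of "coeff y (s - t)" "sing b 1"] by auto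
qed

lemma koszul_sign_mult_coeff: "coef (coeff (koszul_sign ix x R * f) s) m = koszul_sign ix x R * coef (coeff (f :: (nat, 'k::field) mpoly poly) s) m"
  by (cases "even (card {y \<in> R. ix y < ix x})") (simp_all add: koszul_sign_def)

lemma chi_union: "finite A \<Longrightarrow> finite B \<Longrightarrow> A \<inter> B = {} \<Longrightarrow> chi (A \<union> B) = chi A + chi B"
  by (simp add: chi_def sum.union_disjoint)

text \<open>The faces of the simplicial complex at \<open>\<alpha> = x\<^sub>W T\<close>: the power of \<open>T\<close> allows only one edge \<open>e\<close>, which is either in \<open>S\<close> or
a factor of the quotient \<open>\<alpha> / \<Prod>S\<close>, and all vertices in \<open>S\<close> avoid \<open>e\<close> since \<open>\<alpha>\<close> is squarefree in the vertices.\<close>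

lemma squarefree_face:
  fixes y :: "(nat, 'k::field) mpoly poly"
  assumes G: "simple_graph n E" and y: "y \<in> rees_algebra (mpoly_ring {1..n}) (edge_ideal n E)"
    and S: "S \<subseteq> {1..n} <+> E" and W: "finite W" and nz: "coef (coeff (y * (\<Prod>x\<in>S. rees_gen x)) 1) (chi W) \<noteq> 0"
  shows "\<exists>e\<in>E. e \<subseteq> W \<and> Inl -` S \<subseteq> W - e \<and> Inr -` S \<subseteq> {e}"
proof -
  have "finite S" using S finite_XG[OF G] finite_subset by blast
  let ?V = "Inl -` S" and ?F = "Inr -` S"
  have fin: "finite ?V" "finite ?F"
    using \<open>finite S\<close> by (auto intro!: finite_vimageI simp: inj_def)
  have FE: "?F \<subseteq> E" using S by auto
  obtain m where m: "card ?F \<le> 1" "chi W = m + (chi ?V + (\<Sum>e\<in>?F. chi e))" "m \<in> supp (coeff y (1 - card ?F))"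
    using coef_mult_tmon nz unfolding prod_rees_gen[OF \<open>finite S\<close>] by blast
  have mn: "m \<in> power_exponents n E (1 - card ?F)"
    using y m(3) unfolding rees_algebra_eq[OF G] power_span_def by blast
  obtain e m' where e: "e \<in> E" "?F \<subseteq> {e}" "chi W = chi e + m' + chi ?V"
  proof (cases "?F = {}")
    case True
    then have "m \<in> power_exponents n E 1" using mn by simp
    then obtain e m' where "m = chi e + m'" "e \<in> E" by auto
    then show ?thesis using that[of e m'] m(2) True by simp
  next
    case False
    then have "card ?F = 1" using m(1) fin(2) by (metis One_nat_def card_gt_0_iff le_antisym Suc_leI)
    then obtain f where f: "?F = {f}" by (auto simp: card_1_singleton_iff)
    then show ?thesis using that[of f m] m(2) FE by (simp add: ac_simps)
  qed
  have fe: "finite e" using edge_finite[OF G e(1)] .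
  have eq: "(if v \<in> W then 1 else 0) = (if v \<in> e then 1 else 0) + coef m' v + (if v \<in> ?V then 1 else 0 :: nat)" for v
    using arg_cong[OF e(3), of "\<lambda>p. coef p v"] fe W fin(1) by (simp add: lookup_add coef_chi)
  have "e \<subseteq> W"
  proof
    fix v assume "v \<in> e"
    then show "v \<in> W" using eq[of v] by (simp split: if_splits)
  qed
  moreover have "?V \<subseteq> W - e"
  proof
    fix v assume "v \<in> ?V"
    then show "v \<in> W - e" using eq[of v] by (simp split: if_splits)
  qed
  ultimately show ?thesis using e(1,2) by blast
qed

text \<open>The condition \<open>hit\<close> says that a transversal of the blocks of \<open>W - e1\<close> meets every edge inside \<open>W\<close> other than \<open>e1\<close>, so that \<open>e1\<close> and
\<open>W - e1\<close> form the only facet that contains it; the edge \<open>e1\<close> itself is added to block 1. The condition \<open>miss\<close> says that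
every facet of the simplex on \<open>A0\<close> is a face; its boundary is the cycle. The only facet of this simplex that is
a transversal is the one opposite to \<open>a0\<close>, so the value of the cocycle at the cycle is a sign.\<close>

lemma betti_configuration:
  fixes \<beta> :: "nat \<Rightarrow> nat"
  assumes G: "simple_graph n E"
    and W: "W \<subseteq> {1..n}" and e1: "e1 \<in> E" "e1 \<subseteq> W"
    and i: "1 \<le> i" and \<beta>: "\<beta> ` (W - e1) \<subseteq> {1..i}"
    and hit: "\<And>U e. U \<subseteq> W - e1 \<Longrightarrow> {1..i} \<subseteq> \<beta> ` U \<Longrightarrow> e \<in> E \<Longrightarrow> e \<subseteq> W \<Longrightarrow> e \<inter> U = {} \<Longrightarrow> e = e1"
    and A0: "A0 \<subseteq> W" "a0 \<in> A0" "a0 \<in> e1" "A0 - {a0} \<subseteq> W - e1" "bij_betw \<beta> (A0 - {a0}) {1..i}"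
    and miss: "\<And>a. a \<in> A0 \<Longrightarrow> \<exists>e\<in>E. e \<subseteq> W - (A0 - {a})"
  shows "algebra_betti ({1..n} <+> E) (\<lambda>c::'k::field. [:mconst c:]) rees_gen
     (rees_algebra (mpoly_ring {1..n}) (edge_ideal n E)) i (int (card W) - 1) \<noteq> 0"
proof -
  let ?X = "{1..n} <+> E"
  let ?A = "rees_algebra (mpoly_ring {1..n}) (edge_ideal n E) :: (nat, 'k) mpoly poly set"
  interpret sg: standard_graded "\<lambda>c::'k. [:mconst c:]" rees_gen ?X ?A
    by (rule rees_standard_graded[OF G])
  have finW: "finite W" using W finite_subset by auto
  have finA0: "finite A0" using A0(1) finW finite_subset by auto
  \<comment> \<open>The generator of \<open>e1\<close> joins block 1; the generators of the other edges stay outside \<open>B\<close>.\<close>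
  define b where "b x = (case x of Inl v \<Rightarrow> \<beta> v | Inr e \<Rightarrow> 1)" for x :: "nat + nat set"
  define B where "B = Inl ` (W - e1) \<union> {Inr e1}"
  have BX: "B \<subseteq> ?X" "b ` B \<subseteq> {1..i}" using W e1 \<beta> i by (auto simp: B_def b_def)
  obtain ix :: "nat + nat set \<Rightarrow> nat" where ix: "inj_on ix ?X" "\<And>x y. x \<in> ?X \<Longrightarrow> y \<in> ?X \<Longrightarrow> b x < b y \<Longrightarrow> ix x < ix y"
    using block_order_exists[of ?X b] finite_XG[OF G] by blast
  \<comment> \<open>Multiplying \<open>z R\<close> by the generators in \<open>R\<close> reads off the coefficient of \<open>z R\<close> at \<open>\<alpha> / \<Prod>R\<close> without dividing.\<close>
  define \<phi> where "\<phi> z = (\<Sum>R\<in>transversals b B i. coef (coeff (z R * (\<Prod>x\<in>R. rees_gen x)) 1) (chi W))"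
    for z :: "(nat + nat set) set \<Rightarrow> (nat, 'k) mpoly poly"
  have face: "x \<in> B" if R: "R \<in> transversals b B i" and x: "x \<in> ?X - R" and y: "y \<in> ?A"
    and nz: "coef (coeff (y * (\<Prod>x\<in>insert x R. rees_gen x)) 1) (chi W) \<noteq> 0" for R x y
  proof -
    have RB: "R \<subseteq> B" "b ` R = {1..i}" using R by (auto simp: transversals_def bij_betw_def)
    have "insert x R \<subseteq> ?X" using RB BX x by auto
    from squarefree_face[OF G y this finW nz] obtain e where
      e: "e \<in> E" "e \<subseteq> W" "Inl -` insert x R \<subseteq> W - e" "Inr -` insert x R \<subseteq> {e}" by blast
    have "e = e1"
    proof (cases "Inr e1 \<in> R")
      case True
      then show ?thesis using e(4) by auto
    next
      case False
      then have R': "R = Inl ` (Inl -` R)" using RB by (auto simp: B_def)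
      have "b ` R = b ` Inl ` (Inl -` R)" by (rule arg_cong[OF R'])
      also have "\<dots> = \<beta> ` (Inl -` R)" by (simp add: image_image b_def del: image_vimage_eq)
      finally have "{1..i} \<subseteq> \<beta> ` (Inl -` R)" using RB(2) by simp
      moreover have "Inl -` R \<subseteq> W - e1" using RB(1) by (auto simp: B_def)
      moreover have "e \<inter> (Inl -` R) = {}" using e(3) by auto
      ultimately show ?thesis using hit e(1,2) by blast
    qed
    then show ?thesis using e(3,4) by (cases x) (auto simp: B_def)
  qed
  have \<phi>_kos: "\<phi> (koszul ?X ix rees_gen y) = 0" if y: "\<And>S. y S \<in> ?A" for y
  proof -
    define g where "g S = coef (coeff (y S * (\<Prod>x\<in>S. rees_gen x)) 1) (chi W)" for S
    have "\<phi> (koszul ?X ix rees_gen y) = (\<Sum>R\<in>transversals b B i. \<Sum>x\<in>?X - R. koszul_sign ix x R * g (insert x R))"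
      unfolding \<phi>_def
    proof (rule sum.cong[OF refl])
      fix R assume R: "R \<in> transversals b B i"
      then have "R \<subseteq> ?X" using BX by (auto simp: transversals_def)
      then have finR: "finite R" using sg.X finite_subset by blast
      have "koszul ?X ix rees_gen y R * (\<Prod>x\<in>R. rees_gen x) =
          (\<Sum>x\<in>?X - R. koszul_sign ix x R * (y (insert x R) * (\<Prod>x\<in>insert x R. rees_gen x)))"
        unfolding koszul_def sum_distrib_right using finR
        by (intro sum.cong) (auto simp: ac_simps simp del: rees_gen.simps)
      then show "coef (coeff (koszul ?X ix rees_gen y R * (\<Prod>x\<in>R. rees_gen x)) 1) (chi W) =
          (\<Sum>x\<in>?X - R. koszul_sign ix x R * g (insert x R))"
        by (simp only: coeff_sum lookup_sum koszul_sign_mult_coeff g_def)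
    qed
    also have "\<dots> = 0"
      by (rule sum_transversal_cofaces[OF sg.X ix BX]) (use face y in \<open>auto simp only: g_def\<close>)
    finally show ?thesis .
  qed
  \<comment> \<open>\<open>w\<close> is the simplex on \<open>A0\<close>. Its coefficient need not be in \<open>A\<close>, only the coefficients of its boundary \<open>z\<close> are.\<close>
  define w where "w S = (if S = Inl ` A0 then tmon (chi (W - A0)) 1 else 0 :: (nat, 'k) mpoly poly)" for S :: "(nat + nat set) set"
  define z where "z = koszul ?X ix rees_gen w"
  have zval: "z (Inl ` (A0 - {a})) = koszul_sign ix (Inl a) (Inl ` (A0 - {a})) * tmon (chi (W - (A0 - {a}))) 1" if a: "a \<in> A0" for a
  proof -
    let ?R = "Inl ` (A0 - {a}) :: (nat + nat set) set"
    have eq: "insert x ?R = Inl ` A0 \<longleftrightarrow> x = Inl a" if "x \<notin> ?R" for x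
      using that a by (auto simp: set_eq_iff image_iff)
    have "z ?R = (\<Sum>x\<in>?X - ?R. if x = Inl a then koszul_sign ix (Inl a) ?R * rees_gen (Inl a) * tmon (chi (W - A0)) 1 else 0)"
      unfolding z_def koszul_def by (rule sum.cong) (auto simp: w_def eq simp del: rees_gen.simps)
    also have "\<dots> = koszul_sign ix (Inl a) ?R * (rees_gen (Inl a) * tmon (chi (W - A0)) 1)"
      using a A0(1) W sg.X by (subst sum.delta) (auto simp: mult.assoc simp del: rees_gen.simps)
    also have "rees_gen (Inl a) * tmon (chi (W - A0)) 1 = tmon (chi (insert a (W - A0))) 1"
      using finW a by (simp add: rees_gen_Inl tmon_mult chi_def del: rees_gen.simps)
    also have "insert a (W - A0) = W - (A0 - {a})" using a A0(1) by auto
    finally show ?thesis .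
  qed
  have z0: "z R = 0" if R: "\<And>a. a \<in> A0 \<Longrightarrow> R \<noteq> Inl ` (A0 - {a})" for R
  proof -
    have "w (insert x R) = 0" if x: "x \<in> ?X - R" for x
    proof (rule ccontr)
      assume "w (insert x R) \<noteq> 0"
      then have ins: "insert x R = Inl ` A0" by (auto simp: w_def split: if_splits)
      then obtain a where a: "a \<in> A0" "x = Inl a" by auto
      have "R = insert x R - {x}" using x by auto
      also have "\<dots> = Inl ` (A0 - {a})" unfolding ins unfolding a(2) by auto
      finally show False using R[OF a(1)] by simp
    qed
    then show ?thesis by (simp add: z_def koszul_def)
  qed
  have cardA0: "card (A0 - {a}) = i" if "a \<in> A0" for a
    using bij_betw_same_card[OF A0(5)] A0(2) that finA0 by (simp add: card_Diff_singleton)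
  show ?thesis
  proof (rule sg.betti_nonzero[OF ix(1), of i z])
    show "koszul ?X ix rees_gen z R = 0" if "R \<subseteq> ?X" for R
      unfolding z_def by (rule koszul_koszul[OF sg.X ix(1) that])
    fix S
    show "if S \<subseteq> ?X \<and> card S = i then z S \<in> rg.ev ` mpolys_hom ?X (int (card W) - 1 - int i) else z S = 0"
    proof (cases "\<exists>a\<in>A0. S = Inl ` (A0 - {a})")
      case True
      then obtain a where a: "a \<in> A0" "S = Inl ` (A0 - {a})" by blast
      let ?U = "W - (A0 - {a})"
      obtain e where e: "e \<in> E" "e \<subseteq> ?U" using miss[OF a(1)] by blast
      have "chi ?U = chi e + chi (?U - e)"
        using chi_union[of e "?U - e"] finW e(2) finite_subset[OF e(2)] by (simp add: Un_absorb1)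
      moreover have "supp (chi (?U - e)) \<subseteq> {1..n}" using W finW by (subst supp_chi) auto
      ultimately have "chi ?U \<in> power_exponents n E 1" using e(1) by auto
      from tmon_in_image[OF G this, of "1::'k"]
      obtain p :: "(nat + nat set, 'k) mpoly"
        where p: "p \<in> mpolys_hom ?X (int (card ?U) - 1)" "tmon (chi ?U) 1 = rg.ev p"
        by (auto simp: mdeg_chi)
      have "card ?U = card W - i" using cardA0[OF a(1)] A0(1) finA0 by (subst card_Diff_subset) auto
      moreover have "i \<le> card W"
        using cardA0[OF a(1)] card_mono[OF finW, of "A0 - {a}"] A0(1) by auto
      ultimately have deg: "int (card ?U) - 1 = int (card W) - 1 - int i" by simp
      have "z S = rg.ev (koszul_sign ix (Inl a) S * p)"
        unfolding rg.ev_mult rg.ev_koszul_sign p(2)[symmetric] a(2) by (rule zval[OF a(1)])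
      moreover have "koszul_sign ix (Inl a) S * p \<in> mpolys_hom ?X (int (card W) - 1 - int i)"
        using koszul_sign_mpolys_hom[OF p(1)] unfolding deg .
      moreover have "S \<subseteq> ?X \<and> card S = i"
        using a A0(1) W cardA0[OF a(1)] by (auto simp: card_image)
      ultimately show ?thesis by simp
    next
      case False
      then have "z S = 0" using z0 by blast
      moreover have "(0 :: (nat, 'k) mpoly poly) \<in> rg.ev ` mpolys_hom ?X (int (card W) - 1 - int i)"
        by (rule image_eqI[of _ _ 0]) auto
      ultimately show ?thesis by simp
    qed
  next
    fix y :: "(nat + nat set) set \<Rightarrow> (nat, 'k) mpoly poly" assume y: "\<And>S. y S \<in> ?A"
    let ?R = "Inl ` (A0 - {a0}) :: (nat + nat set) set"
    have RT: "?R \<in> transversals b B i"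
    proof -
      have "bij_betw b ?R {1..i}"
        using A0(5) unfolding bij_betw_def by (auto simp: inj_on_def b_def image_image)
      then show ?thesis using A0(4) by (auto simp: transversals_def B_def)
    qed
    have "coef (coeff (z R * (\<Prod>x\<in>R. rees_gen x)) 1) (chi W) = 0" if R: "R \<in> transversals b B i" "R \<noteq> ?R" for R
    proof -
      have "R \<noteq> Inl ` (A0 - {a})" if a: "a \<in> A0" for a
      proof
        assume eq: "R = Inl ` (A0 - {a})"
        with R(2) have "a \<noteq> a0" by auto
        then have "Inl a0 \<in> R" using eq A0(2) by auto
        then show False using R(1) A0(3) by (auto simp: transversals_def B_def)
      qed
      then show ?thesis by (simp add: z0)
    qed
    then have "\<phi> z = coef (coeff (z ?R * (\<Prod>x\<in>?R. rees_gen x)) 1) (chi W)"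
      unfolding \<phi>_def using RT finite_transversals[of B b i] finW
      by (subst sum.remove[OF _ RT]) (auto simp: B_def intro!: sum.neutral)
    also have "(\<Prod>x\<in>?R. rees_gen x) = (tmon (chi (A0 - {a0})) 0 :: (nat, 'k) mpoly poly)"
    proof -
      have "Inl -` ?R = A0 - {a0}" "Inr -` ?R = {}" by auto
      then show ?thesis using finA0 by (subst prod_rees_gen) auto
    qed
    also have "z ?R * tmon (chi (A0 - {a0})) 0 = koszul_sign ix (Inl a0) ?R * tmon (chi W) 1"
    proof -
      have "chi (W - (A0 - {a0})) + chi (A0 - {a0}) = chi W"
        using chi_union[of "W - (A0 - {a0})" "A0 - {a0}"] finW finA0 A0(1)
        by (metis Diff_disjoint Diff_partition Diff_subset Int_commute Un_commute finite_Diff subset_trans)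
      then show ?thesis unfolding zval[OF A0(2)] mult.assoc tmon_mult by simp
    qed
    also have "coef (coeff (koszul_sign ix (Inl a0) ?R * tmon (chi W) 1) 1) (chi W) = (koszul_sign ix (Inl a0) ?R :: 'k)"
      unfolding koszul_sign_mult_coeff by simp
    finally have "\<phi> z \<noteq> 0" using koszul_sign_cases[of ix "Inl a0" ?R, where 'a = 'k] by auto
    then show "koszul ?X ix rees_gen y \<noteq> z" using \<phi>_kos[of y] y by metis
  qed
qed

section \<open>Configurations from induced matchings\<close>

lemma indmat_attained:
  assumes "simple_graph n E"
  shows "\<exists>M. induced_matching E M \<and> card M = indmat E"
    and "induced_matching E M \<Longrightarrow> card M \<le> indmat E"
proof -
  let ?S = "{card M | M. induced_matching E M}"
  have "finite E" using assms finite_subset[of E "Pow {1..n}"] by (auto simp: simple_graph_def)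
  have "?S \<subseteq> card ` Pow E" by (auto simp: induced_matching_def matching_def)
  then have fin: "finite ?S" by (rule finite_subset) (use \<open>finite E\<close> in simp)
  have "induced_matching E {}" by (simp add: induced_matching_def matching_def)
  then have "?S \<noteq> {}" by blast
  from Max_in[OF fin this] show "\<exists>M. induced_matching E M \<and> card M = indmat E"
    unfolding indmat_def by auto
  show "induced_matching E M \<Longrightarrow> card M \<le> indmat E"
    unfolding indmat_def using fin by (intro Max_ge) auto
qed

abbreviation rees_betti :: "'k::field itself \<Rightarrow> nat \<Rightarrow> nat set set \<Rightarrow> nat \<Rightarrow> int \<Rightarrow> nat" where
  "rees_betti K n E \<equiv> algebra_betti ({1..n} <+> E) (\<lambda>c::'k. [:mconst c:]) rees_gen
     (rees_algebra (mpoly_ring {1..n}) (edge_ideal n E))"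

text \<open>For edges \<open>a b\<close> and \<open>a c\<close>: the set \<open>W = {a, b, c}\<close>, the single block \<open>{c}\<close>, and the cycle given by the two points \<open>b\<close> and \<open>c\<close>,
which lie in different components.\<close>

lemma betti_adjacent_edges:
  assumes G: "simple_graph n E" and e: "e \<in> E" "f \<in> E" "e \<noteq> f" "e \<inter> f \<noteq> {}"
  shows "rees_betti TYPE('k::field) n E 1 2 \<noteq> 0"
proof -
  have ce: "card e = 2" "card f = 2" using edge_card[OF G] e by auto
  obtain a where a: "a \<in> e" "a \<in> f" using e by auto
  obtain b where b: "e = {a, b}" "a \<noteq> b" using ce(1) a(1) by (auto simp: card_2_iff)
  obtain c where c: "f = {a, c}" "a \<noteq> c" using ce(2) a(2) by (auto simp: card_2_iff)
  have bc: "b \<noteq> c" using b c e(3) by auto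
  have W: "{a, b, c} - e = {c}" using b c bc by auto
  have "rees_betti TYPE('k) n E 1 (int (card {a, b, c}) - 1) \<noteq> 0"
  proof (rule betti_configuration[OF G, where ?e1.0 = e and \<beta> = "\<lambda>_. 1" and ?a0.0 = b and ?A0.0 = "{b, c}"])
    show "{a, b, c} \<subseteq> {1..n}" using edge_sub[OF G] e b c by blast
  next
    fix U g assume U: "U \<subseteq> {a, b, c} - e" "{1..1} \<subseteq> (\<lambda>_. 1::nat) ` U" and g: "g \<in> E" "g \<subseteq> {a, b, c}" "g \<inter> U = {}"
    have "U = {c}" using U W by auto
    then have "g \<subseteq> e" using g b c by auto
    then show "g = e" using card_seteq[of e g] ce(1) edge_card[OF G g(1)] edge_finite[OF G e(1)] by auto
  next
    fix v assume "v \<in> {b, c}"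
    then consider "v = b" | "v = c" by blast
    then show "\<exists>g\<in>E. g \<subseteq> {a, b, c} - ({b, c} - {v})"
    proof cases
      case 1
      have "e \<subseteq> {a, b, c} - ({b, c} - {b})" using b c bc by auto
      then show ?thesis using e(1) 1 by blast
    next
      case 2
      have "f \<subseteq> {a, b, c} - ({b, c} - {c})" using b c bc by auto
      then show ?thesis using e(2) 2 by blast
    qed
  qed (use e b c bc in \<open>auto simp: bij_betw_def\<close>)
  moreover have "card {a, b, c} = 3" using b c bc by simp
  ultimately show ?thesis by simp
qed

text \<open>The blocks are the edges of the matching other than the distinguished edge \<open>h 0\<close>; the simplex has one vertex \<open>r k\<close> in each edge
\<open>h k\<close>. The matching is induced, so an edge inside \<open>W\<close> belongs to the matching and a transversal meets it unless it is \<open>h 0\<close>.\<close>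

lemma betti_induced_matching:
  assumes G: "simple_graph n E" and M: "induced_matching E M" and q: "card M = Suc i" "1 \<le> i"
  shows "rees_betti TYPE('k::field) n E i (2 * int i + 1) \<noteq> 0"
proof -
  have finM: "finite M" using q card.infinite by fastforce
  have ME: "M \<subseteq> E" using M by (simp add: induced_matching_def matching_def)
  have disj: "e \<inter> e' = {}" if "e \<in> M" "e' \<in> M" "e \<noteq> e'" for e e'
    using M that by (auto simp: induced_matching_def matching_def)
  have ind: "\<not> (e \<inter> f \<noteq> {} \<and> e' \<inter> f \<noteq> {})" if "e \<in> M" "e' \<in> M" "e \<noteq> e'" "f \<in> E" for e e' f
    using M that unfolding induced_matching_def by blast
  have card2: "card e = 2" and finE: "finite e" if "e \<in> M" for e
    using edge_card[OF G] edge_finite[OF G] ME that by auto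
  obtain h where h: "bij_betw h {0..<Suc i} M"
    using ex_bij_betw_nat_finite[OF finM] q by auto
  have hM: "h k \<in> M" if "k \<le> i" for k using h that by (auto simp: bij_betw_def)
  have h_inj: "h k = h l \<longleftrightarrow> k = l" if "k \<le> i" "l \<le> i" for k l
    using h that by (auto simp: bij_betw_def inj_on_def)
  have h_surj: "\<exists>k\<le>i. e = h k" if "e \<in> M" for e
  proof -
    have "e \<in> h ` {0..<Suc i}" using h that by (simp add: bij_betw_def)
    then obtain k where "e = h k" "k < Suc i" by auto
    then show ?thesis by (intro exI[of _ k]) simp
  qed
  define \<beta> where "\<beta> v = (THE k. k \<le> i \<and> v \<in> h k)" for v
  have \<beta>: "\<beta> v = k" if "k \<le> i" "v \<in> h k" for v k
    unfolding \<beta>_def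
  proof (rule the_equality)
    fix l assume "l \<le> i \<and> v \<in> h l"
    then show "l = k" using disj[OF hM hM, of l k] h_inj[of l k] that by auto
  qed (use that in auto)
  define r where "r k = (SOME v. v \<in> h k)" for k
  have r: "r k \<in> h k" if "k \<le> i" for k
  proof -
    have "h k \<noteq> {}" using card2[OF hM[OF that]] by auto
    then show ?thesis unfolding r_def by (simp add: some_in_eq)
  qed
  have r_in: "r k \<in> h l \<longleftrightarrow> k = l" if "k \<le> i" "l \<le> i" for k l
    using \<beta>[OF that(1) r[OF that(1)]] \<beta>[OF that(2), of "r k"] r[OF that(1)] by auto
  let ?W = "\<Union>M" and ?A = "r ` {0..i}"
  have W: "v \<in> ?W \<longleftrightarrow> (\<exists>k\<le>i. v \<in> h k)" for v using hM h_surj by blast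
  have rA: "?A - {r k} = r ` ({0..i} - {k})" if "k \<le> i" for k
    using r_in r that by (auto simp: image_iff) metis+
  have "rees_betti TYPE('k) n E i (int (card ?W) - 1) \<noteq> 0"
  proof (rule betti_configuration[OF G, where ?e1.0 = "h 0" and \<beta> = \<beta> and ?a0.0 = "r 0" and ?A0.0 = ?A])
    show "?W \<subseteq> {1..n}" using edge_sub[OF G] ME by blast
    show "h 0 \<in> E" "h 0 \<subseteq> ?W" using hM[of 0] ME by auto
    show "1 \<le> i" by fact
    show "\<beta> ` (?W - h 0) \<subseteq> {1..i}"
    proof
      fix k assume "k \<in> \<beta> ` (?W - h 0)"
      then obtain v where v: "k = \<beta> v" "v \<in> ?W" "v \<notin> h 0" by blast
      then obtain l where l: "l \<le> i" "v \<in> h l" using W[of v] by blast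
      then have "k = l" using \<beta> v(1) by simp
      moreover have "l \<noteq> 0" using v(3) l(2) by metis
      ultimately show "k \<in> {1..i}" using l(1) by simp
    qed
    show "e = h 0" if U: "U \<subseteq> ?W - h 0" "{1..i} \<subseteq> \<beta> ` U" and e: "e \<in> E" "e \<subseteq> ?W" "e \<inter> U = {}" for U e
    proof -
      have "e \<noteq> {}" using edge_card[OF G e(1)] by auto
      then obtain v k where v: "v \<in> e" "k \<le> i" "v \<in> h k" using e(2) W by blast
      have "e \<subseteq> h k"
      proof
        fix u assume u: "u \<in> e"
        then obtain l where l: "l \<le> i" "u \<in> h l" using e(2) W by blast
        then have "h l = h k" using ind[OF hM[OF l(1)] hM[OF v(2)] _ e(1)] u v by blast
        then show "u \<in> h k" using l by simp
      qed
      then have ek: "e = h k" using card_seteq[of "h k" e] card2 finE hM[OF v(2)] edge_card[OF G e(1)] by auto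
      have "k = 0"
      proof (rule ccontr)
        assume "k \<noteq> 0"
        then have "k \<in> \<beta> ` U" using U(2) v(2) by auto
        then obtain u where u: "u \<in> U" "\<beta> u = k" by auto
        obtain l where "l \<le> i" "u \<in> h l" using u(1) U(1) W by blast
        with \<beta>[of l u] u have "u \<in> h k" by simp
        then show False using u e(3) ek by auto
      qed
      then show ?thesis using ek by simp
    qed
    show "?A \<subseteq> ?W"
    proof
      fix v assume "v \<in> ?A"
      then obtain k where "k \<le> i" "v = r k" by auto
      then show "v \<in> ?W" using UnionI[OF hM r] by simp
    qed
    show "r 0 \<in> ?A" by auto
    show "r 0 \<in> h 0" using r by simp
    show "?A - {r 0} \<subseteq> ?W - h 0"
    proof
      fix v assume "v \<in> ?A - {r 0}"
      then obtain k where k: "k \<le> i" "v = r k" "v \<noteq> r 0" by auto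
      then have "k \<noteq> 0" by metis
      with k show "v \<in> ?W - h 0" using UnionI[OF hM[OF k(1)] r[OF k(1)]] r_in[of k 0] by simp
    qed
    show "bij_betw \<beta> (?A - {r 0}) {1..i}"
    proof -
      have "\<beta> (r k) = k" if "k \<le> i" for k using \<beta> r that by simp
      then show ?thesis unfolding rA[of 0, simplified]
        by (intro bij_betw_byWitness[where f' = r]) auto
    qed
    show "\<exists>e\<in>E. e \<subseteq> ?W - (?A - {a})" if a: "a \<in> ?A" for a
    proof -
      obtain k where k: "k \<le> i" "a = r k" using a by auto
      have "h k \<inter> r ` ({0..i} - {k}) = {}" using r_in[OF _ k(1)] by auto
      then show ?thesis unfolding k(2) rA[OF k(1)] using hM[OF k(1)] ME by (intro bexI[of _ "h k"]) auto
    qed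
  qed
  moreover have "card ?W = 2 * Suc i"
  proof -
    have "pairwise disjnt M" unfolding pairwise_def disjnt_def using disj by blast
    then have "card ?W = (\<Sum>e\<in>M. card e)" using finE by (rule card_Union_disjoint)
    also have "\<dots> = 2 * card M" using card2 by simp
    finally show ?thesis using q by simp
  qed
  ultimately show ?thesis by (simp add: algebra_simps)
qed

text \<open>The unit is not in the ideal generated by the vertices.\<close>

lemma betti_0_0_edgeless: "rees_betti TYPE('k::field) n {} 0 0 \<noteq> 0"
proof -
  have G: "simple_graph n {}" by (simp add: simple_graph_def)
  let ?X = "{1..n} <+> ({} :: nat set set)"
  let ?A = "rees_algebra (mpoly_ring {1..n}) (edge_ideal n {}) :: (nat, 'k) mpoly poly set"
  interpret sg: standard_graded "\<lambda>c::'k. [:mconst c:]" rees_gen ?X ?A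
    by (rule rees_standard_graded[OF G])
  obtain ix :: "nat + nat set \<Rightarrow> nat" where ix: "inj_on ix ?X"
    using finite_imp_inj_to_nat_seg[OF sg.X] by metis
  define z where "z S = (if S = {} then 1 else 0 :: (nat, 'k) mpoly poly)" for S :: "(nat + nat set) set"
  show ?thesis
  proof (rule sg.betti_nonzero[OF ix, where z = z])
    have "(1 :: (nat + nat set, 'k) mpoly) \<in> mpolys_hom ?X 0"
      using mpolys_hom_mconst[of "1::'k" ?X] by (simp add: mconst_def)
    then have "(rg.ev (1 :: (nat + nat set, 'k) mpoly) :: (nat, 'k) mpoly poly) \<in> rg.ev ` mpolys_hom ?X 0"
      by (rule imageI)
    moreover have "finite S" if "S \<subseteq> ?X" for S using that sg.X finite_subset by blast
    ultimately show "if S \<subseteq> ?X \<and> card S = 0 then z S \<in> rg.ev ` mpolys_hom ?X (0 - int 0) else z S = 0" for S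
      by (auto simp: z_def)
    show "koszul ?X ix rees_gen z R = 0" for R by (simp add: koszul_def z_def)
    fix y :: "(nat + nat set) set \<Rightarrow> (nat, 'k) mpoly poly"
    show "koszul ?X ix rees_gen y \<noteq> z"
    proof
      assume eq: "koszul ?X ix rees_gen y = z"
      have "coef (coeff (koszul ?X ix rees_gen y {}) 0) 0 = (\<Sum>x\<in>?X. 0)"
        unfolding koszul_def coeff_sum lookup_sum mult.assoc koszul_sign_mult_coeff
        by (rule sum.cong) (auto simp: coef_mvar_mult)
      then show False unfolding eq by (simp add: z_def)
    qed
  qed
qed

theorem proposition2p5:
  fixes n :: nat and E :: "nat set set"
  assumes "simple_graph n E"
    and "card E \<noteq> 1"
  shows "int (indmat E) \<le> rees_edge_reg TYPE('k::field) n E"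
proof -
  note G = assms(1)
  interpret sg: standard_graded "\<lambda>c::'k. [:mconst c:]" rees_gen "{1..n} <+> E"
    "rees_algebra (mpoly_ring {1..n}) (edge_ideal n E)"
    by (rule rees_standard_graded[OF G])
  have reg: "int d \<le> rees_edge_reg TYPE('k) n E" if "rees_betti TYPE('k) n E i (int i + int d) \<noteq> 0" for i d
    using sg.reg_ge[OF that] by (simp add: rees_edge_reg_def)
  obtain M where M: "induced_matching E M" "card M = indmat E" using indmat_attained(1)[OF G] by blast
  consider "E = {}" | "E \<noteq> {}" "indmat E \<le> 1" | "2 \<le> indmat E" by linarith
  then show ?thesis
  proof cases
    case 1
    then have "M = {}" using M(1) by (auto simp: induced_matching_def matching_def)
    then have "indmat E = 0" using M(2) by simp
    then show ?thesis using reg[of 0 0] betti_0_0_edgeless[of n, where 'k = 'k] 1 by simp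
  next
    case 2
    \<comment> \<open>Two disjoint edges do not form an induced matching here, so a third edge meets both.\<close>
    have "\<exists>e\<in>E. \<exists>f\<in>E. e \<noteq> f \<and> e \<inter> f \<noteq> {}"
    proof -
      obtain e where e: "e \<in> E" using 2 by auto
      have "E \<noteq> {e}" using assms(2) by auto
      then obtain f where f: "f \<in> E" "f \<noteq> e" using e by blast
      show ?thesis
      proof (cases "e \<inter> f = {}")
        case True
        have "\<not> induced_matching E {e, f}"
          using indmat_attained(2)[OF G, of "{e, f}"] 2 f(2) by auto
        moreover have "matching E {e, f}" using e f True by (auto simp: matching_def)
        ultimately obtain g where "g \<in> E" "e \<inter> g \<noteq> {}" "f \<inter> g \<noteq> {}"
          unfolding induced_matching_def by blast
        moreover from this have "g \<noteq> e" using True by auto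
        ultimately show ?thesis using e by blast
      qed (use e f in blast)
    qed
    then have "rees_betti TYPE('k) n E 1 2 \<noteq> 0" using betti_adjacent_edges[OF G] by blast
    then show ?thesis using reg[of 1 1] 2(2) by simp
  next
    case 3
    define i where "i = indmat E - 1"
    have i: "indmat E = Suc i" "1 \<le> i" using 3 by (simp_all add: i_def)
    have "rees_betti TYPE('k) n E i (2 * int i + 1) \<noteq> 0"
      by (rule betti_induced_matching[OF G M(1)]) (use M i in auto)
    then show ?thesis using reg[of i "Suc i"] i by (simp add: algebra_simps)
  qed
qed

end
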